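(* Let $n\geq 1$ and let $X=(X_t)_{t\ge 0}$ be an $n$-dimensional Lévy process with characteristic exponent $\psi$ and without a Gaussian component (i.e. $Q=0$ in the Lévy–Khintchine representation of $\psi$). The following conditions are equivalent: (a) $\displaystyle\lim_{|\xi|\to\infty}\frac{\operatorname{Re}\psi(\xi)}{\ln(1+|\xi|)}=\infty$; (b) for all $t>0$ the transition density $p_t$ exists, $p_t\in C^\infty(\mathbb R^n)$ and $\nabla^\alpha p_t\in L_1(\mathbb R^n)\cap C_\infty(\mathbb R^n)$ for all $\alpha\in\mathbb N_0^n$; (c) for all $t>0$ the transition density $p_t$ exists and $p_t,\nabla p_t\in L_1(\mathbb R^n)$. If moreover $X$ is isotropic with $\psi(\xi)=g(|\xi|^2)$ for an increasing function $g$, then the conditions (a), (b), (c) are also equivalent to each of the following: (d) for all $t>0$ the transition density $p_t$ exists and $p_t\in C_\infty(\mathbb R^n)$; (e) for all $t>0$ the transition density $p_t$ exists and $p_t\in L_\infty(\mathbb R^n)$; (f) $e^{-t\psi}\in L_1(\mathbb R^n)$ for all $t>0$.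
   Context: A Lévy process $X=(X_t)_{t\ge0}$ in $\mathbb R^n$ has independent and stationary increments and càdlàg paths; $\mathbb P_0,\mathbb E_0$ refer to the process started at $0$. Its characteristic exponent $\psi:\mathbb R^n\to\mathbb C$ is determined by $\mathbb E_0 e^{iX_t\cdot\xi}=e^{-t\psi(\xi)}$ and has the Lévy–Khintchine representation $$\psi(\xi)=i\ell\cdot\xi+\tfrac12\,\xi\cdot Q\xi+\int_{\mathbb R^n\setminus\{0\}}\Big(1-e^{iy\cdot\xi}+\frac{iy\cdot\xi}{1+|y|^2}\Big)\nu(dy),$$ with $\ell\in\mathbb R^n$, $Q\in\mathbb R^{n\times n}$ positive semi-definite, and $\nu$ a measure on $\mathbb R^n\setminus\{0\}$ with $\int(1\wedge|y|^2)\,\nu(dy)<\infty$. $p_t(dx)$ denotes the law of $X_t$ under $\mathbb P_0$; "the transition density exists" means $p_t(dx)=p_t(x)\,dx$ is absolutely continuous with respect to Lebesgue measure, and the density is denoted by the same letter $p_t$ (regularity statements are for a version of the density). $C_\infty(\mathbb R^n)$ is the set of continuous functions on $\mathbb R^n$ vanishing at infinity. In (c), $\nabla p_t$ is the distributional gradient. $X$ is isotropic if $\mathbb P_0(X_t\in B)=\mathbb P_0(X_t\in LB)$ for all $t\ge0$, all Borel sets $B\subset\mathbb R^n$ and every isometry $L:\mathbb R^n\to\mathbb R^n$ with $L(0)=0$. In this case $\psi(\xi)=g(|\xi|^2)$ for some continuous $g:[0,\infty)\to[0,\infty)$. "Increasing" is meant in the non-strict sense. *)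

theory Defs
  imports "HOL-Probability.Probability"
begin

text \<open>Only nonnegative times matter: \<open>X t\<close> is unconstrained for \<open>t < 0\<close>. The
  process starts at the origin, so \<open>M\<close> is the measure written \<open>P\<^sub>0\<close> in the literature.\<close>

locale levy_process = prob_space M
  for M :: "'a measure" and X :: "real \<Rightarrow> 'a \<Rightarrow> real ^ 'n" +
  assumes rv: "\<And>t. 0 \<le> t \<Longrightarrow> random_variable borel (X t)"
    and start: "AE \<omega> in M. X 0 \<omega> = 0"
    and indep_increments:
      "\<And>(s :: nat \<Rightarrow> real) k. 0 \<le> s 0 \<Longrightarrow> (\<And>j. j < k \<Longrightarrow> s j < s (Suc j)) \<Longrightarrow>
        indep_vars (\<lambda>_. borel) (\<lambda>j \<omega>. X (s (Suc j)) \<omega> - X (s j) \<omega>) {..<k}"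
    and stationary_increments:
      "\<And>s t. 0 \<le> s \<Longrightarrow> 0 \<le> t \<Longrightarrow>
        distr M borel (\<lambda>\<omega>. X (s + t) \<omega> - X s \<omega>) = distr M borel (\<lambda>\<omega>. X t \<omega> - X 0 \<omega>)"
    and right_continuous:
      "\<And>\<omega> t. \<omega> \<in> space M \<Longrightarrow> 0 \<le> t \<Longrightarrow> ((\<lambda>s. X s \<omega>) \<longlongrightarrow> X t \<omega>) (at_right t)"
    and left_limits:
      "\<And>\<omega> t. \<omega> \<in> space M \<Longrightarrow> 0 < t \<Longrightarrow> \<exists>l. ((\<lambda>s. X s \<omega>) \<longlongrightarrow> l) (at_left t)"

text \<open>Requiring the identity for every \<open>t \<ge> 0\<close>, not just for \<open>t = 1\<close>, makes \<open>\<psi>\<close> unique.\<close>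

definition characteristic_exponent ::
  "'a measure \<Rightarrow> (real \<Rightarrow> 'a \<Rightarrow> real ^ 'n) \<Rightarrow> (real ^ 'n \<Rightarrow> complex) \<Rightarrow> bool" where
  "characteristic_exponent M X \<psi> \<longleftrightarrow>
    (\<forall>t\<ge>0. \<forall>\<xi>. (LINT \<omega>|M. iexp (X t \<omega> \<bullet> \<xi>)) = exp (- (of_real t * \<psi> \<xi>)))"

text \<open>Measures on the punctured space are identified with Borel measures on the whole
  space that do not charge the origin.\<close>

definition levy_measure :: "(real ^ 'n) measure \<Rightarrow> bool" where
  "levy_measure \<nu> \<longleftrightarrow> sets \<nu> = sets borel \<and> emeasure \<nu> {0} = 0 \<and>
    (\<integral>\<^sup>+ y. ennreal (min 1 ((norm y)\<^sup>2)) \<partial>\<nu>) < \<infinity>"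

definition pos_semidefinite :: "real ^ 'n ^ 'n \<Rightarrow> bool" where
  "pos_semidefinite Q \<longleftrightarrow> transpose Q = Q \<and> (\<forall>x. 0 \<le> x \<bullet> (Q *v x))"

definition levy_khintchine ::
  "(real ^ 'n \<Rightarrow> complex) \<Rightarrow> real ^ 'n \<Rightarrow> real ^ 'n ^ 'n \<Rightarrow> (real ^ 'n) measure \<Rightarrow> bool" where
  "levy_khintchine \<psi> l Q \<nu> \<longleftrightarrow> pos_semidefinite Q \<and> levy_measure \<nu> \<and>
    (\<forall>\<xi>. \<psi> \<xi> = \<i> * of_real (l \<bullet> \<xi>) + of_real (\<xi> \<bullet> (Q *v \<xi>)) / 2 +
      (LINT y|\<nu>. 1 - iexp (y \<bullet> \<xi>) + \<i> * of_real ((y \<bullet> \<xi>) / (1 + (norm y)\<^sup>2))))"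

definition isotropic :: "'a measure \<Rightarrow> (real \<Rightarrow> 'a \<Rightarrow> real ^ 'n) \<Rightarrow> bool" where
  "isotropic M X \<longleftrightarrow>
    (\<forall>t\<ge>0. \<forall>B\<in>sets borel. \<forall>L :: real ^ 'n \<Rightarrow> real ^ 'n.
      (\<forall>x y. dist (L x) (L y) = dist x y) \<and> L 0 = 0 \<longrightarrow>
      measure M {\<omega> \<in> space M. X t \<omega> \<in> B} = measure M {\<omega> \<in> space M. X t \<omega> \<in> L ` B})"

text \<open>\<open>p\<close> is a version of the density of the law of \<open>X t\<close>. Nonnegativity has to be demanded
  because \<^const>\<open>ennreal\<close> truncates negative values to zero.\<close>

definition transition_density ::
  "'a measure \<Rightarrow> (real \<Rightarrow> 'a \<Rightarrow> real ^ 'n) \<Rightarrow> real \<Rightarrow> (real ^ 'n \<Rightarrow> real) \<Rightarrow> bool" where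
  "transition_density M X t p \<longleftrightarrow>
    (\<forall>x. 0 \<le> p x) \<and> distributed M lborel (X t) (\<lambda>x. ennreal (p x))"

definition partial_deriv :: "'n \<Rightarrow> (real ^ 'n \<Rightarrow> real) \<Rightarrow> real ^ 'n \<Rightarrow> real" where
  "partial_deriv i f x = deriv (\<lambda>h. f (x + h *\<^sub>R axis i 1)) 0"

primrec C_k :: "nat \<Rightarrow> (real ^ 'n \<Rightarrow> real) \<Rightarrow> bool" where
  "C_k 0 f \<longleftrightarrow> continuous_on UNIV f"
| "C_k (Suc k) f \<longleftrightarrow> (\<forall>x. f differentiable (at x)) \<and> (\<forall>i. C_k k (partial_deriv i f))"

definition C_infinity :: "(real ^ 'n \<Rightarrow> real) \<Rightarrow> bool" where
  "C_infinity f \<longleftrightarrow> (\<forall>k. C_k k f)"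

text \<open>A multi-index is a function \<open>\<alpha>\<close> on the index type, and \<open>multi_deriv \<alpha> f\<close> applies
  the operator \<open>\<partial>\<^sub>i\<close> \<open>\<alpha> i\<close> times for every \<open>i\<close>, in the order of a fixed enumeration of the
  coordinates. For smooth \<open>f\<close> the order is immaterial, as partial derivatives commute.\<close>

definition coordinates :: "'n::finite list" where
  "coordinates = (SOME is. distinct is \<and> set is = UNIV)"

lemma coordinates: "distinct (coordinates :: 'n::finite list)" "set (coordinates :: 'n list) = UNIV"
proof -
  have "\<exists>is :: 'n list. distinct is \<and> set is = UNIV"
    using finite_distinct_list[of "UNIV :: 'n set"] by auto
  from someI_ex[OF this]
  show "distinct (coordinates :: 'n list)" "set (coordinates :: 'n list) = UNIV"
    by (auto simp: coordinates_def)
qed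

definition multi_deriv :: "('n \<Rightarrow> nat) \<Rightarrow> (real ^ 'n \<Rightarrow> real) \<Rightarrow> real ^ 'n \<Rightarrow> real" where
  "multi_deriv \<alpha> f = foldr (\<lambda>i. partial_deriv i ^^ \<alpha> i) coordinates f"

definition C_vanishing :: "(real ^ 'n \<Rightarrow> real) \<Rightarrow> bool" where
  "C_vanishing f \<longleftrightarrow> continuous_on UNIV f \<and> (f \<longlongrightarrow> 0) at_infinity"

definition ess_bounded :: "(real ^ 'n \<Rightarrow> real) \<Rightarrow> bool" where
  "ess_bounded f \<longleftrightarrow> f \<in> borel_measurable lborel \<and> (\<exists>C. AE x in lborel. \<bar>f x\<bar> \<le> C)"

definition locally_integrable :: "(real ^ 'n \<Rightarrow> 'b::{banach, second_countable_topology}) \<Rightarrow> bool" where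
  "locally_integrable f \<longleftrightarrow> (\<forall>K. compact K \<longrightarrow> set_integrable lborel K f)"

definition test_function :: "(real ^ 'n \<Rightarrow> real) \<Rightarrow> bool" where
  "test_function \<phi> \<longleftrightarrow> C_infinity \<phi> \<and> compact (closure {x. \<phi> x \<noteq> 0})"

text \<open>The distributional gradient of \<open>f\<close> is represented by the locally integrable field \<open>G\<close>.\<close>

definition distributional_gradient ::
  "(real ^ 'n \<Rightarrow> real) \<Rightarrow> (real ^ 'n \<Rightarrow> real ^ 'n) \<Rightarrow> bool" where
  "distributional_gradient f G \<longleftrightarrow> locally_integrable f \<and> locally_integrable G \<and>
    (\<forall>\<phi> i. test_function \<phi> \<longrightarrow>
      (LINT x|lborel. f x * partial_deriv i \<phi> x) = - (LINT x|lborel. G x $ i * \<phi> x))"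

end

theory Submission
  imports Defs
begin

text \<open>
  Write \<open>\<phi>\<^sub>t = exp (- t \<psi>)\<close> for the characteristic function of \<open>X\<^sub>t\<close>. Condition (a) says that every \<open>\<phi>\<^sub>t\<close>
  decays faster than any power, and it already follows from \<open>\<bar>\<xi>\<bar> \<bar>\<phi>\<^sub>t(\<xi>)\<bar> \<le> C\<^sub>t\<close> for all \<open>t > 0\<close>.

  For (a) \<open>\<Longrightarrow>\<close> (b), rapid decay gives a smooth density by Fourier inversion. Integrability of its derivatives
  needs more: split \<open>\<psi> = \<psi>\<^sub>1 + \<psi>\<^sub>2\<close> into small and large jumps. The exponent \<open>\<psi>\<^sub>1\<close> is smooth with
  derivatives of polynomial growth, so the inverse transform of \<open>\<xi>\<^sup>\<alpha> exp (- t \<psi>\<^sub>1)\<close> decays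
  rapidly (integrate by parts), while \<open>exp (- t \<psi>\<^sub>2)\<close> belongs to a compound Poisson law; convolving with a
  probability law preserves integrability and decay at infinity.

  For (c) \<open>\<Longrightarrow>\<close> (a), test the distributional gradient with trigonometric functions cut off by a bump.
  In the isotropic case, a bounded density makes \<open>\<phi>\<^sub>t \<ge> 0\<close> integrable (regularise with Gaussians), and since
  \<open>\<phi>\<^sub>t\<close> is radially decreasing, its integral over the ball of radius \<open>\<bar>\<xi>\<bar>\<close> bounds \<open>\<bar>\<xi>\<bar>\<^sup>n \<phi>\<^sub>t(\<xi>)\<close>.
\<close>

subsection \<open>Differentiation under the integral and integration by parts\<close>

text \<open>One power of |\<xi>| suffices in the growth criterion because the time is arbitrary:
  |\<xi>| exp(-t Re \<psi>) \<le> C means Re \<psi> \<ge> (ln |\<xi>| - ln C) / t, and t may be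
  taken as small as desired. The obstacle in (b) is integrability in x. Decay of an inverse
  transform calls for derivatives in \<xi>, but derivatives of \<psi> are moments of the Levy
  measure, and large jumps need not have any. Jumps of norm at most 1 have all moments of order two
  and higher, hence the cut at 1. Removing the large jumps does not spoil the decay in \<xi>: their
  exponent is bounded, so dividing by its exponential costs a constant factor. Their share of the
  compensator is linear in \<xi> and is moved into the small-jump exponent. Putting the large jumps
  back gives no rate of decay in x, since their compound Poisson law may have heavy tails;
  convergence to 0 then comes from dominated convergence. In the radial case \<psi> is real, so the
  characteristic function is positive, and Fatou's lemma bounds its integral without prior knowledge
  of integrability.\<close>

lemma has_vector_derivative_at_tendsto:
  "(f has_vector_derivative D) (at x) \<longleftrightarrow> ((\<lambda>h. (f (x + h) - f x) /\<^sub>R h) \<longlongrightarrow> D) (at 0)"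
proof -
  have "(f has_vector_derivative D) (at x) \<longleftrightarrow>
    ((\<lambda>h. norm (f (x + h) - f x - h *\<^sub>R D) / norm h) \<longlongrightarrow> 0) (at 0)"
    by (simp add: has_vector_derivative_def has_derivative_at bounded_linear_scaleR_left)
  also have "\<dots> \<longleftrightarrow> ((\<lambda>h. norm ((f (x + h) - f x) /\<^sub>R h - D)) \<longlongrightarrow> 0) (at 0)"
  proof (rule tendsto_cong)
    show "\<forall>\<^sub>F h in at 0. norm (f (x + h) - f x - h *\<^sub>R D) / norm h
        = norm ((f (x + h) - f x) /\<^sub>R h - D)"
      unfolding eventually_at_filter
    proof (intro always_eventually allI impI)
      fix h :: real assume "h \<noteq> 0"
      then have "(f (x + h) - f x) /\<^sub>R h - D = (f (x + h) - f x - h *\<^sub>R D) /\<^sub>R h"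
        by (simp add: scaleR_diff_right)
      then show "norm (f (x + h) - f x - h *\<^sub>R D) / norm h = norm ((f (x + h) - f x) /\<^sub>R h - D)"
        by (simp add: divide_inverse mult.commute)
    qed
  qed
  also have "\<dots> \<longleftrightarrow> ((\<lambda>h. (f (x + h) - f x) /\<^sub>R h) \<longlongrightarrow> D) (at 0)"
    by (simp add: tendsto_norm_zero_iff LIM_zero_iff)
  finally show ?thesis .
qed

text \<open>The mean value inequality carries the bound \<open>g\<close> from \<open>f'\<close> to
  every difference quotient with step below 1, and dominated convergence along sequences does the
  rest. Other base points are reached by absorbing a translation into \<open>f\<close>.\<close>

lemma has_vector_derivative_integral_dominated:
  fixes f :: "real \<Rightarrow> 'a \<Rightarrow> 'b::{banach, second_countable_topology}"
  assumes int: "\<And>s. integrable M (f s)"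
    and deriv: "\<And>s x. \<bar>s\<bar> < 1 \<Longrightarrow> x \<in> space M \<Longrightarrow> ((\<lambda>s. f s x) has_vector_derivative f' s x) (at s)"
    and bound: "\<And>s x. \<bar>s\<bar> < 1 \<Longrightarrow> x \<in> space M \<Longrightarrow> norm (f' s x) \<le> g x"
    and g: "integrable M g"
  shows "integrable M (f' 0)"
    and "((\<lambda>s. \<integral>x. f s x \<partial>M) has_vector_derivative (\<integral>x. f' 0 x \<partial>M)) (at 0)"
proof -
  let ?q = "\<lambda>h x. (f h x - f 0 x) /\<^sub>R h"
  have q_bound: "norm (?q h x) \<le> g x" if h: "\<bar>h\<bar> < 1" "h \<noteq> 0" and x: "x \<in> space M" for h x
  proof -
    have "norm (f h x - f 0 x) \<le> g x * norm (h - 0)"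
    proof (rule differentiable_bound[of "{-1<..<1}" "\<lambda>s. f s x" "\<lambda>s r. r *\<^sub>R f' s x"])
      show "((\<lambda>s. f s x) has_derivative (\<lambda>r. r *\<^sub>R f' s x)) (at s within {-1<..<1})"
        if "s \<in> {-1<..<1}" for s
        using deriv[of s x] that x
        by (auto simp: has_vector_derivative_def intro: has_derivative_at_withinI)
      show "onorm (\<lambda>r. r *\<^sub>R f' s x) \<le> g x" if "s \<in> {-1<..<1}" for s
      proof -
        have "norm (f' s x) \<le> g x" using bound[of s x] that x by auto
        then show ?thesis
          by (intro onorm_bound) (auto simp: mult.commute mult_left_mono order_trans[OF norm_ge_zero])
      qed
    qed (use h in auto)
    moreover have "norm (?q h x) = norm (f h x - f 0 x) / \<bar>h\<bar>"
      by (simp add: divide_inverse_commute)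
    ultimately show ?thesis using h by (simp add: divide_simps mult.commute)
  qed
  have q_lim: "((\<lambda>h. ?q h x) \<longlongrightarrow> f' 0 x) (at 0)" if "x \<in> space M" for x
    using deriv[of 0 x] that by (simp add: has_vector_derivative_at_tendsto)
  have meas: "f' 0 \<in> borel_measurable M"
  proof (rule borel_measurable_LIMSEQ_metric)
    show "?q (1 / real (Suc k)) \<in> borel_measurable M" for k
      using int by (intro borel_measurable_scaleR borel_measurable_diff) auto
    show "(\<lambda>k. ?q (1 / real (Suc k)) x) \<longlonglongrightarrow> f' 0 x" if "x \<in> space M" for x
    proof (rule filterlim_compose[OF q_lim[OF that]])
      show "filterlim (\<lambda>k. 1 / real (Suc k)) (at 0) sequentially"
        using LIMSEQ_Suc[OF lim_1_over_n] by (auto simp: filterlim_at)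
    qed
  qed
  show "integrable M (f' 0)"
    by (rule Bochner_Integration.integrable_bound[OF g meas]) (use bound[of 0] in \<open>auto intro!: AE_I2 order_trans[OF _ abs_ge_self]\<close>)
  \<comment> \<open>Restricting to the interval puts every term of every sequence within reach of
    the bound, without passing to a tail.\<close>
  have "((\<lambda>h. \<integral>x. ?q h x \<partial>M) \<longlongrightarrow> (\<integral>x. f' 0 x \<partial>M)) (at 0 within {-1<..<1})"
    unfolding tendsto_at_iff_sequentially o_def
  proof (intro allI impI)
    fix X :: "nat \<Rightarrow> real" assume X: "\<forall>i. X i \<in> {-1<..<1} - {0}" "X \<longlonglongrightarrow> 0"
    show "(\<lambda>i. \<integral>x. ?q (X i) x \<partial>M) \<longlonglongrightarrow> (\<integral>x. f' 0 x \<partial>M)"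
    proof (rule integral_dominated_convergence[OF meas _ g])
      show "AE x in M. (\<lambda>i. ?q (X i) x) \<longlonglongrightarrow> f' 0 x"
        using X by (intro AE_I2 filterlim_compose[OF q_lim]) (auto simp: filterlim_at intro!: always_eventually)
      show "AE x in M. norm (?q (X i) x) \<le> g x" for i
        using X(1)[rule_format, of i] by (intro AE_I2 q_bound) auto
    qed (use int in auto)
  qed
  then have "((\<lambda>h. \<integral>x. ?q h x \<partial>M) \<longlongrightarrow> (\<integral>x. f' 0 x \<partial>M)) (at 0)"
    by (simp add: at_within_open[of 0 "{-1<..<1::real}"])
  then show "((\<lambda>s. \<integral>x. f s x \<partial>M) has_vector_derivative (\<integral>x. f' 0 x \<partial>M)) (at 0)"
    using int by (simp add: has_vector_derivative_at_tendsto)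
qed

section \<open>Invariance of Lebesgue measure and the vanishing integral of a derivative\<close>

lemma lborel_integral_translate:
  fixes f :: "'a::euclidean_space \<Rightarrow> 'b::{banach, second_countable_topology}"
  assumes [measurable]: "f \<in> borel_measurable borel"
  shows "(LINT x|lborel. f (c + x)) = (LINT x|lborel. f x)"
proof -
  have "(LINT x|lborel. f x) = (LINT x|distr lborel borel ((+) c). f x)"
    by (simp add: lborel_distr_plus)
  also have "\<dots> = (LINT x|lborel. f (c + x))"
    by (subst integral_distr) auto
  finally show ?thesis by simp
qed

lemma lborel_integrable_translate:
  fixes f :: "'a::euclidean_space \<Rightarrow> 'b::{banach, second_countable_topology}"
  assumes "integrable lborel f"
  shows "integrable lborel (\<lambda>x. f (c + x))"
proof -
  have [measurable]: "f \<in> borel_measurable borel"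
    using borel_measurable_integrable[OF assms] by simp
  have "integrable (distr lborel borel ((+) c)) f"
    using assms by (simp add: lborel_distr_plus)
  then show ?thesis
    by (subst (asm) integrable_distr_eq) auto
qed

lemma lborel_integral_reflect:
  fixes f :: "'a::euclidean_space \<Rightarrow> 'b::{banach, second_countable_topology}"
  assumes [measurable]: "f \<in> borel_measurable borel"
  shows "(LINT x|lborel. f (c - x)) = (LINT x|lborel. f x)"
proof -
  have "(LINT x|lborel. f x) = (LINT x|distr lborel borel (\<lambda>x::'a. c + (-1) *\<^sub>R x). f x)"
    by (subst lborel_affine[of "-1" c]) (auto simp: density_1)
  also have "\<dots> = (LINT x|lborel. f (c - x))"
    by (subst integral_distr) auto
  finally show ?thesis by simp
qed

lemma lborel_integrable_reflect:
  fixes f :: "'a::euclidean_space \<Rightarrow> 'b::{banach, second_countable_topology}"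
  assumes "integrable lborel f"
  shows "integrable lborel (\<lambda>x. f (c - x))"
proof -
  have [measurable]: "f \<in> borel_measurable borel"
    using borel_measurable_integrable[OF assms] by simp
  have "integrable (distr lborel borel (\<lambda>x::'a. c + (-1) *\<^sub>R x)) f"
    using assms by (subst (asm) lborel_affine[of "-1" c]) (auto simp: density_1)
  then show ?thesis
    by (subst (asm) integrable_distr_eq) auto
qed

text \<open>Translation invariance makes the integral of a difference quotient vanish.\<close>

lemma lborel_integral_directional_derivative:
  fixes f f' :: "'a::euclidean_space \<Rightarrow> 'b::{banach, second_countable_topology}"
  assumes f: "integrable lborel f"
    and deriv: "\<And>x. ((\<lambda>s. f (x + s *\<^sub>R e)) has_vector_derivative f' x) (at 0)"
    and bound: "\<And>s x. \<bar>s\<bar> < 1 \<Longrightarrow> norm (f' (x + s *\<^sub>R e)) \<le> g x"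
    and g: "integrable lborel g"
  shows "integrable lborel f'" "(LINT x|lborel. f' x) = 0"
proof -
  have deriv': "((\<lambda>s. f (x + s *\<^sub>R e)) has_vector_derivative f' (x + s *\<^sub>R e)) (at s)" for s x
    using deriv[of "x + s *\<^sub>R e"]
    by (simp add: has_vector_derivative_at_tendsto algebra_simps)
  have int: "integrable lborel (\<lambda>x. f (x + s *\<^sub>R e))" for s
    using lborel_integrable_translate[OF f, of "s *\<^sub>R e"] by (simp add: add.commute)
  note * = has_vector_derivative_integral_dominated[of lborel "\<lambda>s x. f (x + s *\<^sub>R e)" "\<lambda>s x. f' (x + s *\<^sub>R e)" g, OF int]
  have "integrable lborel (\<lambda>x. f' (x + 0 *\<^sub>R e))"
    by (rule *(1)) (use deriv' bound g in auto)
  then show "integrable lborel f'" by simp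
  have "((\<lambda>s. LINT x|lborel. f (x + s *\<^sub>R e)) has_vector_derivative (LINT x|lborel. f' (x + 0 *\<^sub>R e))) (at 0)"
    by (rule *(2)) (use deriv' bound g in auto)
  moreover have "(LINT x|lborel. f (x + s *\<^sub>R e)) = (LINT x|lborel. f x)" for s
    using lborel_integral_translate[of f "s *\<^sub>R e"] f by (simp add: add.commute)
  ultimately show "(LINT x|lborel. f' x) = 0"
    by (simp add: has_vector_derivative_at_tendsto tendsto_const_iff)
qed

text \<open>\<open>lborel\<close> is the image of the product of its one-dimensional copies under
  the coordinate map. The factorisation serves both the polynomial majorant and the Gaussian
  transform.\<close>

lemma integrable_lborel_prod:
  fixes f :: "'a::euclidean_space \<Rightarrow> real \<Rightarrow> 'b::{real_normed_field, banach, second_countable_topology}"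
  assumes f: "\<And>b. b \<in> Basis \<Longrightarrow> integrable lborel (f b)"
  shows "integrable lborel (\<lambda>x. \<Prod>b\<in>Basis. f b (x \<bullet> b))"
    and "(LINT x|lborel. (\<Prod>b\<in>Basis. f b (x \<bullet> b))) = (\<Prod>b\<in>Basis. LINT x|lborel. f b x)"
proof -
  interpret product_sigma_finite "\<lambda>_::'a. lborel :: real measure" ..
  have [measurable]: "f b \<in> borel_measurable borel" if "b \<in> Basis" for b
    using borel_measurable_integrable[OF f[OF that]] by simp
  have T: "(\<lambda>g. \<Sum>b\<in>Basis. g b *\<^sub>R b) \<in> (\<Pi>\<^sub>M b\<in>(Basis::'a set). lborel) \<rightarrow>\<^sub>M borel"
    by measurable
  have prod_eq: "(\<Prod>b\<in>Basis. f b ((\<Sum>c\<in>Basis. g c *\<^sub>R c) \<bullet> b)) = (\<Prod>b\<in>Basis. f b (g b))" for g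
    by (intro prod.cong) auto
  have m: "(\<lambda>x. \<Prod>b\<in>Basis. f b (x \<bullet> b)) \<in> borel_measurable borel"
    by measurable
  show "integrable lborel (\<lambda>x. \<Prod>b\<in>Basis. f b (x \<bullet> b))"
    apply (subst lborel_eq)
    apply (subst integrable_distr_eq[OF T m])
    apply (subst prod_eq)
    apply (rule product_integrable_prod)
    using f by auto
  show "(LINT x|lborel. (\<Prod>b\<in>Basis. f b (x \<bullet> b))) = (\<Prod>b\<in>Basis. LINT x|lborel. f b x)"
    apply (subst lborel_eq)
    apply (subst integral_distr[OF T m])
    apply (subst prod_eq)
    apply (rule product_integral_prod)
    using f by auto
qed

lemma integrable_inverse_one_plus_square: "integrable lborel (\<lambda>x::real. inverse (1 + x\<^sup>2))"
proof -
  show ?thesis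
    using integrable_inverse_1_plus_square by (simp add: set_integrable_def einterval_def)
qed

text \<open>The exponent 2n comes from comparison with a product: each of the n factors 1 + (x .
  b)^2 is at most (1 + |x|)^2. This power is the standard majorant in the later integrability
  arguments.\<close>

lemma integrable_inverse_one_plus_norm_power:
  fixes k :: nat
  assumes "2 * DIM('a) \<le> k"
  shows "integrable lborel (\<lambda>x::'a::euclidean_space. inverse ((1 + norm x) ^ k))"
proof (rule Bochner_Integration.integrable_bound)
  show "integrable lborel (\<lambda>x::'a. \<Prod>b\<in>Basis. inverse (1 + (x \<bullet> b)\<^sup>2))"
    by (intro integrable_lborel_prod integrable_inverse_one_plus_square)
  show "AE x::'a in lborel. norm (inverse ((1 + norm x) ^ k)) \<le> norm (\<Prod>b\<in>Basis. inverse (1 + (x \<bullet> b)\<^sup>2))"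
  proof (rule AE_I2)
    fix x :: 'a
    have "(\<Prod>b\<in>Basis. 1 + (x \<bullet> b)\<^sup>2) \<le> (\<Prod>b\<in>(Basis::'a set). (1 + norm x)\<^sup>2)"
    proof (intro prod_mono conjI)
      fix b :: 'a assume "b \<in> Basis"
      then have "(x \<bullet> b)\<^sup>2 \<le> (norm x)\<^sup>2"
        using Basis_le_norm[of b x] by (simp add: abs_le_square_iff[symmetric])
      then show "1 + (x \<bullet> b)\<^sup>2 \<le> (1 + norm x)\<^sup>2"
        by (simp add: power2_sum) (smt (verit) norm_ge_zero)
    qed (simp add: add_nonneg_nonneg)
    also have "\<dots> = (1 + norm x) ^ (2 * DIM('a))"
      by (simp add: power_mult)
    also have "\<dots> \<le> (1 + norm x) ^ k"
      using assms by (intro power_increasing) auto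
    finally have "inverse ((1 + norm x) ^ k) \<le> inverse (\<Prod>b\<in>Basis. 1 + (x \<bullet> b)\<^sup>2)"
      by (intro le_imp_inverse_le prod_pos) (auto simp: add_pos_nonneg)
    then show "norm (inverse ((1 + norm x) ^ k)) \<le> norm (\<Prod>b\<in>Basis. inverse (1 + (x \<bullet> b)\<^sup>2))"
      by (simp add: prod_inversef[symmetric] abs_prod prod_nonneg add_nonneg_nonneg)
  qed
qed (measurable)

subsection \<open>Fourier transform and Gaussian kernels\<close>

text \<open>The sign is opposite to that of the characteristic function and no normalisation is
  built in, so a factor (2 pi)^n shows up in the inversion formula.\<close>

definition fourier :: "('a::euclidean_space \<Rightarrow> complex) \<Rightarrow> 'a \<Rightarrow> complex" where
  "fourier h x = (LINT \<xi>|lborel. iexp (- (x \<bullet> \<xi>)) * h \<xi>)"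

lemma norm_iexp [simp]: "cmod (iexp x) = 1"
  by (simp add: norm_exp_i_times)

lemma measurable_iexp [measurable]: "iexp \<in> borel_measurable borel"
  by (intro borel_measurable_continuous_onI continuous_intros)

lemma integrable_iexp_mult:
  assumes "integrable lborel (h :: 'a::euclidean_space \<Rightarrow> complex)"
  shows "integrable lborel (\<lambda>\<xi>. iexp (- (x \<bullet> \<xi>)) * h \<xi>)"
proof -
  have [measurable]: "h \<in> borel_measurable borel"
    using borel_measurable_integrable[OF assms] by simp
  show ?thesis
    by (rule Bochner_Integration.integrable_bound[OF assms]) (auto simp: norm_mult)
qed

lemma norm_fourier_le:
  assumes "integrable lborel (h :: 'a::euclidean_space \<Rightarrow> complex)"
  shows "cmod (fourier h x) \<le> (LINT \<xi>|lborel. cmod (h \<xi>))"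
  unfolding fourier_def
  using integral_norm_bound[of lborel "\<lambda>\<xi>. iexp (- (x \<bullet> \<xi>)) * h \<xi>"]
  by (simp add: norm_mult)

text \<open>The centred Gaussian density with standard deviation \<sigma> in every coordinate; the
  product form reduces its integrals to dimension one.\<close>

definition heat :: "real \<Rightarrow> 'a::euclidean_space \<Rightarrow> real" where
  "heat \<sigma> z = (\<Prod>b\<in>Basis. normal_density 0 \<sigma> (z \<bullet> b))"

lemma heat_nonneg [simp]: "0 \<le> heat \<sigma> z"
  unfolding heat_def by (intro prod_nonneg) auto

lemma heat_minus [simp]: "heat \<sigma> (- z) = heat \<sigma> z"
  unfolding heat_def by (intro prod.cong) (auto simp: normal_density_def)

lemma measurable_heat [measurable]: "heat \<sigma> \<in> borel_measurable borel"
  unfolding heat_def[abs_def] by measurable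

lemma
  assumes "0 < \<sigma>"
  shows integrable_heat: "integrable lborel (heat \<sigma> :: 'a::euclidean_space \<Rightarrow> real)"
    and integral_heat: "(LINT z|lborel. heat \<sigma> (z :: 'a)) = 1"
  using integrable_lborel_prod[where 'a='a and f="\<lambda>_. normal_density 0 \<sigma>"] assms
  by (simp_all add: heat_def[abs_def])

lemma heat_scale:
  assumes "0 < \<sigma>"
  shows "\<sigma> ^ DIM('a) * heat \<sigma> (\<sigma> *\<^sub>R z) = heat 1 (z :: 'a::euclidean_space)"
proof -
  have "normal_density 0 1 t = \<sigma> * normal_density 0 \<sigma> (\<sigma> * t)" for t
    using assms by (simp add: normal_density_def real_sqrt_mult power_mult_distrib)
  then show ?thesis
    by (simp add: heat_def prod.distrib)
qed

lemma integral_mult_heat: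
  fixes f :: "'a::euclidean_space \<Rightarrow> real"
  assumes \<sigma>: "0 < \<sigma>" and [measurable]: "f \<in> borel_measurable borel"
  shows "(LINT x|lborel. f x * heat \<sigma> (y - x)) = (LINT z|lborel. f (y + \<sigma> *\<^sub>R z) * heat 1 z)"
proof -
  have "(LINT x|lborel. f x * heat \<sigma> (y - x))
      = (LINT x|density (distr lborel borel (\<lambda>x. y + \<sigma> *\<^sub>R x)) (\<lambda>_. ennreal (\<bar>\<sigma>\<bar> ^ DIM('a))). f x * heat \<sigma> (y - x))"
    using \<sigma> by (subst lborel_affine[of \<sigma> y]) auto
  also have "\<dots> = (LINT z|lborel. \<sigma> ^ DIM('a) * (f (y + \<sigma> *\<^sub>R z) * heat \<sigma> (- (\<sigma> *\<^sub>R z))))"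
    using \<sigma> by (simp add: integral_density integral_distr del: heat_minus)
  also have "\<dots> = (LINT z|lborel. f (y + \<sigma> *\<^sub>R z) * heat 1 z)"
    by (intro Bochner_Integration.integral_cong) (auto simp: heat_scale[OF \<sigma>, symmetric])
  finally show ?thesis .
qed

text \<open>Substituting x = u / \<sigma> turns the integral into the characteristic function of the
  standard normal law at z / \<sigma>. The factor 2 pi remains because the result is written as a
  multiple of a normal density.\<close>

lemma integral_iexp_gaussian_1D:
  assumes "0 < \<sigma>"
  shows "integrable lborel (\<lambda>x. iexp (z * x) * complex_of_real (exp (- (\<sigma> * x)\<^sup>2 / 2)))"
    and "(LINT x|lborel. iexp (z * x) * complex_of_real (exp (- (\<sigma> * x)\<^sup>2 / 2)))
      = complex_of_real (2 * pi * normal_density 0 \<sigma> z)"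
proof -
  have gauss: "exp (- (\<sigma> * x)\<^sup>2 / 2) = sqrt (2 * pi / \<sigma>\<^sup>2) * normal_density 0 (1 / \<sigma>) x" for x
    using assms by (simp add: normal_density_def power_mult_distrib divide_simps real_sqrt_divide real_sqrt_mult)
  have "integrable lborel (\<lambda>x. complex_of_real (exp (- (\<sigma> * x)\<^sup>2 / 2)))"
    unfolding gauss using assms by (intro integrable_of_real integrable_mult_right integrable_normal_density) auto
  then show "integrable lborel (\<lambda>x. iexp (z * x) * complex_of_real (exp (- (\<sigma> * x)\<^sup>2 / 2)))"
    by (rule Bochner_Integration.integrable_bound) (auto simp: norm_mult)
  let ?g = "\<lambda>x. iexp (z * x) * complex_of_real (exp (- (\<sigma> * x)\<^sup>2 / 2))"
  have "(LINT x|lborel. ?g x) = \<bar>1 / \<sigma>\<bar> *\<^sub>R (LINT x|lborel. ?g (0 + (1 / \<sigma>) * x))"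
    using assms by (intro lborel_integral_real_affine) auto
  also have "\<dots> = (1 / \<sigma>) *\<^sub>R (LINT x|lborel. sqrt (2 * pi) *\<^sub>R (std_normal_density x *\<^sub>R iexp ((z / \<sigma>) * x)))"
    using assms
    by (intro arg_cong2[where f=scaleR] Bochner_Integration.integral_cong)
       (auto simp: std_normal_density_def scaleR_conv_of_real)
  also have "\<dots> = (1 / \<sigma>) *\<^sub>R (sqrt (2 * pi) *\<^sub>R char std_normal_distribution (z / \<sigma>))"
    unfolding char_def integral_scaleR_right by (subst integral_density) auto
  also have "\<dots> = complex_of_real (2 * pi * normal_density 0 \<sigma> z)"
  proof -
    have "1 / \<sigma> * (sqrt (2 * pi) * exp (- (z / \<sigma>)\<^sup>2 / 2)) = 2 * pi * normal_density 0 \<sigma> z"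
      using assms
      by (simp add: normal_density_def real_sqrt_mult power_divide field_simps)
    then show ?thesis
      by (simp add: char_std_normal_distribution scaleR_conv_of_real flip: of_real_mult of_real_divide)
  qed
  finally show "(LINT x|lborel. ?g x) = complex_of_real (2 * pi * normal_density 0 \<sigma> z)" .
qed

text \<open>The multiplier that transforms into \<open>heat \<sigma>\<close> up to (2 pi)^n. As
  \<sigma> tends to 0 it increases to 1 while the heat kernel concentrates at the origin.\<close>

definition gaussian :: "real \<Rightarrow> 'a::euclidean_space \<Rightarrow> real" where
  "gaussian \<sigma> \<xi> = exp (- (\<sigma> * norm \<xi>)\<^sup>2 / 2)"

lemma gaussian_bounds [simp]: "0 < gaussian \<sigma> \<xi>" "0 \<le> gaussian \<sigma> \<xi>" "gaussian \<sigma> \<xi> \<le> 1"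
  by (simp_all add: gaussian_def)

lemma measurable_gaussian [measurable]: "gaussian \<sigma> \<in> borel_measurable borel"
  unfolding gaussian_def[abs_def] by measurable

lemma tendsto_gaussian: "(\<lambda>k. gaussian (1 / real (Suc k)) \<xi>) \<longlonglongrightarrow> 1"
proof -
  have "(\<lambda>k. exp (- (1 / real (Suc k) * norm \<xi>)\<^sup>2 / 2)) \<longlonglongrightarrow> exp (- (0 * norm \<xi>)\<^sup>2 / 2)"
    by (intro tendsto_intros LIMSEQ_Suc[OF lim_1_over_n]) auto
  then show ?thesis by (simp add: gaussian_def)
qed

lemma
  fixes z :: "'a::euclidean_space"
  assumes "0 < \<sigma>"
  shows integrable_iexp_gaussian: "integrable lborel (\<lambda>\<xi>. iexp (z \<bullet> \<xi>) * complex_of_real (gaussian \<sigma> \<xi>))"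
    and integral_iexp_gaussian: "(LINT \<xi>|lborel. iexp (z \<bullet> \<xi>) * complex_of_real (gaussian \<sigma> \<xi>))
      = complex_of_real ((2 * pi) ^ DIM('a) * heat \<sigma> z)"
proof -
  let ?f = "\<lambda>b x. iexp ((z \<bullet> b) * x) * complex_of_real (exp (- (\<sigma> * x)\<^sup>2 / 2))"
  have eq: "iexp (z \<bullet> \<xi>) * complex_of_real (gaussian \<sigma> \<xi>) = (\<Prod>b\<in>Basis. ?f b (\<xi> \<bullet> b))" for \<xi> :: 'a
  proof -
    have "iexp (z \<bullet> \<xi>) = (\<Prod>b\<in>Basis. iexp ((z \<bullet> b) * (\<xi> \<bullet> b)))"
      by (subst euclidean_inner) (simp add: exp_sum sum_distrib_left del: of_real_mult)
    moreover have "gaussian \<sigma> \<xi> = (\<Prod>b\<in>Basis. exp (- (\<sigma> * (\<xi> \<bullet> b))\<^sup>2 / 2))"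
    proof -
      have "(norm \<xi>)\<^sup>2 = (\<Sum>b\<in>Basis. (\<xi> \<bullet> b)\<^sup>2)"
        unfolding power2_norm_eq_inner by (subst euclidean_inner) (simp add: power2_eq_square)
      then show ?thesis
        unfolding gaussian_def
        by (simp add: exp_sum[symmetric] power_mult_distrib sum_distrib_left sum_negf sum_divide_distrib)
    qed
    ultimately show ?thesis by (simp add: prod.distrib)
  qed
  show "integrable lborel (\<lambda>\<xi>. iexp (z \<bullet> \<xi>) * complex_of_real (gaussian \<sigma> \<xi>))"
    unfolding eq by (intro integrable_lborel_prod integral_iexp_gaussian_1D assms)
  show "(LINT \<xi>|lborel. iexp (z \<bullet> \<xi>) * complex_of_real (gaussian \<sigma> \<xi>))
      = complex_of_real ((2 * pi) ^ DIM('a) * heat \<sigma> z)"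
    unfolding eq integrable_lborel_prod(2)[OF integral_iexp_gaussian_1D(1)[OF assms]]
      integral_iexp_gaussian_1D(2)[OF assms]
    by (simp add: heat_def prod.distrib)
qed

lemma integrable_gaussian:
  assumes "0 < \<sigma>"
  shows "integrable lborel (gaussian \<sigma> :: 'a::euclidean_space \<Rightarrow> real)"
  using integrable_iexp_gaussian[OF assms, of "0 :: 'a"] by (simp add: complex_of_real_integrable_eq)

lemma measurable_char_function:
  assumes "sigma_finite_measure N" "f \<in> N \<rightarrow>\<^sub>M (borel :: 'a::euclidean_space measure)"
  shows "(\<lambda>\<xi>. LINT y|N. iexp (f y \<bullet> \<xi>)) \<in> borel_measurable borel"
proof -
  interpret sigma_finite_measure N by fact
  note assms(2)[measurable]
  show ?thesis by measurable
qed

text \<open>Regularising by a Gaussian gives Fourier inversion without any integrability assumption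
  on the characteristic function.\<close>

lemma fourier_char_gaussian:
  fixes N :: "'a::euclidean_space measure"
  assumes N: "finite_measure N" "sets N = sets borel" and \<sigma>: "0 < \<sigma>"
  shows "fourier (\<lambda>\<xi>. (LINT y|N. iexp (y \<bullet> \<xi>)) * complex_of_real (gaussian \<sigma> \<xi>)) x
    = complex_of_real ((2 * pi) ^ DIM('a) * (LINT y|N. heat \<sigma> (y - x)))"
proof -
  interpret N: finite_measure N by fact
  interpret P: pair_sigma_finite N "lborel :: 'a measure" ..
  note [measurable_cong] = N(2)
  let ?g = "\<lambda>y \<xi>. iexp ((y - x) \<bullet> \<xi>) * complex_of_real (gaussian \<sigma> \<xi>)"
  have int: "integrable (N \<Otimes>\<^sub>M lborel) (case_prod ?g)"
  proof (rule P.Fubini_integrable)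
    show "integrable N (\<lambda>y. LINT \<xi>|lborel. cmod (case (y, \<xi>) of (y, \<xi>) \<Rightarrow> ?g y \<xi>))"
      by (simp add: norm_mult)
    show "AE y in N. integrable lborel (\<lambda>\<xi>. case (y, \<xi>) of (y, \<xi>) \<Rightarrow> ?g y \<xi>)"
      by (simp only: prod.case integrable_iexp_gaussian[OF \<sigma>] always_eventually simp_thms)
  qed measurable
  have "fourier (\<lambda>\<xi>. (LINT y|N. iexp (y \<bullet> \<xi>)) * complex_of_real (gaussian \<sigma> \<xi>)) x
    = (LINT \<xi>|lborel. LINT y|N. ?g y \<xi>)"
    unfolding fourier_def
    by (intro Bochner_Integration.integral_cong refl)
       (simp add: inner_diff_left exp_diff exp_minus field_simps flip: integral_mult_left_zero integral_mult_right_zero)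
  also have "\<dots> = (LINT y|N. LINT \<xi>|lborel. ?g y \<xi>)"
    using P.Fubini_integral[OF int] .
  also have "\<dots> = (LINT y|N. complex_of_real ((2 * pi) ^ DIM('a) * heat \<sigma> (y - x)))"
    by (simp only: integral_iexp_gaussian[OF \<sigma>])
  finally show ?thesis by simp
qed

subsection \<open>Fourier inversion\<close>

lemma tendsto_fourier_gaussian:
  assumes h: "integrable lborel (h :: 'a::euclidean_space \<Rightarrow> complex)"
  shows "(\<lambda>k. fourier (\<lambda>\<xi>. h \<xi> * complex_of_real (gaussian (1 / real (Suc k)) \<xi>)) x) \<longlonglongrightarrow> fourier h x"
  unfolding fourier_def
proof (rule integral_dominated_convergence)
  have [measurable]: "h \<in> borel_measurable borel"
    using borel_measurable_integrable[OF h] by simp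
  show "(\<lambda>\<xi>. iexp (- (x \<bullet> \<xi>)) * h \<xi>) \<in> borel_measurable lborel"
    "(\<lambda>\<xi>. iexp (- (x \<bullet> \<xi>)) * (h \<xi> * complex_of_real (gaussian (1 / real (Suc k)) \<xi>))) \<in> borel_measurable lborel" for k
    by measurable
  show "integrable lborel (\<lambda>\<xi>. cmod (h \<xi>))"
    using h by simp
  have "(\<lambda>k. iexp (- (x \<bullet> \<xi>)) * (h \<xi> * complex_of_real (gaussian (1 / real (Suc k)) \<xi>)))
      \<longlonglongrightarrow> iexp (- (x \<bullet> \<xi>)) * (h \<xi> * complex_of_real 1)" for \<xi>
    by (intro tendsto_intros tendsto_gaussian)
  then show "AE \<xi> in lborel. (\<lambda>k. iexp (- (x \<bullet> \<xi>)) * (h \<xi> * complex_of_real (gaussian (1 / real (Suc k)) \<xi>)))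
      \<longlonglongrightarrow> iexp (- (x \<bullet> \<xi>)) * h \<xi>"
    by simp
  show "AE \<xi> in lborel. cmod (iexp (- (x \<bullet> \<xi>)) * (h \<xi> * complex_of_real (gaussian (1 / real (Suc k)) \<xi>)))
      \<le> cmod (h \<xi>)" for k
    by (intro AE_I2) (simp add: norm_mult mult_left_le)
qed

text \<open>The substitution x = y + \<sigma> z makes the Gaussian weight independent of \<sigma>.
  Only the argument of \<open>f\<close> moves, so continuity at \<open>y\<close> and the majorant
  \<open>B * heat 1 z\<close> give the limit.\<close>

lemma tendsto_integral_mult_heat:
  fixes f :: "'a::euclidean_space \<Rightarrow> real"
  assumes f: "continuous_on UNIV f" and bound: "\<And>x. \<bar>f x\<bar> \<le> B"
  shows "(\<lambda>k. LINT x|lborel. f x * heat (1 / real (Suc k)) (y - x)) \<longlonglongrightarrow> f y"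
proof -
  have [measurable]: "f \<in> borel_measurable borel"
    using f by (rule borel_measurable_continuous_onI)
  have "(\<lambda>k. LINT z|lborel. f (y + (1 / real (Suc k)) *\<^sub>R z) * heat 1 z) \<longlonglongrightarrow> (LINT z|lborel. f y * heat 1 (z :: 'a))"
  proof (rule integral_dominated_convergence)
    show "integrable lborel (\<lambda>z::'a. B * heat 1 z)"
      by (intro integrable_mult_right integrable_heat) auto
    show "AE z in lborel. norm (f (y + (1 / real (Suc k)) *\<^sub>R z) * heat 1 z) \<le> B * heat 1 z" for k
      using bound by (intro AE_I2) (simp add: abs_mult mult_right_mono)
    have "(\<lambda>k. y + (1 / real (Suc k)) *\<^sub>R z) \<longlonglongrightarrow> y" for z
      using tendsto_add[OF tendsto_const[of y] tendsto_scaleR[OF LIMSEQ_Suc[OF lim_1_over_n] tendsto_const[of z]]]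
      by simp
    then show "AE z in lborel. (\<lambda>k. f (y + (1 / real (Suc k)) *\<^sub>R z) * heat 1 z) \<longlonglongrightarrow> f y * heat 1 z"
      using f by (intro AE_I2 tendsto_intros isCont_tendsto_compose[of y f]) (auto simp: continuous_on_eq_continuous_at)
  qed measurable
  then show ?thesis
    by (simp add: integral_mult_heat integral_heat)
qed

text \<open>\<open>q\<close> is a bounded pointwise limit of the densities of \<open>N\<close>
  smoothed by Gaussians, whence its nonnegativity. The smoothed identity against continuous
  integrable test functions passes to the limit, and open boxes, whose indicators are limits of such
  functions, determine the measure.\<close>

theorem fourier_inversion_density:
  fixes N :: "'a::euclidean_space measure"
  assumes N: "finite_measure N" "sets N = sets borel"
    and int: "integrable lborel (\<lambda>\<xi>. LINT y|N. iexp (y \<bullet> \<xi>))"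
  defines "q \<equiv> \<lambda>x. Re (fourier (\<lambda>\<xi>. LINT y|N. iexp (y \<bullet> \<xi>)) x) / (2 * pi) ^ DIM('a)"
  shows "0 \<le> q x" and "N = density lborel (\<lambda>x. ennreal (q x))"
proof -
  interpret N: finite_measure N by fact
  interpret P: pair_sigma_finite N "lborel :: 'a measure" ..
  note [measurable_cong] = N(2)
  let ?\<phi> = "\<lambda>\<xi>. LINT y|N. iexp (y \<bullet> \<xi>)"
  let ?\<sigma> = "\<lambda>k. 1 / real (Suc k)"
  have [measurable]: "?\<phi> \<in> borel_measurable borel"
    using borel_measurable_integrable[OF int] by simp
  \<comment> \<open>The density at \<open>x\<close> of the convolution of \<open>N\<close> with a
    centred Gaussian of standard deviation 1 / (k + 1).\<close>
  define K where "K k x = (LINT y|N. heat (?\<sigma> k) (y - x))" for k and x :: 'a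
  have K: "Re (fourier (\<lambda>\<xi>. ?\<phi> \<xi> * complex_of_real (gaussian (?\<sigma> k) \<xi>)) x) / (2 * pi) ^ DIM('a) = K k x" for k x
    using fourier_char_gaussian[OF N, of "?\<sigma> k" x] by (simp add: K_def)
  have K_lim: "(\<lambda>k. K k x) \<longlonglongrightarrow> q x" for x
    unfolding K[symmetric] q_def
    by (intro tendsto_intros tendsto_fourier_gaussian int) auto
  have K_nonneg: "0 \<le> K k x" for k x
    unfolding K_def by (intro Bochner_Integration.integral_nonneg) simp
  show q_nonneg: "0 \<le> q x" for x
    by (rule LIMSEQ_le_const[OF K_lim]) (auto simp: K_nonneg)
  define C where "C = (LINT \<xi>|lborel. cmod (?\<phi> \<xi>)) / (2 * pi) ^ DIM('a)"
  have K_le: "K k x \<le> C" for k x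
  proof -
    have int_k: "integrable lborel (\<lambda>\<xi>. ?\<phi> \<xi> * complex_of_real (gaussian (?\<sigma> k) \<xi>))"
      by (rule Bochner_Integration.integrable_bound[OF int]) (auto simp: norm_mult mult_left_le)
    have "Re (fourier (\<lambda>\<xi>. ?\<phi> \<xi> * complex_of_real (gaussian (?\<sigma> k) \<xi>)) x)
        \<le> (LINT \<xi>|lborel. cmod (?\<phi> \<xi> * complex_of_real (gaussian (?\<sigma> k) \<xi>)))"
      using norm_fourier_le[OF int_k] complex_Re_le_cmod order_trans by blast
    also have "\<dots> \<le> (LINT \<xi>|lborel. cmod (?\<phi> \<xi>))"
      using int_k int by (intro integral_mono integrable_norm) (auto simp: norm_mult mult_left_le)
    finally show ?thesis
      unfolding K[symmetric] C_def by (intro divide_right_mono) auto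
  qed
  have [measurable]: "K k \<in> borel_measurable borel" for k
    unfolding K_def[abs_def] by measurable
  have [measurable]: "q \<in> borel_measurable borel"
    by (rule borel_measurable_LIMSEQ_metric[OF _ K_lim]) simp
  have q_le: "q x \<le> C" for x
    by (rule LIMSEQ_le_const2[OF K_lim]) (auto simp: K_le)
  have test: "(LINT y|N. f y) = (LINT x|lborel. f x * q x)"
    if f: "continuous_on UNIV f" "\<And>x. \<bar>f x\<bar> \<le> 1" "integrable lborel f" for f :: "'a \<Rightarrow> real"
  proof -
    have [measurable]: "f \<in> borel_measurable borel"
      using f(1) by (rule borel_measurable_continuous_onI)
    let ?F = "\<lambda>k y. LINT x|lborel. f x * heat (?\<sigma> k) (y - x)"
    have heat_refl: "integrable lborel (\<lambda>x. heat (?\<sigma> k) (y - x))" "(LINT x|lborel. heat (?\<sigma> k) (y - x)) = 1" for k and y :: 'a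
      using lborel_integrable_reflect[OF integrable_heat[of "?\<sigma> k"], of y]
        lborel_integral_reflect[OF measurable_heat, of "?\<sigma> k" y]
      by (auto simp: integral_heat)
    have int_fh: "integrable lborel (\<lambda>x. f x * heat (?\<sigma> k) (y - x))" for k y
      using f(2) by (intro Bochner_Integration.integrable_bound[OF heat_refl(1)[of k y]]) (auto simp: abs_mult intro!: AE_I2 mult_left_le_one_le)
    have abs_le: "(LINT x|lborel. \<bar>f x * heat (?\<sigma> k) (y - x)\<bar>) \<le> 1" for k y
    proof -
      have "(LINT x|lborel. \<bar>f x * heat (?\<sigma> k) (y - x)\<bar>) \<le> (LINT x|lborel. heat (?\<sigma> k) (y - x))"
        using f(2) by (intro integral_mono integrable_abs int_fh heat_refl) (auto simp: abs_mult intro!: mult_left_le_one_le)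
      then show ?thesis unfolding heat_refl(2) .
    qed
    \<comment> \<open>Fubini shifts the smoothing from the test function to the measure.\<close>
    have fub: "(LINT y|N. ?F k y) = (LINT x|lborel. f x * K k x)" for k
    proof -
      have int2: "integrable (N \<Otimes>\<^sub>M lborel) (\<lambda>(y, x). f x * heat (?\<sigma> k) (y - x))"
      proof (rule P.Fubini_integrable)
        show "integrable N (\<lambda>y. LINT x|lborel. norm (case (y, x) of (y, x) \<Rightarrow> f x * heat (?\<sigma> k) (y - x)))"
          using abs_le by (intro N.integrable_const_bound[where B=1] AE_I2) auto
        show "AE y in N. integrable lborel (\<lambda>x. case (y, x) of (y, x) \<Rightarrow> f x * heat (?\<sigma> k) (y - x))"
          using int_fh by simp
      qed measurable
      show ?thesis
        using P.Fubini_integral[OF int2] by (simp add: K_def)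
    qed
    have "(\<lambda>k. LINT y|N. ?F k y) \<longlonglongrightarrow> (LINT y|N. f y)"
    proof (rule integral_dominated_convergence[where w="\<lambda>_. 1"])
      show "AE y in N. (\<lambda>k. ?F k y) \<longlonglongrightarrow> f y"
        using f by (intro AE_I2 tendsto_integral_mult_heat)
      show "AE y in N. norm (?F k y) \<le> 1" for k
        unfolding real_norm_def by (intro AE_I2 order_trans[OF integral_abs_bound abs_le])
    qed (use N in measurable)
    moreover have "(\<lambda>k. LINT x|lborel. f x * K k x) \<longlonglongrightarrow> (LINT x|lborel. f x * q x)"
    proof (rule integral_dominated_convergence[where w="\<lambda>x. \<bar>f x\<bar> * C"])
      show "AE x in lborel. (\<lambda>k. f x * K k x) \<longlonglongrightarrow> f x * q x"
        by (intro AE_I2 tendsto_intros K_lim)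
      show "AE x in lborel. norm (f x * K k x) \<le> \<bar>f x\<bar> * C" for k
        using K_le K_nonneg by (intro AE_I2) (simp add: abs_mult mult_left_mono)
      show "integrable lborel (\<lambda>x. \<bar>f x\<bar> * C)" using f by simp
    qed measurable
    ultimately show ?thesis
      unfolding fub by (rule LIMSEQ_unique)
  qed
  have box_eq: "emeasure N (box l u) = emeasure (density lborel (\<lambda>x. ennreal (q x))) (box l u)" for l u
  proof -
    let ?U = "box l u"
    \<comment> \<open>Lipschitz functions that vanish outside the open box and increase to its
      indicator.\<close>
    define f where "f k x = min 1 (real k * infdist x (- ?U))" for k x
    \<comment> \<open>The complement must be nonempty: \<open>infdist\<close> to the empty set is 0
      by convention, which would make every \<open>f k\<close> vanish.\<close>
    have U: "open ?U" "bounded ?U" "?U \<noteq> UNIV"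
      using bounded_box[of l u] by auto
    have f_cont: "continuous_on UNIV (f k)" for k
      unfolding f_def[abs_def] by (intro continuous_intros)
    have f_bound: "\<bar>f k x\<bar> \<le> indicator ?U x" for k x
    proof -
      have "0 \<le> real k * infdist x (- ?U)" by (simp add: infdist_nonneg)
      then show ?thesis by (auto simp: f_def indicator_def min_def)
    qed
    have f_lim: "(\<lambda>k. f k x) \<longlonglongrightarrow> indicator ?U x" for x
    proof (cases "x \<in> ?U")
      case True
      have "infdist x (- ?U) \<noteq> 0"
        using True U in_closed_iff_infdist_zero[of "- ?U" x]
        by (metis ComplD Compl_UNIV_eq closed_Compl double_complement)
      then have pos: "infdist x (- ?U) > 0"
        using infdist_nonneg[of x "- ?U"] by simp
      then obtain m where m: "1 / infdist x (- ?U) < real m"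
        using reals_Archimedean2 by blast
      have "f k x = 1" if "k \<ge> m" for k
      proof -
        have "1 \<le> real m * infdist x (- ?U)" using m pos by (simp add: field_simps)
        also have "\<dots> \<le> real k * infdist x (- ?U)" using that pos by (intro mult_right_mono) auto
        finally show ?thesis by (simp add: f_def)
      qed
      then show ?thesis
        using True by (intro tendsto_eventually eventually_sequentiallyI[of m]) auto
    next
      case False
      then show ?thesis by (simp add: f_def)
    qed
    have [measurable]: "f k \<in> borel_measurable borel" for k
      using f_cont by (rule borel_measurable_continuous_onI)
    have ind_int: "integrable lborel (indicator ?U :: 'a \<Rightarrow> real)"
      by (rule integrable_real_indicator) (use emeasure_lborel_box_finite[of l u] in \<open>auto simp: less_top\<close>)
    have f_int: "integrable lborel (f k)" for k
      by (rule Bochner_Integration.integrable_bound[OF ind_int]) (use f_bound in auto)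
    have "(\<lambda>k. LINT y|N. f k y) \<longlonglongrightarrow> (LINT y|N. indicator ?U y)"
      by (rule integral_dominated_convergence[where w="\<lambda>_. 1"])
        (use f_lim f_bound N in \<open>auto simp: indicator_def intro!: AE_I2 order_trans[OF f_bound]\<close>)
    moreover have "(\<lambda>k. LINT x|lborel. f k x * q x) \<longlonglongrightarrow> (LINT x|lborel. indicator ?U x * q x)"
    proof (rule integral_dominated_convergence[where w="\<lambda>x. indicator ?U x * C"])
      show "AE x in lborel. norm (f k x * q x) \<le> indicator ?U x * C" for k
        using f_bound q_nonneg q_le by (intro AE_I2) (simp add: abs_mult mult_mono)
      show "AE x in lborel. (\<lambda>k. f k x * q x) \<longlonglongrightarrow> indicator ?U x * q x"
        by (intro AE_I2 tendsto_intros f_lim)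
    qed (use ind_int in auto)
    moreover have "(LINT y|N. f k y) = (LINT x|lborel. f k x * q x)" for k
      using f_bound by (intro test f_cont f_int) (auto intro!: order_trans[OF f_bound] simp: indicator_def)
    ultimately have "(LINT y|N. indicator ?U y) = (LINT x|lborel. indicator ?U x * q x)"
      using LIMSEQ_unique by auto
    moreover have "emeasure (density lborel (\<lambda>x. ennreal (q x))) ?U = ennreal (LINT x|lborel. indicator ?U x * q x)"
    proof -
      have "integrable lborel (\<lambda>x. indicator ?U x * q x)"
        by (rule Bochner_Integration.integrable_bound[of _ "\<lambda>x. indicator ?U x * C"])
          (use ind_int q_le q_nonneg in \<open>auto simp: abs_mult intro!: AE_I2 mult_left_mono order_trans[OF _ abs_ge_self]\<close>)
      moreover have "emeasure (density lborel (\<lambda>x. ennreal (q x))) ?U = (\<integral>\<^sup>+ x. ennreal (indicator ?U x * q x) \<partial>lborel)"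
        by (subst emeasure_density) (auto intro!: nn_integral_cong simp: indicator_def)
      ultimately show ?thesis
        using q_nonneg by (simp add: nn_integral_eq_integral)
    qed
    ultimately show ?thesis
      using N.emeasure_eq_measure N(2) by simp
  qed
  show "N = density lborel (\<lambda>x. ennreal (q x))"
  proof (rule measure_eqI_generator_eq)
    let ?E = "range (\<lambda>(a, b). box a b::'a set)"
    show "Int_stable ?E"
      by (auto simp: Int_stable_def box_Int_box)
    show "?E \<subseteq> Pow UNIV" "sets N = sigma_sets UNIV ?E" "sets (density lborel (\<lambda>x. ennreal (q x))) = sigma_sets UNIV ?E"
      by (simp_all add: borel_eq_box N(2))
    let ?A = "\<lambda>n::nat. box (- (real n *\<^sub>R One)) (real n *\<^sub>R One) :: 'a set"
    show "range ?A \<subseteq> ?E" "(\<Union>i. ?A i) = UNIV"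
      unfolding UN_box_eq_UNIV by auto
    show "emeasure N (?A i) \<noteq> \<infinity>" for i by simp
    show "emeasure N Y = emeasure (density lborel (\<lambda>x. ennreal (q x))) Y" if "Y \<in> ?E" for Y
      using that box_eq by auto
  qed
qed

text \<open>Inversion of the regularised function at the origin bounds its integral by (2 pi)^n
  \<open>C\<close>, uniformly in the width, as the heat kernel has total mass 1. Since
  \<open>\<phi>\<close> is nonnegative, Fatou's lemma removes the regularisation.\<close>

theorem integrable_char_of_bounded_density:
  fixes p :: "'a::euclidean_space \<Rightarrow> real" and \<phi> :: "'a \<Rightarrow> real"
  assumes [measurable]: "p \<in> borel_measurable borel"
    and p: "\<And>x. 0 \<le> p x" "AE x in lborel. p x \<le> C"
    and N: "finite_measure N" "N = density lborel (\<lambda>x. ennreal (p x))"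
    and \<phi>: "\<And>\<xi>. (LINT y|N. iexp (y \<bullet> \<xi>)) = complex_of_real (\<phi> \<xi>)" "\<And>\<xi>. 0 \<le> \<phi> \<xi>"
  shows "integrable lborel \<phi>"
proof -
  interpret N: finite_measure N by fact
  have sets_N: "sets N = sets borel" by (simp add: N(2))
  note [measurable_cong] = sets_N
  have "(\<lambda>\<xi>. LINT y|N. iexp (y \<bullet> \<xi>)) \<in> borel_measurable borel"
    by (rule measurable_char_function) (use N.sigma_finite_measure_axioms in \<open>auto simp: sets_N\<close>)
  from measurable_compose[OF this borel_measurable_Re] have [measurable]: "\<phi> \<in> borel_measurable borel"
    by (simp add: \<phi>(1))
  let ?\<sigma> = "\<lambda>k. 1 / real (Suc k)"
  let ?c = "\<lambda>\<xi>. \<bar>\<phi> \<xi>\<bar>"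
  have \<phi>_le: "\<phi> \<xi> \<le> measure N UNIV" for \<xi>
  proof -
    have "\<phi> \<xi> \<le> cmod (LINT y|N. iexp (y \<bullet> \<xi>))"
      by (simp add: \<phi>(1))
    also have "\<dots> \<le> (LINT y|N. cmod (iexp (y \<bullet> \<xi>)))"
      by (rule integral_norm_bound)
    also have "\<dots> = measure N UNIV"
      using sets_eq_imp_space_eq[OF sets_N] by simp
    finally show ?thesis .
  qed
  have int: "integrable lborel (\<lambda>\<xi>. \<phi> \<xi> * gaussian (?\<sigma> k) \<xi>)" for k
    by (rule Bochner_Integration.integrable_bound[of _ "\<lambda>\<xi>. measure N UNIV * gaussian (?\<sigma> k) \<xi>"])
       (use \<phi>(2) \<phi>_le in \<open>auto simp: abs_mult intro!: integrable_gaussian mult_right_mono\<close>)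
  have bound: "(LINT \<xi>|lborel. \<phi> \<xi> * gaussian (?\<sigma> k) \<xi>) \<le> (2 * pi) ^ DIM('a) * C" for k
  proof -
    have "complex_of_real (LINT \<xi>|lborel. \<phi> \<xi> * gaussian (?\<sigma> k) \<xi>)
      = fourier (\<lambda>\<xi>. (LINT y|N. iexp (y \<bullet> \<xi>)) * complex_of_real (gaussian (?\<sigma> k) \<xi>)) 0"
      by (simp add: fourier_def \<phi>(1) flip: of_real_mult)
    also have "\<dots> = complex_of_real ((2 * pi) ^ DIM('a) * (LINT y|N. heat (?\<sigma> k) y))"
      using fourier_char_gaussian[OF N(1) sets_N, of "?\<sigma> k" 0] by simp
    finally have "(LINT \<xi>|lborel. \<phi> \<xi> * gaussian (?\<sigma> k) \<xi>) = (2 * pi) ^ DIM('a) * (LINT y|N. heat (?\<sigma> k) y)"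
      using of_real_eq_iff by blast
    moreover have "(LINT y|N. heat (?\<sigma> k) y) \<le> C"
    proof -
      have ae: "AE x in lborel. p x * heat (?\<sigma> k) x \<le> C * heat (?\<sigma> k) x"
        using p(2) by eventually_elim (auto intro: mult_right_mono)
      have intC: "integrable lborel (\<lambda>x::'a. C * heat (?\<sigma> k) x)"
        by (intro integrable_mult_right integrable_heat) auto
      have "(LINT y|N. heat (?\<sigma> k) y) = (LINT x|lborel. p x * heat (?\<sigma> k) x)"
        unfolding N(2) by (subst integral_density) (auto simp: p)
      also have "\<dots> \<le> (LINT x|lborel. C * heat (?\<sigma> k) (x :: 'a))"
      proof (rule integral_mono_AE[OF _ intC ae])
        show "integrable lborel (\<lambda>x. p x * heat (?\<sigma> k) x)"
        proof (rule Bochner_Integration.integrable_bound[OF intC])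
          show "AE x in lborel. norm (p x * heat (?\<sigma> k) x) \<le> norm (C * heat (?\<sigma> k) x)"
          proof (rule eventually_mono[OF ae])
            fix x assume "p x * heat (?\<sigma> k) x \<le> C * heat (?\<sigma> k) x"
            moreover have "0 \<le> p x * heat (?\<sigma> k) x" using p(1) by simp
            ultimately show "norm (p x * heat (?\<sigma> k) x) \<le> norm (C * heat (?\<sigma> k) x)"
              unfolding real_norm_def by linarith
          qed
        qed measurable
      qed
      also have "\<dots> = C" by (simp add: integral_heat)
      finally show ?thesis .
    qed
    ultimately show ?thesis by (simp add: mult_left_mono)
  qed
  have "(\<integral>\<^sup>+ \<xi>. ennreal (\<phi> \<xi>) \<partial>lborel) = (\<integral>\<^sup>+ \<xi>. liminf (\<lambda>k. ennreal (\<phi> \<xi> * gaussian (?\<sigma> k) \<xi>)) \<partial>lborel)"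
  proof (rule nn_integral_cong)
    fix \<xi> :: 'a
    have "(\<lambda>k. ennreal (\<phi> \<xi> * gaussian (?\<sigma> k) \<xi>)) \<longlonglongrightarrow> ennreal (\<phi> \<xi> * 1)"
      by (intro tendsto_ennrealI tendsto_intros tendsto_gaussian)
    then show "ennreal (\<phi> \<xi>) = liminf (\<lambda>k. ennreal (\<phi> \<xi> * gaussian (?\<sigma> k) \<xi>))"
      by (simp add: lim_imp_Liminf)
  qed
  also have "\<dots> \<le> liminf (\<lambda>k. \<integral>\<^sup>+ \<xi>. ennreal (\<phi> \<xi> * gaussian (?\<sigma> k) \<xi>) \<partial>lborel)"
    by (rule nn_integral_liminf) measurable
  also have "\<dots> \<le> liminf (\<lambda>k::nat. ennreal ((2 * pi) ^ DIM('a) * C))"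
  proof (intro Liminf_mono always_eventually allI)
    fix k
    show "(\<integral>\<^sup>+ \<xi>. ennreal (\<phi> \<xi> * gaussian (?\<sigma> k) \<xi>) \<partial>lborel) \<le> ennreal ((2 * pi) ^ DIM('a) * C)"
      using \<phi>(2) bound by (subst nn_integral_eq_integral[OF int]) (auto intro: ennreal_leI)
  qed
  also have "\<dots> < \<infinity>"
    by (simp add: Liminf_const)
  finally show ?thesis
    using \<phi>(2) by (intro integrableI_nonneg) auto
qed

subsection \<open>Logarithmic growth and decay\<close>

lemma rapid_decay_of_log_growth:
  fixes g :: "'a::real_normed_vector \<Rightarrow> real"
  assumes growth: "filterlim (\<lambda>\<xi>. g \<xi> / ln (1 + norm \<xi>)) at_top at_infinity"
    and nonneg: "\<And>\<xi>. 0 \<le> g \<xi>" and t: "0 < t"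
  shows "\<exists>C. \<forall>\<xi>. exp (- (t * g \<xi>)) * (1 + norm \<xi>) ^ N \<le> C"
proof -
  \<comment> \<open>The threshold N / t is the one for which exp (- t g) compensates the N-th
    power.\<close>
  obtain R where R: "real N / t \<le> g \<xi> / ln (1 + norm \<xi>)" if "R \<le> norm \<xi>" for \<xi>
    using growth unfolding filterlim_at_top eventually_at_infinity by meson
  \<comment> \<open>At least 1, which keeps ln (1 + |\<xi>|) positive outside the ball of radius
    \<open>S\<close>.\<close>
  define S where "S = max R 1"
  have "exp (- (t * g \<xi>)) * (1 + norm \<xi>) ^ N \<le> (1 + S) ^ N" for \<xi>
  proof (cases "S \<le> norm \<xi>")
    case True
    then have pos: "0 < ln (1 + norm \<xi>)" by (auto simp: S_def intro!: ln_gt_zero)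
    have "real N * ln (1 + norm \<xi>) \<le> t * g \<xi>"
      using R[of \<xi>] True pos t by (simp add: S_def field_simps)
    then have "exp (- (t * g \<xi>)) * (1 + norm \<xi>) ^ N \<le> exp (- (real N * ln (1 + norm \<xi>))) * (1 + norm \<xi>) ^ N"
      by (intro mult_right_mono) auto
    also have "exp (- (real N * ln (1 + norm \<xi>))) * (1 + norm \<xi>) ^ N = 1"
    proof -
      have "(1 + norm \<xi>) ^ N = exp (real N * ln (1 + norm \<xi>))"
        by (simp add: exp_of_nat_mult add_pos_nonneg)
      then show ?thesis by (simp add: exp_minus)
    qed
    also have "1 \<le> (1 + S) ^ N"
      by (intro one_le_power) (simp add: S_def)
    finally show ?thesis .
  next
    case False
    have "exp (- (t * g \<xi>)) * (1 + norm \<xi>) ^ N \<le> 1 * (1 + S) ^ N"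
      using False t nonneg[of \<xi>] by (intro mult_mono power_mono) auto
    then show ?thesis by simp
  qed
  then show ?thesis by blast
qed

text \<open>With t = 1 / (2 Z) the decay reads g \<ge> Z (2 ln |\<xi>| - 2 ln C). The factor 2
  leaves room to absorb ln C: for large |\<xi>| the bracket is at least ln (1 + |\<xi>|).\<close>

lemma log_growth_of_decay:
  fixes g :: "'a::real_normed_vector \<Rightarrow> real"
  assumes decay: "\<And>t. 0 < t \<Longrightarrow> \<exists>C. \<forall>\<xi>. norm \<xi> * exp (- (t * g \<xi>)) \<le> C"
  shows "filterlim (\<lambda>\<xi>. g \<xi> / ln (1 + norm \<xi>)) at_top at_infinity"
proof (subst filterlim_at_top_gt[where c=0], intro allI impI)
  fix Z :: real assume Z: "0 < Z"
  obtain C' where C': "norm \<xi> * exp (- (1 / (2 * Z) * g \<xi>)) \<le> C'" for \<xi>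
    using decay[of "1 / (2 * Z)"] Z by auto
  define C where "C = max C' 1"
  have C: "norm \<xi> * exp (- (g \<xi> / (2 * Z))) \<le> C" "1 \<le> C" for \<xi>
    using C'[of \<xi>] by (auto simp: C_def)
  \<comment> \<open>The radius 2 C^2 is what makes C^2 (1 + r) \<le> r^2, using r \<ge> 1, which
    follows from C \<ge> 1.\<close>
  have "Z \<le> g \<xi> / ln (1 + norm \<xi>)" if r: "2 * C\<^sup>2 \<le> norm \<xi>" for \<xi>
  proof -
    define r where "r = norm \<xi>"
    have "1 \<le> C\<^sup>2" using C(2) by simp
    then have r1: "1 \<le> r" "2 * C\<^sup>2 \<le> r" using r by (auto simp: r_def)
    have "C\<^sup>2 * (1 + r) \<le> C\<^sup>2 * (2 * r)" using r1 by (intro mult_left_mono) auto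
    also have "\<dots> \<le> r * r" using r1 by (auto simp: mult_right_mono)
    finally have "ln (C\<^sup>2 * (1 + r)) \<le> ln (r\<^sup>2)"
      using r1 C(2) by (subst ln_le_cancel_iff) (auto simp: power2_eq_square)
    then have 1: "2 * ln C + ln (1 + r) \<le> 2 * ln r"
      using r1 C(2) by (simp add: ln_mult ln_realpow)
    have "ln (r * exp (- (g \<xi> / (2 * Z)))) \<le> ln C"
      using C(1)[of \<xi>] C(2) r1 by (subst ln_le_cancel_iff) (auto simp: r_def[symmetric])
    then have "ln r - g \<xi> / (2 * Z) \<le> ln C"
      using r1 by (simp add: ln_mult)
    with 1 have "ln (1 + r) \<le> g \<xi> / Z" by (simp add: field_simps)
    moreover have "0 < ln (1 + r)" using r1 by (intro ln_gt_zero) auto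
    ultimately show ?thesis using Z by (simp add: r_def field_simps)
  qed
  then show "eventually (\<lambda>\<xi>. Z \<le> g \<xi> / ln (1 + norm \<xi>)) at_infinity"
    unfolding eventually_at_infinity by blast
qed

text \<open>For |\<xi>| \<ge> 1 the power |\<xi>|^n is weakened to |\<xi>|, all that
  \<open>log_growth_of_decay\<close> asks for. Inside the unit ball nonnegativity of
  \<open>g\<close> makes the exponential at most 1, hence the constant \<open>max 1 (I / c)\<close>
  with \<open>c\<close> the volume of the unit ball.\<close>

lemma decay_of_radial_integrable:
  fixes g :: "real \<Rightarrow> real"
  assumes mono: "mono_on {0..} g" and nonneg: "\<And>\<xi>::'a::euclidean_space. 0 \<le> g ((norm \<xi>)\<^sup>2)"
    and int: "integrable lborel (\<lambda>\<xi>::'a. exp (- (t * g ((norm \<xi>)\<^sup>2))))" and t: "0 < t"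
  shows "\<exists>C. \<forall>\<xi>::'a. norm \<xi> * exp (- (t * g ((norm \<xi>)\<^sup>2))) \<le> C"
proof -
  let ?e = "\<lambda>\<xi>::'a. exp (- (t * g ((norm \<xi>)\<^sup>2)))"
  define I where "I = (LINT \<xi>|lborel. ?e \<xi>)"
  define c where "c = unit_ball_vol (real DIM('a))"
  have c: "0 < c" by (simp add: c_def)
  have I: "0 \<le> I" by (simp add: I_def)
  have "norm \<xi> * ?e \<xi> \<le> max 1 (I / c)" for \<xi> :: 'a
  proof (cases "1 \<le> norm \<xi>")
    case True
    define r where "r = norm \<xi>"
    have "(LINT x|lborel. indicator (ball (0::'a) r) x * ?e \<xi>) \<le> I"
      unfolding I_def
    proof (rule integral_mono[OF _ int])
      show "integrable lborel (\<lambda>x. indicator (ball (0::'a) r) x * ?e \<xi>)"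
        by (intro integrable_mult_left integrable_real_indicator) (use emeasure_lborel_ball_finite[of "0 :: 'a" r] in \<open>auto simp: less_top\<close>)
      show "indicator (ball (0::'a) r) x * ?e \<xi> \<le> ?e x" for x :: 'a
        using mono_onD[OF mono, of "(norm x)\<^sup>2" "(norm \<xi>)\<^sup>2"] t
        by (auto simp: indicator_def r_def intro!: power_mono mult_left_mono)
    qed
    also have "(LINT x|lborel. indicator (ball (0::'a) r) x * ?e \<xi>) = c * r ^ DIM('a) * ?e \<xi>"
      using content_ball[of r "0 :: 'a"] by (simp add: c_def r_def)
    finally have le_I: "c * r ^ DIM('a) * ?e \<xi> \<le> I" .
    have "c * r * ?e \<xi> \<le> c * r ^ DIM('a) * ?e \<xi>"
      using True c DIM_positive[where 'a='a] self_le_power[of r "DIM('a)"]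
      by (intro mult_right_mono mult_left_mono) (auto simp: r_def)
    from order_trans[OF this le_I] have "r * ?e \<xi> \<le> I / c"
      using c by (simp add: field_simps)
    then show ?thesis by (simp add: r_def)
  next
    case False
    then have "norm \<xi> * ?e \<xi> \<le> 1 * 1"
      using nonneg[of \<xi>] t by (intro mult_mono) auto
    then show ?thesis by simp
  qed
  then show ?thesis by blast
qed

subsection \<open>Rapidly decaying functions\<close>

text \<open>Decay faster than any power, without smoothness: this is what (a) provides for the
  characteristic function, which may fail to be differentiable.\<close>

definition rapid :: "('a::euclidean_space \<Rightarrow> complex) \<Rightarrow> bool" where
  "rapid h \<longleftrightarrow> h \<in> borel_measurable borel \<and> (\<forall>N. \<exists>C. \<forall>\<xi>. cmod (h \<xi>) * (1 + norm \<xi>) ^ N \<le> C)"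

definition poly_bounded :: "('a::euclidean_space \<Rightarrow> complex) \<Rightarrow> bool" where
  "poly_bounded P \<longleftrightarrow> P \<in> borel_measurable borel \<and> (\<exists>C k. \<forall>\<xi>. cmod (P \<xi>) \<le> C * (1 + norm \<xi>) ^ k)"

lemma rapid_measurable: "rapid h \<Longrightarrow> h \<in> borel_measurable borel"
  and poly_bounded_measurable: "poly_bounded P \<Longrightarrow> P \<in> borel_measurable borel"
  by (auto simp: rapid_def poly_bounded_def)

lemma rapid_bound:
  assumes "rapid h"
  shows "\<exists>C\<ge>0. \<forall>\<xi>. cmod (h \<xi>) \<le> C * inverse ((1 + norm \<xi>) ^ N)"
proof -
  obtain C where C: "cmod (h \<xi>) * (1 + norm \<xi>) ^ N \<le> C" for \<xi>
    using assms unfolding rapid_def by meson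
  have "0 \<le> C" by (rule order_trans[OF _ C[of 0]]) auto
  moreover have "cmod (h \<xi>) \<le> C * inverse ((1 + norm \<xi>) ^ N)" for \<xi>
    using C[of \<xi>] by (simp add: field_simps add_pos_nonneg)
  ultimately show ?thesis by blast
qed

lemma rapid_integrable:
  assumes "rapid h"
  shows "integrable lborel h"
proof -
  obtain C where C: "0 \<le> C" "\<And>\<xi>. cmod (h \<xi>) \<le> C * inverse ((1 + norm \<xi>) ^ (2 * DIM('a)))"
    using rapid_bound[OF assms, where N="2 * DIM('a)"] by blast
  show ?thesis
  proof (rule Bochner_Integration.integrable_bound)
    show "integrable lborel (\<lambda>\<xi>::'a. C * inverse ((1 + norm \<xi>) ^ (2 * DIM('a))))"
      by (intro integrable_mult_right integrable_inverse_one_plus_norm_power) simp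
    show "AE \<xi> in lborel. cmod (h \<xi>) \<le> norm (C * inverse ((1 + norm \<xi>) ^ (2 * DIM('a))))"
      using C by (intro AE_I2) (auto intro: order_trans[OF _ abs_ge_self])
  qed (use rapid_measurable[OF assms] in simp)
qed

text \<open>A nonnegative constant and an exponent that may be raised at will let two such bounds be
  brought to a common power.\<close>

lemma poly_bounded_exponent:
  assumes "poly_bounded P"
  shows "\<exists>C\<ge>0. \<exists>k. \<forall>\<xi>. \<forall>m\<ge>k. cmod (P \<xi>) \<le> C * (1 + norm \<xi>) ^ m"
proof -
  obtain C k where C: "cmod (P \<xi>) \<le> C * (1 + norm \<xi>) ^ k" for \<xi>
    using assms unfolding poly_bounded_def by meson
  have "0 \<le> C * (1 + norm (0 :: 'a)) ^ k" by (rule order_trans[OF norm_ge_zero C])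
  then have "0 \<le> C" by simp
  have "cmod (P \<xi>) \<le> C * (1 + norm \<xi>) ^ m" if "k \<le> m" for \<xi> m
  proof -
    have "C * (1 + norm \<xi>) ^ k \<le> C * (1 + norm \<xi>) ^ m"
      using \<open>0 \<le> C\<close> that by (intro mult_left_mono power_increasing) auto
    with C[of \<xi>] show ?thesis by linarith
  qed
  then show ?thesis using \<open>0 \<le> C\<close> by blast
qed

lemma rapid_mult:
  assumes P: "poly_bounded P" and h: "rapid h"
  shows "rapid (\<lambda>\<xi>. P \<xi> * h \<xi>)"
  unfolding rapid_def
proof (intro conjI allI)
  show "(\<lambda>\<xi>. P \<xi> * h \<xi>) \<in> borel_measurable borel"
    using rapid_measurable[OF h] poly_bounded_measurable[OF P] by measurable
  fix N
  obtain C k where C: "0 \<le> C" "\<And>\<xi> m. k \<le> m \<Longrightarrow> cmod (P \<xi>) \<le> C * (1 + norm \<xi>) ^ m"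
    using poly_bounded_exponent[OF P] by blast
  obtain D where D: "\<And>\<xi>. cmod (h \<xi>) * (1 + norm \<xi>) ^ (k + N) \<le> D"
    using h unfolding rapid_def by meson
  have "cmod (P \<xi> * h \<xi>) * (1 + norm \<xi>) ^ N \<le> C * D" for \<xi>
  proof -
    have "cmod (P \<xi> * h \<xi>) * (1 + norm \<xi>) ^ N \<le> (C * (1 + norm \<xi>) ^ k) * (cmod (h \<xi>) * (1 + norm \<xi>) ^ N)"
      unfolding norm_mult mult.assoc[of "cmod (P \<xi>)"] by (intro mult_right_mono C order_refl) auto
    also have "\<dots> = C * (cmod (h \<xi>) * (1 + norm \<xi>) ^ (k + N))"
      by (simp add: power_add mult_ac)
    also have "\<dots> \<le> C * D" by (intro mult_left_mono C D)
    finally show ?thesis .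
  qed
  then show "\<exists>C. \<forall>\<xi>. cmod (P \<xi> * h \<xi>) * (1 + norm \<xi>) ^ N \<le> C" by blast
qed

lemma poly_bounded_const [simp]: "poly_bounded (\<lambda>_. c)"
  unfolding poly_bounded_def by (intro conjI exI[of _ "cmod c"] exI[of _ 0]) auto

lemma poly_bounded_inner [simp]: "poly_bounded (\<lambda>\<xi>. complex_of_real (v \<bullet> \<xi>))"
  unfolding poly_bounded_def
proof (intro conjI exI[of _ "norm v"] exI[of _ 1] allI)
  fix \<xi> :: 'a
  have "\<bar>v \<bullet> \<xi>\<bar> \<le> norm v * norm \<xi>" by (rule Cauchy_Schwarz_ineq2)
  also have "\<dots> \<le> norm v * (1 + norm \<xi>) ^ 1" by (intro mult_left_mono) auto
  finally show "cmod (complex_of_real (v \<bullet> \<xi>)) \<le> norm v * (1 + norm \<xi>) ^ 1" by simp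
qed measurable

lemma poly_bounded_add:
  assumes "poly_bounded P" "poly_bounded Q"
  shows "poly_bounded (\<lambda>\<xi>. P \<xi> + Q \<xi>)"
proof -
  obtain C k where C: "0 \<le> C" "\<And>\<xi> m. k \<le> m \<Longrightarrow> cmod (P \<xi>) \<le> C * (1 + norm \<xi>) ^ m"
    using poly_bounded_exponent[OF assms(1)] by blast
  obtain D l where D: "0 \<le> D" "\<And>\<xi> m. l \<le> m \<Longrightarrow> cmod (Q \<xi>) \<le> D * (1 + norm \<xi>) ^ m"
    using poly_bounded_exponent[OF assms(2)] by blast
  have "cmod (P \<xi> + Q \<xi>) \<le> (C + D) * (1 + norm \<xi>) ^ (k + l)" for \<xi>
    using C(2)[of "k + l" \<xi>] D(2)[of "k + l" \<xi>] norm_triangle_ineq[of "P \<xi>" "Q \<xi>"]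
    by (simp add: distrib_right)
  then show ?thesis
    unfolding poly_bounded_def
    by (intro conjI borel_measurable_add poly_bounded_measurable assms exI[of _ "C + D"] exI[of _ "k + l"] allI)
qed

lemma poly_bounded_mult:
  assumes "poly_bounded P" "poly_bounded Q"
  shows "poly_bounded (\<lambda>\<xi>. P \<xi> * Q \<xi>)"
proof -
  obtain C k where C: "0 \<le> C" "\<And>\<xi> m. k \<le> m \<Longrightarrow> cmod (P \<xi>) \<le> C * (1 + norm \<xi>) ^ m"
    using poly_bounded_exponent[OF assms(1)] by blast
  obtain D l where D: "0 \<le> D" "\<And>\<xi> m. l \<le> m \<Longrightarrow> cmod (Q \<xi>) \<le> D * (1 + norm \<xi>) ^ m"
    using poly_bounded_exponent[OF assms(2)] by blast
  have "cmod (P \<xi> * Q \<xi>) \<le> (C * D) * (1 + norm \<xi>) ^ (k + l)" for \<xi>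
  proof -
    have "cmod (P \<xi>) * cmod (Q \<xi>) \<le> (C * (1 + norm \<xi>) ^ k) * (D * (1 + norm \<xi>) ^ l)"
      using C D by (intro mult_mono) auto
    then show ?thesis by (simp add: norm_mult power_add mult_ac)
  qed
  then show ?thesis
    unfolding poly_bounded_def
    by (intro conjI borel_measurable_times poly_bounded_measurable assms exI[of _ "C * D"] exI[of _ "k + l"] allI)
qed

lemma fourier_add:
  assumes "rapid h" "rapid k"
  shows "fourier (\<lambda>\<xi>. h \<xi> + k \<xi>) x = fourier h x + fourier k x"
  unfolding fourier_def distrib_left
  by (intro Bochner_Integration.integral_add integrable_iexp_mult rapid_integrable assms)

lemma fourier_cmult: "fourier (\<lambda>\<xi>. c * h \<xi>) x = c * fourier h x"
  unfolding fourier_def by (subst mult.left_commute) (rule integral_mult_right_zero)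

lemma norm_iexp_minus_taylor: "cmod (iexp a - 1 - \<i> * complex_of_real a) \<le> a\<^sup>2 / 2"
  using iexp_approx1[of a 1] by (simp add: numeral_2_eq_2 diff_diff_eq)

text \<open>The first-order Taylor remainder of the exponential is at most half of (v . \<xi>)^2, so
  the error is at most \<open>K\<close> |v|^2 with \<open>K\<close> half the second absolute moment
  of \<open>h\<close>. This yields the Frechet derivative at once, without passing through partial
  derivatives.\<close>

lemma fourier_has_derivative:
  assumes h: "rapid (h :: 'a::euclidean_space \<Rightarrow> complex)"
  shows "(fourier h has_derivative (\<lambda>v. fourier (\<lambda>\<xi>. (- \<i> * complex_of_real (v \<bullet> \<xi>)) * h \<xi>) x)) (at x)"
proof -
  let ?D = "\<lambda>v. fourier (\<lambda>\<xi>. (- \<i> * complex_of_real (v \<bullet> \<xi>)) * h \<xi>) x"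
  have r1: "rapid (\<lambda>\<xi>. (- \<i> * complex_of_real (v \<bullet> \<xi>)) * h \<xi>)" for v
    by (intro rapid_mult h poly_bounded_mult) auto
  have int2: "integrable lborel (\<lambda>\<xi>. (norm \<xi>)\<^sup>2 * cmod (h \<xi>))"
  proof -
    have "poly_bounded (\<lambda>\<xi>::'a. complex_of_real ((norm \<xi>)\<^sup>2))"
      unfolding poly_bounded_def
      by (intro conjI exI[of _ "1::real"] exI[of _ "2::nat"] allI) (auto simp: norm_power intro!: power_mono)
    from integrable_norm[OF rapid_integrable[OF rapid_mult[OF this h]]] show ?thesis
      by (simp add: norm_mult norm_power)
  qed
  define K where "K = (LINT \<xi>|lborel. (norm \<xi>)\<^sup>2 * cmod (h \<xi>)) / 2"
  have lin: "linear ?D"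
  proof (rule linearI)
    fix v w
    have "?D (v + w) = fourier (\<lambda>\<xi>. (- \<i> * complex_of_real (v \<bullet> \<xi>)) * h \<xi> + (- \<i> * complex_of_real (w \<bullet> \<xi>)) * h \<xi>) x"
      by (simp add: inner_add_left algebra_simps)
    then show "?D (v + w) = ?D v + ?D w" by (simp only: fourier_add[OF r1 r1])
  next
    fix r :: real and v
    have "?D (r *\<^sub>R v) = fourier (\<lambda>\<xi>. complex_of_real r * ((- \<i> * complex_of_real (v \<bullet> \<xi>)) * h \<xi>)) x"
      by (simp add: algebra_simps)
    then show "?D (r *\<^sub>R v) = r *\<^sub>R ?D v" by (simp only: fourier_cmult scaleR_conv_of_real)
  qed
  have est: "cmod (fourier h (x + v) - fourier h x - ?D v) \<le> K * (norm v)\<^sup>2" for v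
  proof -
    let ?R = "\<lambda>\<xi>. iexp (- ((x + v) \<bullet> \<xi>)) * h \<xi> - iexp (- (x \<bullet> \<xi>)) * h \<xi>
        - iexp (- (x \<bullet> \<xi>)) * ((- \<i> * complex_of_real (v \<bullet> \<xi>)) * h \<xi>)"
    have ints: "integrable lborel (\<lambda>\<xi>. iexp (- (y \<bullet> \<xi>)) * h \<xi>)"
      "integrable lborel (\<lambda>\<xi>. iexp (- (y \<bullet> \<xi>)) * ((- \<i> * complex_of_real (v \<bullet> \<xi>)) * h \<xi>))" for y
      using integrable_iexp_mult[OF rapid_integrable[OF h]] integrable_iexp_mult[OF rapid_integrable[OF r1]] by auto
    have eq: "fourier h (x + v) - fourier h x - ?D v = (LINT \<xi>|lborel. ?R \<xi>)"
      unfolding fourier_def using ints by (simp del: of_real_minus)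
    have bound: "cmod (?R \<xi>) \<le> (norm v)\<^sup>2 / 2 * ((norm \<xi>)\<^sup>2 * cmod (h \<xi>))" for \<xi>
    proof -
      have "?R \<xi> = iexp (- (x \<bullet> \<xi>)) * (iexp (- (v \<bullet> \<xi>)) - 1 - \<i> * complex_of_real (- (v \<bullet> \<xi>))) * h \<xi>"
        by (simp add: inner_add_left exp_add[symmetric] algebra_simps)
      then have "cmod (?R \<xi>) = cmod (iexp (- (v \<bullet> \<xi>)) - 1 - \<i> * complex_of_real (- (v \<bullet> \<xi>))) * cmod (h \<xi>)"
        by (simp only: norm_mult norm_iexp mult_1)
      also have "\<dots> \<le> ((v \<bullet> \<xi>)\<^sup>2 / 2) * cmod (h \<xi>)"
        using norm_iexp_minus_taylor[of "- (v \<bullet> \<xi>)"] by (intro mult_right_mono) auto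
      also have "\<dots> \<le> ((norm v * norm \<xi>)\<^sup>2 / 2) * cmod (h \<xi>)"
        using Cauchy_Schwarz_ineq2[of v \<xi>]
        by (intro mult_right_mono divide_right_mono) (auto simp: abs_le_square_iff[symmetric])
      finally show ?thesis by (simp add: power_mult_distrib mult_ac)
    qed
    have "cmod (LINT \<xi>|lborel. ?R \<xi>) \<le> (LINT \<xi>|lborel. (norm v)\<^sup>2 / 2 * ((norm \<xi>)\<^sup>2 * cmod (h \<xi>)))"
      by (intro Bochner_Integration.integral_norm_bound_integral Bochner_Integration.integrable_diff ints
        integrable_mult_right int2 bound)
    then show ?thesis unfolding integral_mult_right_zero eq K_def by (simp only: mult.commute times_divide_eq_left times_divide_eq_right)
  qed
  show ?thesis
    unfolding has_derivative_at
  proof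
    show "bounded_linear ?D" using lin by (simp add: linear_conv_bounded_linear)
    show "((\<lambda>v. cmod (fourier h (x + v) - fourier h x - ?D v) / norm v) \<longlongrightarrow> 0) (at 0)"
    proof (rule tendsto_sandwich)
      show "eventually (\<lambda>v. 0 \<le> cmod (fourier h (x + v) - fourier h x - ?D v) / norm v) (at 0)"
        by simp
      show "eventually (\<lambda>v. cmod (fourier h (x + v) - fourier h x - ?D v) / norm v \<le> K * norm v) (at 0)"
        unfolding eventually_at_filter
        using est by (intro always_eventually allI impI) (simp add: divide_simps power2_eq_square mult_ac)
      show "((\<lambda>v::'a. K * norm v) \<longlongrightarrow> 0) (at 0)"
        by (auto intro!: tendsto_eq_intros)
    qed auto
  qed
qed

lemma continuous_on_fourier: "rapid h \<Longrightarrow> continuous_on UNIV (fourier h)"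
  by (meson continuous_at_imp_continuous_on fourier_has_derivative has_derivative_continuous)

lemma measurable_fourier: "rapid h \<Longrightarrow> fourier h \<in> borel_measurable borel"
  by (intro borel_measurable_continuous_onI continuous_on_fourier)

text \<open>Polynomial growth of \<open>P\<close> and of its derivatives along \<open>e\<close> up
  to order \<open>m\<close>. A single direction is recorded because integration by parts moves along
  one basis vector at a time.\<close>

primrec slow :: "'a \<Rightarrow> nat \<Rightarrow> ('a::euclidean_space \<Rightarrow> complex) \<Rightarrow> bool" where
  "slow e 0 P \<longleftrightarrow> poly_bounded P"
| "slow e (Suc m) P \<longleftrightarrow> poly_bounded P \<and>
    (\<exists>P'. (\<forall>\<xi>. ((\<lambda>s. P (\<xi> + s *\<^sub>R e)) has_vector_derivative P' \<xi>) (at 0)) \<and> slow e m P')"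

lemma slow_poly_bounded: "slow e m P \<Longrightarrow> poly_bounded P"
  by (cases m) auto

lemma slow_SucD: "slow e (Suc m) P \<Longrightarrow> slow e m P"
proof (induction m arbitrary: P)
  case (Suc m)
  then show ?case by (metis slow.simps(2))
qed auto

lemma slow_const [simp]: "slow e m (\<lambda>_. c)"
  by (induction m arbitrary: c) (auto intro!: exI[of _ "\<lambda>_. 0"])

lemma slow_inner [simp]: "slow e m (\<lambda>\<xi>. complex_of_real (v \<bullet> \<xi>))"
proof (cases m)
  case (Suc k)
  have "((\<lambda>s. complex_of_real (v \<bullet> (\<xi> + s *\<^sub>R e))) has_vector_derivative complex_of_real (v \<bullet> e)) (at 0)" for \<xi>
    by (intro has_vector_derivative_of_real) (auto intro!: derivative_eq_intros simp: inner_add_right has_real_derivative_iff_has_vector_derivative[symmetric])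
  then show ?thesis unfolding Suc by (auto intro!: exI[of _ "\<lambda>_. complex_of_real (v \<bullet> e)"])
qed simp

lemma slow_add: "slow e m P \<Longrightarrow> slow e m Q \<Longrightarrow> slow e m (\<lambda>\<xi>. P \<xi> + Q \<xi>)"
proof (induction m arbitrary: P Q)
  case (Suc m)
  obtain P' Q' where "\<And>\<xi>. ((\<lambda>s. P (\<xi> + s *\<^sub>R e)) has_vector_derivative P' \<xi>) (at 0)" "slow e m P'"
    "\<And>\<xi>. ((\<lambda>s. Q (\<xi> + s *\<^sub>R e)) has_vector_derivative Q' \<xi>) (at 0)" "slow e m Q'"
    using Suc.prems by auto
  then show ?case
    using Suc by (auto intro!: exI[of _ "\<lambda>\<xi>. P' \<xi> + Q' \<xi>"] poly_bounded_add has_vector_derivative_add)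
qed (simp add: poly_bounded_add)

lemma slow_mult: "slow e m P \<Longrightarrow> slow e m Q \<Longrightarrow> slow e m (\<lambda>\<xi>. P \<xi> * Q \<xi>)"
proof (induction m arbitrary: P Q)
  case (Suc m)
  obtain P' Q' where *: "\<And>\<xi>. ((\<lambda>s. P (\<xi> + s *\<^sub>R e)) has_vector_derivative P' \<xi>) (at 0)" "slow e m P'"
    "\<And>\<xi>. ((\<lambda>s. Q (\<xi> + s *\<^sub>R e)) has_vector_derivative Q' \<xi>) (at 0)" "slow e m Q'"
    using Suc.prems by auto
  have "slow e m (\<lambda>\<xi>. P \<xi> * Q' \<xi> + P' \<xi> * Q \<xi>)"
    by (rule slow_add[OF Suc.IH[OF slow_SucD[OF Suc.prems(1)] *(4)] Suc.IH[OF *(2) slow_SucD[OF Suc.prems(2)]]])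
  moreover have "((\<lambda>s. P (\<xi> + s *\<^sub>R e) * Q (\<xi> + s *\<^sub>R e)) has_vector_derivative P \<xi> * Q' \<xi> + P' \<xi> * Q \<xi>) (at 0)" for \<xi>
    using has_vector_derivative_mult[OF *(1)[of \<xi>] *(3)[of \<xi>]] by simp
  ultimately show ?case
    using Suc.prems by (auto intro!: exI[of _ "\<lambda>\<xi>. P \<xi> * Q' \<xi> + P' \<xi> * Q \<xi>"] poly_bounded_mult)
qed (simp add: poly_bounded_mult)

text \<open>Each derivative moved off the exponential by parts gains a factor \<open>x \<bullet> e\<close>.\<close>

lemma fourier_directional_decay:
  assumes E: "rapid E" and E': "\<And>\<xi>. ((\<lambda>s. E (\<xi> + s *\<^sub>R e)) has_vector_derivative L \<xi> * E \<xi>) (at 0)"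
    and L: "\<And>m. slow e m L" and P: "slow e m P"
  shows "\<exists>C. \<forall>x. \<bar>x \<bullet> e\<bar> ^ m * cmod (fourier (\<lambda>\<xi>. P \<xi> * E \<xi>) x) \<le> C"
  using P
proof (induction m arbitrary: P)
  case 0
  then show ?case
    using norm_fourier_le[OF rapid_integrable[OF rapid_mult[OF _ E]]] by auto
next
  case (Suc m)
  obtain P' where P': "\<And>\<xi>. ((\<lambda>s. P (\<xi> + s *\<^sub>R e)) has_vector_derivative P' \<xi>) (at 0)" "slow e m P'"
    using Suc.prems by auto
  \<comment> \<open>The derivative of P E is (P' + P L) E. As the derivative of \<open>E\<close> is
    a multiple of \<open>E\<close>, the product keeps its shape and the symbol loses one order, so
    the induction hypothesis applies.\<close>
  let ?Q = "\<lambda>\<xi>. P' \<xi> + P \<xi> * L \<xi>"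
  have Q: "slow e m ?Q"
    by (rule slow_add[OF P'(2) slow_mult[OF slow_SucD[OF Suc.prems] L]])
  note pb = slow_poly_bounded[OF Suc.prems] slow_poly_bounded[OF Q]
  obtain C where C: "\<bar>x \<bullet> e\<bar> ^ m * cmod (fourier (\<lambda>\<xi>. ?Q \<xi> * E \<xi>) x) \<le> C" for x
    using Suc.IH[OF Q] by auto
  have "complex_of_real (x \<bullet> e) * fourier (\<lambda>\<xi>. P \<xi> * E \<xi>) x = - \<i> * fourier (\<lambda>\<xi>. ?Q \<xi> * E \<xi>) x" for x
  proof -
    let ?f = "\<lambda>\<xi>. iexp (- (x \<bullet> \<xi>)) * (P \<xi> * E \<xi>)"
    let ?k = "\<lambda>\<xi>. (- \<i> * complex_of_real (x \<bullet> e)) * (P \<xi> * E \<xi>) + ?Q \<xi> * E \<xi>"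
    let ?f' = "\<lambda>\<xi>. iexp (- (x \<bullet> \<xi>)) * ?k \<xi>"
    have "rapid (\<lambda>\<xi>. ((- \<i> * complex_of_real (x \<bullet> e)) * P \<xi> + ?Q \<xi>) * E \<xi>)"
      by (rule rapid_mult[OF poly_bounded_add[OF poly_bounded_mult[OF poly_bounded_const pb(1)] pb(2)] E])
    then have k: "rapid ?k" by (simp add: algebra_simps)
    obtain B where B: "0 \<le> B" "\<And>\<xi>. cmod (?k \<xi>) \<le> B * inverse ((1 + norm \<xi>) ^ (2 * DIM('a)))"
      using rapid_bound[OF k, where N="2 * DIM('a)"] by blast
    \<comment> \<open>The majorant must serve all shifts by s e with |s| < 1. There 1 + |\<xi>| is
      at most (1 + |e|) (1 + |\<xi> + s e|), an inequality of Peetre type.\<close>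
    let ?g = "\<lambda>\<xi>::'a. B * (1 + norm e) ^ (2 * DIM('a)) * inverse ((1 + norm \<xi>) ^ (2 * DIM('a)))"
    have "(LINT \<xi>|lborel. ?f' \<xi>) = 0"
    proof (rule lborel_integral_directional_derivative(2)[of ?f e ?f' ?g])
      show "integrable lborel ?f"
        by (intro integrable_iexp_mult rapid_integrable rapid_mult pb E)
      show "integrable lborel ?g"
        by (intro integrable_mult_right integrable_inverse_one_plus_norm_power) simp
      show "((\<lambda>s. ?f (\<xi> + s *\<^sub>R e)) has_vector_derivative ?f' \<xi>) (at 0)" for \<xi>
      proof -
        have "((\<lambda>s. iexp (- (x \<bullet> (\<xi> + s *\<^sub>R e)))) has_vector_derivative (- (x \<bullet> e)) *\<^sub>R (\<i> * iexp (- (x \<bullet> (\<xi> + 0 *\<^sub>R e))))) (at 0)"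
          by (rule vector_diff_chain_at[where g=iexp, unfolded o_def])
            (auto intro!: derivative_eq_intros has_vector_derivative_iexp simp: inner_add_right has_real_derivative_iff_has_vector_derivative[symmetric])
        from has_vector_derivative_mult[OF this has_vector_derivative_mult[OF P'(1)[of \<xi>] E'[of \<xi>]]]
        show ?thesis
          by (simp add: scaleR_conv_of_real algebra_simps)
      qed
      show "cmod (?f' (\<xi> + s *\<^sub>R e)) \<le> ?g \<xi>" if s: "\<bar>s\<bar> < 1" for s \<xi>
      proof -
        have "norm \<xi> \<le> norm (\<xi> + s *\<^sub>R e) + norm (s *\<^sub>R e)"
          using norm_triangle_ineq4[of "\<xi> + s *\<^sub>R e" "s *\<^sub>R e"] by simp
        moreover have "norm (s *\<^sub>R e) \<le> norm e"
          using s by (simp add: mult_left_le_one_le)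
        ultimately have "1 + norm \<xi> \<le> 1 + norm (\<xi> + s *\<^sub>R e) + norm e" by simp
        also have "\<dots> \<le> (1 + norm e) * (1 + norm (\<xi> + s *\<^sub>R e))"
          by (simp add: algebra_simps)
        finally have "(1 + norm \<xi>) ^ (2 * DIM('a)) \<le> (1 + norm e) ^ (2 * DIM('a)) * (1 + norm (\<xi> + s *\<^sub>R e)) ^ (2 * DIM('a))"
          by (subst power_mult_distrib[symmetric]) (intro power_mono, auto)
        then have "inverse ((1 + norm (\<xi> + s *\<^sub>R e)) ^ (2 * DIM('a))) \<le> (1 + norm e) ^ (2 * DIM('a)) * inverse ((1 + norm \<xi>) ^ (2 * DIM('a)))"
          by (simp add: field_simps add_pos_nonneg)
        then have "B * inverse ((1 + norm (\<xi> + s *\<^sub>R e)) ^ (2 * DIM('a))) \<le> ?g \<xi>"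
          using B(1) by (simp add: mult_left_mono mult.assoc)
        with B(2)[of "\<xi> + s *\<^sub>R e"] show ?thesis by (simp only: norm_mult norm_iexp mult_1)
      qed
    qed
    then have "fourier ?k x = 0" by (simp add: fourier_def)
    moreover have "fourier ?k x = (- \<i> * complex_of_real (x \<bullet> e)) * fourier (\<lambda>\<xi>. P \<xi> * E \<xi>) x + fourier (\<lambda>\<xi>. ?Q \<xi> * E \<xi>) x"
      unfolding fourier_add[OF rapid_mult[OF poly_bounded_const rapid_mult[OF pb(1) E]] rapid_mult[OF pb(2) E]]
        fourier_cmult ..
    ultimately have "\<i> * (complex_of_real (x \<bullet> e) * fourier (\<lambda>\<xi>. P \<xi> * E \<xi>) x) = fourier (\<lambda>\<xi>. ?Q \<xi> * E \<xi>) x"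
      by (simp add: algebra_simps)
    from arg_cong[OF this, of "\<lambda>z. - \<i> * z"] show ?thesis by simp
  qed
  then have eq: "\<bar>x \<bullet> e\<bar> * cmod (fourier (\<lambda>\<xi>. P \<xi> * E \<xi>) x) = cmod (fourier (\<lambda>\<xi>. ?Q \<xi> * E \<xi>) x)" for x
    by (metis norm_mult norm_of_real norm_minus_cancel norm_ii mult_1)
  have "\<bar>x \<bullet> e\<bar> ^ Suc m * cmod (fourier (\<lambda>\<xi>. P \<xi> * E \<xi>) x) \<le> C" for x
    using C[of x] unfolding eq[symmetric] power_Suc by (simp only: mult_ac)
  then show ?case by blast
qed

text \<open>The directional bounds combine through the largest absolute coordinate M of x, taken to
  be at least 1: 1 + |x| \<le> (1 + n) M, and M^m is at most 1 plus the sum of the m-th powers of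
  the absolute coordinates.\<close>

lemma fourier_rapid_decay:
  fixes E :: "'a::euclidean_space \<Rightarrow> complex"
  assumes E: "rapid E"
    and E': "\<And>e \<xi>. e \<in> Basis \<Longrightarrow> ((\<lambda>s. E (\<xi> + s *\<^sub>R e)) has_vector_derivative L e \<xi> * E \<xi>) (at 0)"
    and L: "\<And>e m. e \<in> Basis \<Longrightarrow> slow e m (L e)" and P: "\<And>e m. e \<in> Basis \<Longrightarrow> slow e m P"
  shows "\<exists>C. \<forall>x. cmod (fourier (\<lambda>\<xi>. P \<xi> * E \<xi>) x) * (1 + norm x) ^ m \<le> C"
proof -
  let ?F = "\<lambda>x. cmod (fourier (\<lambda>\<xi>. P \<xi> * E \<xi>) x)"
  obtain e0 :: 'a where e0: "e0 \<in> Basis" using nonempty_Basis by blast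
  obtain C0 where C0: "?F x \<le> C0" for x
    using fourier_directional_decay[OF E E' L P, of e0 0] e0 by auto
  have "\<forall>e\<in>Basis. \<exists>C. \<forall>x. \<bar>x \<bullet> e\<bar> ^ m * ?F x \<le> C"
    using fourier_directional_decay[OF E E' L P] by blast
  then obtain C where C: "\<And>e x. e \<in> Basis \<Longrightarrow> \<bar>x \<bullet> e\<bar> ^ m * ?F x \<le> C e"
    by metis
  let ?d = "real (1 + DIM('a))"
  have "?F x * (1 + norm x) ^ m \<le> ?d ^ m * (C0 + (\<Sum>e\<in>Basis. C e))" for x
  proof -
    define M where "M = Max (insert 1 ((\<lambda>e. \<bar>x \<bullet> e\<bar>) ` Basis))"
    have M: "1 \<le> M" "\<And>e. e \<in> Basis \<Longrightarrow> \<bar>x \<bullet> e\<bar> \<le> M"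
      unfolding M_def by (rule Max_ge; simp)+
    have "norm x \<le> (\<Sum>e\<in>Basis. \<bar>x \<bullet> e\<bar>)" by (rule norm_le_l1)
    also have "\<dots> \<le> (\<Sum>e\<in>(Basis::'a set). M)" using M by (intro sum_mono)
    finally have "1 + norm x \<le> ?d * M" using M(1) by (simp add: algebra_simps)
    then have 1: "(1 + norm x) ^ m \<le> ?d ^ m * M ^ m"
      by (subst power_mult_distrib[symmetric]) (intro power_mono, auto)
    have Mp: "M ^ m \<le> 1 + (\<Sum>e\<in>Basis. \<bar>x \<bullet> e\<bar> ^ m)"
    proof -
      have "M \<in> insert 1 ((\<lambda>e. \<bar>x \<bullet> e\<bar>) ` Basis)" unfolding M_def by (rule Max_in) auto
      then show ?thesis
      proof
        assume "M = 1" then show ?thesis by (simp add: sum_nonneg)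
      next
        assume "M \<in> (\<lambda>e. \<bar>x \<bullet> e\<bar>) ` Basis"
        then obtain e where "e \<in> Basis" "M = \<bar>x \<bullet> e\<bar>" by auto
        then show ?thesis
          using member_le_sum[of e Basis "\<lambda>e. \<bar>x \<bullet> e\<bar> ^ m"] by auto
      qed
    qed
    have "?F x * (1 + norm x) ^ m \<le> ?F x * (?d ^ m * (1 + (\<Sum>e\<in>Basis. \<bar>x \<bullet> e\<bar> ^ m)))"
      using Mp by (intro mult_left_mono order_trans[OF 1]) auto
    also have "\<dots> = ?d ^ m * (?F x + (\<Sum>e\<in>Basis. \<bar>x \<bullet> e\<bar> ^ m * ?F x))"
      by (simp add: algebra_simps sum_distrib_left)
    also have "\<dots> \<le> ?d ^ m * (C0 + (\<Sum>e\<in>Basis. C e))"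
      using C0 C by (intro mult_left_mono add_mono sum_mono) auto
    finally show ?thesis .
  qed
  then show ?thesis by blast
qed

subsection \<open>Compound Poisson laws and convolution\<close>

text \<open>Restriction to the finitely many coordinates involved reduces the claim to a finite
  product. The infinite product is there for sums with a random, unbounded number of terms.\<close>

lemma (in product_prob_space) integral_PiM_prod_finite:
  fixes f :: "'i \<Rightarrow> 'a \<Rightarrow> 'b::{real_normed_field, banach, second_countable_topology}"
  assumes J: "finite J" "J \<subseteq> I" and f: "\<And>i. i \<in> J \<Longrightarrow> integrable (M i) (f i)"
  shows "(\<integral>\<omega>. (\<Prod>i\<in>J. f i (\<omega> i)) \<partial>PiM I M) = (\<Prod>i\<in>J. \<integral>x. f i x \<partial>M i)"
proof -
  have [measurable]: "f i \<in> borel_measurable (M i)" if "i \<in> J" for i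
    using f[OF that] by simp
  have "(\<Prod>i\<in>J. \<integral>x. f i x \<partial>M i) = (\<integral>\<omega>. (\<Prod>i\<in>J. f i (\<omega> i)) \<partial>PiM J M)"
    by (rule product_integral_prod[OF J(1) f, symmetric])
  also have "\<dots> = (\<integral>\<omega>. (\<Prod>i\<in>J. f i (\<omega> i)) \<partial>distr (PiM I M) (PiM J M) (\<lambda>x. restrict x J))"
    by (simp only: distr_PiM_restrict_finite[OF J])
  also have "\<dots> = (\<integral>\<omega>. (\<Prod>i\<in>J. f i (restrict \<omega> J i)) \<partial>PiM I M)"
    using J by (intro integral_distr measurable_restrict_subset) measurable
  also have "\<dots> = (\<integral>\<omega>. (\<Prod>i\<in>J. f i (\<omega> i)) \<partial>PiM I M)"
    by (intro Bochner_Integration.integral_cong prod.cong) auto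
  finally show ?thesis by simp
qed

text \<open>The Poisson generating function on the closed unit disc, where the values of
  characteristic functions lie.\<close>

lemma poisson_expectation_power:
  fixes z :: complex
  assumes r: "0 < r" and z: "cmod z \<le> 1"
  shows "(\<integral>n. z ^ n \<partial>measure_pmf (poisson_pmf r)) = exp (complex_of_real r * (z - 1))"
proof -
  let ?a = "\<lambda>n. pmf (poisson_pmf r) n *\<^sub>R z ^ n"
  have int: "integrable (count_space UNIV) ?a"
  proof -
    have "integrable (measure_pmf (poisson_pmf r)) (\<lambda>n. z ^ n)"
      by (rule measure_pmf.integrable_const_bound[where B=1]) (use z in \<open>auto simp: norm_power power_le_one\<close>)
    then show ?thesis
      unfolding measure_pmf_eq_density by (subst (asm) integrable_density) auto
  qed
  have "(\<integral>n. z ^ n \<partial>measure_pmf (poisson_pmf r)) = (\<integral>n. ?a n \<partial>count_space UNIV)"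
    unfolding measure_pmf_eq_density by (subst integral_density) auto
  also have "\<dots> = (\<Sum>n. ?a n)"
    by (rule integral_count_space_nat[OF int])
  also have "\<dots> = exp (complex_of_real r * (z - 1))"
  proof (rule sums_unique[symmetric])
    have "(\<lambda>n. exp (- complex_of_real r) * ((complex_of_real r * z) ^ n /\<^sub>R fact n)) sums (exp (- complex_of_real r) * exp (complex_of_real r * z))"
      by (intro sums_mult exp_converges)
    moreover have "exp (- complex_of_real r) * ((complex_of_real r * z) ^ n /\<^sub>R fact n) = ?a n" for n
      using r by (simp add: scaleR_conv_of_real power_mult_distrib exp_of_real[symmetric] divide_inverse mult_ac del: exp_of_real flip: of_real_minus)
    moreover have "exp (- complex_of_real r) * exp (complex_of_real r * z) = exp (complex_of_real r * (z - 1))"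
      by (simp add: exp_add[symmetric] algebra_simps)
    ultimately show "?a sums exp (complex_of_real r * (z - 1))" by simp
  qed
  finally show ?thesis .
qed

text \<open>The witness is the law of a sum of a Poisson number of independent jumps with law
  \<open>P\<close>. Given n summands its characteristic function is an n-th power, and averaging
  over n produces the exponential.\<close>

lemma compound_poisson_exists:
  fixes P :: "'a::euclidean_space measure"
  assumes P: "prob_space P" "sets P = sets borel" and r: "0 < r"
  shows "\<exists>N. prob_space N \<and> sets N = sets borel \<and>
    (\<forall>\<xi>. (LINT y|N. iexp (y \<bullet> \<xi>)) = exp (complex_of_real r * ((LINT y|P. iexp (y \<bullet> \<xi>)) - 1)))"
proof -
  interpret P: prob_space P by fact
  interpret PI: product_prob_space "\<lambda>_::nat. P" UNIV ..
  note [measurable_cong] = P(2)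
  let ?S = "PiM (UNIV :: nat set) (\<lambda>_. P)"
  interpret S: prob_space ?S by (rule PI.P.prob_space_axioms)
  let ?\<Omega> = "measure_pmf (poisson_pmf r) \<Otimes>\<^sub>M ?S"
  interpret PP: pair_prob_space "measure_pmf (poisson_pmf r)" ?S ..
  have Z[measurable]: "(\<lambda>(n, \<omega>). \<Sum>i<n. \<omega> i :: 'a) \<in> ?\<Omega> \<rightarrow>\<^sub>M borel"
  proof -
    have "(\<lambda>(n, \<omega>). \<Sum>i<n. \<omega> i :: 'a) \<in> count_space UNIV \<Otimes>\<^sub>M ?S \<rightarrow>\<^sub>M borel"
      by (rule measurable_pair_measure_countable1) (auto intro!: borel_measurable_sum)
    then show ?thesis
      by (subst measurable_cong_sets[OF sets_pair_measure_cong[OF sets_measure_pmf_count_space refl] refl])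
  qed
  define N where "N = distr ?\<Omega> borel (\<lambda>(n, \<omega>). \<Sum>i<n. \<omega> i :: 'a)"
  have "(LINT y|N. iexp (y \<bullet> \<xi>)) = exp (complex_of_real r * ((LINT y|P. iexp (y \<bullet> \<xi>)) - 1))" for \<xi>
  proof -
    let ?\<phi> = "LINT y|P. iexp (y \<bullet> \<xi>)"
    have int_iexp: "integrable P (\<lambda>y. iexp (y \<bullet> \<xi>))"
      by (rule P.integrable_const_bound[where B=1]) auto
    have \<phi>: "cmod ?\<phi> \<le> 1"
      using integral_norm_bound[of P "\<lambda>y. iexp (y \<bullet> \<xi>)"] by (simp add: P.prob_space)
    have int: "integrable ?\<Omega> (\<lambda>x. iexp ((case x of (n, \<omega>) \<Rightarrow> \<Sum>i<n. \<omega> i) \<bullet> \<xi>))"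
      by (rule PP.P.integrable_const_bound[where B=1]) auto
    have "(LINT y|N. iexp (y \<bullet> \<xi>)) = (LINT x|?\<Omega>. iexp ((case x of (n, \<omega>) \<Rightarrow> \<Sum>i<n. \<omega> i) \<bullet> \<xi>))"
      unfolding N_def by (subst integral_distr) auto
    also have "\<dots> = (LINT n|measure_pmf (poisson_pmf r). LINT \<omega>|?S. iexp ((\<Sum>i<n. \<omega> i) \<bullet> \<xi>))"
      using PP.integral_fst'[OF int] by simp
    also have "\<dots> = (LINT n|measure_pmf (poisson_pmf r). ?\<phi> ^ n)"
    proof (intro Bochner_Integration.integral_cong refl)
      fix n
      have "(LINT \<omega>|?S. iexp ((\<Sum>i<n. \<omega> i) \<bullet> \<xi>)) = (LINT \<omega>|?S. (\<Prod>i<n. iexp (\<omega> i \<bullet> \<xi>)))"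
        by (simp add: inner_sum_left sum_distrib_left exp_sum)
      also have "\<dots> = (\<Prod>i<n. ?\<phi>)"
        by (rule PI.integral_PiM_prod_finite) (auto intro: int_iexp)
      finally show "(LINT \<omega>|?S. iexp ((\<Sum>i<n. \<omega> i) \<bullet> \<xi>)) = ?\<phi> ^ n" by simp
    qed
    also have "\<dots> = exp (complex_of_real r * (?\<phi> - 1))"
      by (rule poisson_expectation_power[OF r \<phi>])
    finally show ?thesis .
  qed
  moreover have "prob_space N"
    unfolding N_def by (rule PP.P.prob_space_distr) measurable
  ultimately show ?thesis
    by (intro exI[of _ N]) (auto simp: N_def)
qed

text \<open>With c the total mass, the jumps have law \<rho> / c and arrive at rate t c, so that c
  cancels in the exponent. For c = 0 this normalisation breaks down and the Dirac measure at the
  origin takes over.\<close>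

lemma compound_poisson_exists_finite:
  fixes \<rho> :: "'a::euclidean_space measure"
  assumes \<rho>: "finite_measure \<rho>" "sets \<rho> = sets borel" and t: "0 < t"
  shows "\<exists>N. prob_space N \<and> sets N = sets borel \<and>
    (\<forall>\<xi>. (LINT y|N. iexp (y \<bullet> \<xi>)) = exp (- (complex_of_real t * (LINT y|\<rho>. 1 - iexp (y \<bullet> \<xi>)))))"
proof -
  interpret \<rho>: finite_measure \<rho> by fact
  note [measurable_cong] = \<rho>(2)
  define c where "c = measure \<rho> (space \<rho>)"
  have int_iexp: "integrable \<rho> (\<lambda>y. iexp (y \<bullet> \<xi>))" for \<xi>
    by (rule \<rho>.integrable_const_bound[where B=1]) auto
  have eq: "(LINT y|\<rho>. 1 - iexp (y \<bullet> \<xi>)) = complex_of_real c - (LINT y|\<rho>. iexp (y \<bullet> \<xi>))" for \<xi>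
    using int_iexp[of \<xi>] by (simp add: c_def scaleR_conv_of_real)
  show ?thesis
  proof (cases "c = 0")
    case True
    have "(LINT y|\<rho>. 1 - iexp (y \<bullet> \<xi>)) = 0" for \<xi>
    proof (rule integral_eq_zero_AE)
      have "emeasure \<rho> (space \<rho>) = 0" using True by (simp add: c_def \<rho>.emeasure_eq_measure)
      then show "AE y in \<rho>. 1 - iexp (y \<bullet> \<xi>) = 0"
        by (intro AE_I[of _ _ "space \<rho>"]) auto
    qed
    then show ?thesis
      by (intro exI[of _ "return borel 0"]) (auto intro!: prob_space_return simp: integral_return)
  next
    case False
    then have c: "0 < c" by (simp add: c_def zero_less_measure_iff less_le)
    define P where "P = density \<rho> (\<lambda>_. ennreal (1 / c))"
    have "prob_space P"
    proof
      have "emeasure P (space P) = ennreal (1 / c) * ennreal c"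
        by (simp add: P_def emeasure_density nn_integral_cmult_indicator \<rho>.emeasure_eq_measure c_def)
      also have "\<dots> = 1" using c by (simp flip: ennreal_mult)
      finally show "emeasure P (space P) = 1" .
    qed
    moreover have "sets P = sets borel" by (simp add: P_def \<rho>(2))
    moreover have "0 < t * c" using c t by simp
    ultimately obtain N where N: "prob_space N" "sets N = sets borel"
      "\<And>\<xi>. (LINT y|N. iexp (y \<bullet> \<xi>)) = exp (complex_of_real (t * c) * ((LINT y|P. iexp (y \<bullet> \<xi>)) - 1))"
      using compound_poisson_exists by blast
    have "(LINT y|P. iexp (y \<bullet> \<xi>)) = (LINT y|\<rho>. iexp (y \<bullet> \<xi>)) / complex_of_real c" for \<xi>
      unfolding P_def using c
      by (subst integral_density) (auto simp: scaleR_conv_of_real divide_inverse mult.commute)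
    then have "complex_of_real (t * c) * ((LINT y|P. iexp (y \<bullet> \<xi>)) - 1)
        = - (complex_of_real t * (LINT y|\<rho>. 1 - iexp (y \<bullet> \<xi>)))" for \<xi>
      using c unfolding eq by (simp add: field_simps)
    then show ?thesis
      using N by auto
  qed
qed

text \<open>Integrability is Fubini with translation invariance. A heavy-tailed \<open>N\<close>
  allows no rate at infinity, so the limit is obtained by dominated convergence for a radial
  majorant.\<close>

lemma
  fixes g :: "'a::euclidean_space \<Rightarrow> complex"
  assumes N: "prob_space N" "sets N = sets borel"
    and [measurable]: "g \<in> borel_measurable borel"
    and g: "\<And>x. cmod (g x) * (1 + norm x) ^ (2 * DIM('a)) \<le> C"
  shows integrable_convolution: "integrable lborel (\<lambda>x. LINT y|N. g (x - y))"
    and tendsto_convolution: "((\<lambda>x. LINT y|N. g (x - y)) \<longlongrightarrow> 0) at_infinity"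
proof -
  interpret N: prob_space N by fact
  interpret P: pair_sigma_finite N "lborel :: 'a measure" ..
  interpret Q: pair_sigma_finite "lborel :: 'a measure" N ..
  note [measurable_cong] = N(2)
  let ?k = "2 * DIM('a)"
  have C: "0 \<le> C" by (rule order_trans[OF _ g[of 0]]) simp
  have g': "cmod (g x) \<le> C * inverse ((1 + norm x) ^ ?k)" for x
    using g[of x] by (simp add: field_simps add_pos_nonneg)
  have int_g: "integrable lborel g"
  proof (rule Bochner_Integration.integrable_bound)
    show "integrable lborel (\<lambda>\<xi>::'a. C * inverse ((1 + norm \<xi>) ^ ?k))"
      by (intro integrable_mult_right integrable_inverse_one_plus_norm_power) simp
    show "AE x in lborel. cmod (g x) \<le> norm (C * inverse ((1 + norm x) ^ ?k))"
      using g' C by (intro AE_I2) (auto intro: order_trans[OF _ abs_ge_self])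
  qed measurable
  have int_shift: "integrable lborel (\<lambda>x. g (x - y))" for y
    using lborel_integrable_translate[OF int_g, of "- y"] by simp
  have norm_shift: "(LINT x|lborel. cmod (g (x - y))) = (LINT x|lborel. cmod (g x))" for y
    using lborel_integral_translate[of "\<lambda>x. cmod (g x)" "- y"] by simp
  have "integrable (N \<Otimes>\<^sub>M lborel) (\<lambda>(y, x). g (x - y))"
    by (rule P.Fubini_integrable) (auto simp: norm_shift int_shift)
  from Q.integrable_fst'[OF P.integrable_product_swap[OF this]]
  show "integrable lborel (\<lambda>x. LINT y|N. g (x - y))" by simp
  \<comment> \<open>Since |x - y| \<ge> |x| - |y|, the bound on \<open>g\<close> is estimated
    through |x| alone. The cut at 0 keeps the integrand between 0 and C also where |y| exceeds
    r.\<close>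
  define D where "D r = (LINT y|N. C * inverse ((1 + max 0 (r - norm y)) ^ ?k))" for r
  have "(D \<longlongrightarrow> (LINT y|N. 0)) at_top"
    unfolding D_def
  proof (rule integral_dominated_convergence_at_top[where w="\<lambda>_. C"])
    show "AE y in N. ((\<lambda>r. C * inverse ((1 + max 0 (r - norm y)) ^ ?k)) \<longlongrightarrow> 0) at_top"
    proof (rule AE_I2)
      fix y :: 'a
      have "filterlim (\<lambda>r. 1 + max 0 (r - norm y)) at_top at_top"
        by (rule filterlim_at_top_mono[OF filterlim_tendsto_add_at_top[OF tendsto_const[of "1 - norm y"] filterlim_ident]])
           (auto intro!: always_eventually)
      then have "filterlim (\<lambda>r. (1 + max 0 (r - norm y)) ^ ?k) at_top at_top"
        by (intro filterlim_pow_at_top) auto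
      then show "((\<lambda>r. C * inverse ((1 + max 0 (r - norm y)) ^ ?k)) \<longlongrightarrow> 0) at_top"
        by (auto intro!: tendsto_mult_right_zero tendsto_inverse_0_at_top)
    qed
    show "\<forall>\<^sub>F r in at_top. AE y in N. norm (C * inverse ((1 + max 0 (r - norm y)) ^ ?k)) \<le> C"
    proof (intro always_eventually allI AE_I2)
      fix r and y :: 'a
      have "inverse ((1 + max 0 (r - norm y)) ^ ?k) \<le> 1"
        by (intro inverse_le_1_iff[THEN iffD2] disjI2 one_le_power) auto
      moreover have "0 \<le> inverse ((1 + max 0 (r - norm y)) ^ ?k)"
        by (intro inverse_nonnegative_iff_nonnegative[THEN iffD2] zero_le_power) auto
      ultimately show "norm (C * inverse ((1 + max 0 (r - norm y)) ^ ?k)) \<le> C"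
        using C by (simp add: abs_mult mult_left_le)
    qed
  qed measurable
  then have D_lim: "(D \<longlongrightarrow> 0) at_top" by simp
  have "cmod (LINT y|N. g (x - y)) \<le> D (norm x)" for x
    unfolding D_def
  proof (rule order_trans[OF integral_norm_bound], rule integral_mono)
    have le: "cmod (g (x - y)) \<le> C * inverse ((1 + max 0 (norm x - norm y)) ^ ?k)" for y
    proof (rule order_trans[OF g' mult_left_mono[OF _ C]])
      have "(1 + max 0 (norm x - norm y)) ^ ?k \<le> (1 + norm (x - y)) ^ ?k"
        using norm_triangle_ineq2[of x y] by (intro power_mono) auto
      then show "inverse ((1 + norm (x - y)) ^ ?k) \<le> inverse ((1 + max 0 (norm x - norm y)) ^ ?k)"
        by (intro le_imp_inverse_le zero_less_power) auto
    qed
    show "cmod (g (x - y)) \<le> C * inverse ((1 + max 0 (norm x - norm y)) ^ ?k)" for y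
      by (rule le)
    have "C * inverse ((1 + max 0 (norm x - norm y)) ^ ?k) \<le> C" for y :: 'a
      using C by (intro mult_left_le inverse_le_1_iff[THEN iffD2] disjI2 one_le_power) auto
    moreover have "0 \<le> C * inverse ((1 + max 0 (norm x - norm y)) ^ ?k)" for y :: 'a
      using C by (intro mult_nonneg_nonneg inverse_nonnegative_iff_nonnegative[THEN iffD2] zero_le_power) auto
    ultimately show "integrable N (\<lambda>y. C * inverse ((1 + max 0 (norm x - norm y)) ^ ?k))"
      by (intro N.integrable_const_bound[where B=C]) (auto simp del: inverse_nonnegative_iff_nonnegative)
    then show "integrable N (\<lambda>y. cmod (g (x - y)))"
      by (rule Bochner_Integration.integrable_bound)
         (use le in \<open>auto intro!: AE_I2 order_trans[OF le abs_ge_self]\<close>)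
  qed
  then show "((\<lambda>x. LINT y|N. g (x - y)) \<longlongrightarrow> 0) at_infinity"
    by (intro Lim_null_comparison[OF always_eventually filterlim_compose[OF D_lim filterlim_norm_at_top]]) auto
qed

lemma fourier_mult_char:
  fixes h :: "'a::euclidean_space \<Rightarrow> complex"
  assumes N: "prob_space N" "sets N = sets borel" and h: "integrable lborel h"
  shows "fourier (\<lambda>\<xi>. h \<xi> * (LINT y|N. iexp (y \<bullet> \<xi>))) x = (LINT y|N. fourier h (x - y))"
proof -
  interpret N: prob_space N by fact
  interpret P: pair_sigma_finite N "lborel :: 'a measure" ..
  note [measurable_cong] = N(2)
  have [measurable]: "h \<in> borel_measurable borel"
    using borel_measurable_integrable[OF h] by simp
  let ?g = "\<lambda>y \<xi>. iexp (- ((x - y) \<bullet> \<xi>)) * h \<xi>"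
  have int: "integrable (N \<Otimes>\<^sub>M lborel) (case_prod ?g)"
  proof (rule P.Fubini_integrable)
    show "integrable N (\<lambda>y. LINT \<xi>|lborel. cmod (case (y, \<xi>) of (y, \<xi>) \<Rightarrow> ?g y \<xi>))"
      by (simp add: norm_mult)
    show "AE y in N. integrable lborel (\<lambda>\<xi>. case (y, \<xi>) of (y, \<xi>) \<Rightarrow> ?g y \<xi>)"
      unfolding prod.case by (intro AE_I2 integrable_iexp_mult h)
  qed measurable
  have "fourier (\<lambda>\<xi>. h \<xi> * (LINT y|N. iexp (y \<bullet> \<xi>))) x = (LINT \<xi>|lborel. LINT y|N. ?g y \<xi>)"
    unfolding fourier_def
  proof (intro Bochner_Integration.integral_cong refl)
    fix \<xi>
    have "(LINT y|N. ?g y \<xi>) = (LINT y|N. (iexp (- (x \<bullet> \<xi>)) * h \<xi>) * iexp (y \<bullet> \<xi>))"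
      by (intro Bochner_Integration.integral_cong refl)
         (simp add: inner_diff_left exp_diff exp_minus field_simps)
    also have "\<dots> = iexp (- (x \<bullet> \<xi>)) * (h \<xi> * (LINT y|N. iexp (y \<bullet> \<xi>)))"
      unfolding integral_mult_right_zero by (simp only: mult.assoc)
    finally show "iexp (- (x \<bullet> \<xi>)) * (h \<xi> * (LINT y|N. iexp (y \<bullet> \<xi>))) = (LINT y|N. ?g y \<xi>)" by (rule sym)
  qed
  also have "\<dots> = (LINT y|N. LINT \<xi>|lborel. ?g y \<xi>)"
    using P.Fubini_integral[OF int] .
  finally show ?thesis by (simp add: fourier_def)
qed

subsection \<open>Splitting off the large jumps\<close>

locale levy_jumps =
  fixes \<nu> :: "'a::euclidean_space measure"
  assumes sets_nu [measurable_cong]: "sets \<nu> = sets borel"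
    and null_zero: "emeasure \<nu> {0} = 0"
    and finite_min: "(\<integral>\<^sup>+ y. ennreal (min 1 ((norm y)\<^sup>2)) \<partial>\<nu>) < \<infinity>"
begin

section \<open>Integrability against a Levy measure\<close>

lemmas [measurable_cong] = sets_nu

lemma space_nu: "space \<nu> = UNIV"
  using sets_eq_imp_space_eq[OF sets_nu] by simp

lemma sets_unit_ball [measurable]: "cball (0::'a) 1 \<in> sets borel" "- cball (0::'a) 1 \<in> sets borel"
  by auto

lemma integrable_min: "integrable \<nu> (\<lambda>y. min 1 ((norm y)\<^sup>2))"
  using finite_min by (intro integrableI_bounded) auto

text \<open>Markov's inequality for min 1 |y|^2 gives finite mass to the sets where it is at least 1
  / (k + 1). These exhaust everything but the origin, which is a null set. Sigma-finiteness makes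
  the integrals over jumps measurable in \<xi>.\<close>

sublocale sigma_finite_measure \<nu>
proof
  let ?A = "\<lambda>k. {y::'a. 1 / real (Suc k) \<le> min 1 ((norm y)\<^sup>2)}"
  have fin: "emeasure \<nu> (?A k) \<noteq> \<infinity>" for k
  proof -
    have iff: "1 / real (Suc k) \<le> w \<longleftrightarrow> 1 \<le> ennreal (real (Suc k)) * ennreal w" if "0 \<le> w" for w :: real
    proof -
      have "1 \<le> ennreal (real (Suc k)) * ennreal w \<longleftrightarrow> ennreal 1 \<le> ennreal (real (Suc k) * w)"
        using that by (subst ennreal_mult) auto
      also have "\<dots> \<longleftrightarrow> 1 \<le> real (Suc k) * w"
        using that by (subst ennreal_le_iff) auto
      finally show ?thesis by (simp add: divide_le_eq mult.commute)
    qed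
    have "?A k = {y. 1 \<le> ennreal (real (Suc k)) * ennreal (min 1 ((norm y)\<^sup>2))}"
      by (intro Collect_cong iff) simp
    also have "\<dots> = {y \<in> space \<nu>. 1 \<le> ennreal (real (Suc k)) * ennreal (min 1 ((norm y)\<^sup>2))}"
      by (simp only: space_nu UNIV_I simp_thms)
    also have "emeasure \<nu> \<dots> \<le> ennreal (real (Suc k)) * (\<integral>\<^sup>+ y. ennreal (min 1 ((norm y)\<^sup>2)) \<partial>\<nu>)"
      using nn_integral_Markov_inequality[where u="\<lambda>y. ennreal (min 1 ((norm y)\<^sup>2))" and M=\<nu> and A="space \<nu>" and c="ennreal (real (Suc k))"]
      by (simp add: nn_set_integral_space del: of_nat_Suc)
    also have "\<dots> < \<infinity>"
      using finite_min by (simp add: ennreal_mult_less_top)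
    finally show ?thesis by simp
  qed
  show "\<exists>A. countable A \<and> A \<subseteq> sets \<nu> \<and> \<Union> A = space \<nu> \<and> (\<forall>a\<in>A. emeasure \<nu> a \<noteq> \<infinity>)"
  proof (intro exI[of _ "insert {0} (range ?A)"] conjI ballI)
    show "\<Union> (insert {0} (range ?A)) = space \<nu>"
    proof -
      have "y \<in> (\<Union>k. ?A k)" if "y \<noteq> 0" for y :: 'a
      proof -
        have "0 < min 1 ((norm y)\<^sup>2)" using that by simp
        then obtain k where "1 / real (Suc k) < min 1 ((norm y)\<^sup>2)"
          using nat_approx_posE by blast
        then show ?thesis by (auto intro: less_imp_le)
      qed
      then show ?thesis using sets_eq_imp_space_eq[OF sets_nu] by auto
    qed
    show "insert {0} (range ?A) \<subseteq> sets \<nu>" unfolding sets_nu by auto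
    show "emeasure \<nu> a \<noteq> \<infinity>" if "a \<in> insert {0} (range ?A)" for a
      using that fin null_zero by auto
  qed auto
qed

abbreviation small :: "'a \<Rightarrow> real" where "small y \<equiv> indicator (cball 0 1) y"
abbreviation large :: "'a \<Rightarrow> real" where "large y \<equiv> indicator (- cball 0 1) y"

lemma integrable_small: "integrable \<nu> (\<lambda>y. small y * (norm y)\<^sup>2)"
  by (rule Bochner_Integration.integrable_bound[OF integrable_min])
     (auto simp: indicator_def power_le_one)

lemma integrable_large: "integrable \<nu> large"
  by (rule Bochner_Integration.integrable_bound[OF integrable_min])
     (auto simp: indicator_def min_def power_le_one_iff)

text \<open>Quadratic vanishing at the origin is what the defining condition of a Levy measure makes
  integrable; the small-jump integrands below are all brought into this form.\<close>

lemma integrable_small_bound: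
  fixes f :: "'a \<Rightarrow> complex"
  assumes [measurable]: "f \<in> borel_measurable borel" and bound: "\<And>y. norm y \<le> 1 \<Longrightarrow> cmod (f y) \<le> C * (norm y)\<^sup>2"
  shows "integrable \<nu> (\<lambda>y. small y *\<^sub>R f y)"
    and "cmod (LINT y|\<nu>. small y *\<^sub>R f y) \<le> C * (LINT y|\<nu>. small y * (norm y)\<^sup>2)"
proof -
  have int: "integrable \<nu> (\<lambda>y. C * (small y * (norm y)\<^sup>2))"
    by (intro integrable_mult_right integrable_small)
  have b: "cmod (small y *\<^sub>R f y) \<le> C * (small y * (norm y)\<^sup>2)" for y
    using bound[of y] by (auto simp: indicator_def)
  show i: "integrable \<nu> (\<lambda>y. small y *\<^sub>R f y)"
  proof (rule Bochner_Integration.integrable_bound[OF int])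
    show "AE y in \<nu>. norm (small y *\<^sub>R f y) \<le> norm (C * (small y * (norm y)\<^sup>2))"
      unfolding real_norm_def by (intro AE_I2 order_trans[OF b abs_ge_self])
  qed measurable
  have "cmod (LINT y|\<nu>. small y *\<^sub>R f y) \<le> (LINT y|\<nu>. C * (small y * (norm y)\<^sup>2))"
    by (intro Bochner_Integration.integral_norm_bound_integral i int b)
  then show "cmod (LINT y|\<nu>. small y *\<^sub>R f y) \<le> C * (LINT y|\<nu>. small y * (norm y)\<^sup>2)" by simp
qed

lemma integrable_large_bound:
  fixes f :: "'a \<Rightarrow> 'b::{banach, second_countable_topology}"
  assumes [measurable]: "f \<in> borel_measurable borel" and bound: "\<And>y. 1 < norm y \<Longrightarrow> norm (f y) \<le> C"
  shows "integrable \<nu> (\<lambda>y. large y *\<^sub>R f y)"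
proof (rule Bochner_Integration.integrable_bound)
  show "integrable \<nu> (\<lambda>y. C * large y)"
    by (intro integrable_mult_right integrable_large)
  show "AE y in \<nu>. norm (large y *\<^sub>R f y) \<le> norm (C * large y)"
    using bound by (intro AE_I2) (auto simp: indicator_def intro: order_trans[OF _ abs_ge_self])
qed measurable

definition kern :: "'a \<Rightarrow> 'a \<Rightarrow> complex" where
  "kern \<xi> y = 1 - iexp (y \<bullet> \<xi>) + \<i> * of_real ((y \<bullet> \<xi>) / (1 + (norm y)\<^sup>2))"

lemma measurable_kern [measurable (raw)]:
  assumes [measurable]: "f \<in> borel_measurable M" "h \<in> borel_measurable M"
  shows "(\<lambda>x. kern (f x) (h x)) \<in> borel_measurable M"
  unfolding kern_def by measurable

lemma abs_compensator_error: "\<bar>r / (1 + (norm y)\<^sup>2) - r\<bar> \<le> \<bar>r\<bar> * (norm (y::'a))\<^sup>2"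
proof -
  have *: "r / (1 + (norm y)\<^sup>2) - r = - (r * ((norm y)\<^sup>2 / (1 + (norm y)\<^sup>2)))"
    by (simp add: field_simps add_pos_nonneg add_nonneg_eq_0_iff)
  have "(norm y)\<^sup>2 / (1 + (norm y)\<^sup>2) \<le> (norm y)\<^sup>2 / 1"
    by (intro divide_left_mono) (auto simp: add_pos_nonneg)
  then have "\<bar>r\<bar> * ((norm y)\<^sup>2 / (1 + (norm y)\<^sup>2)) \<le> \<bar>r\<bar> * (norm y)\<^sup>2"
    by (intro mult_left_mono) auto
  then show ?thesis unfolding * by (simp add: abs_mult)
qed

text \<open>The kernel is regrouped into two second-order errors: the exponential minus its linear
  Taylor polynomial, and the cost of replacing the linear term by the compensator.\<close>

lemma norm_kern_small:
  assumes "norm y \<le> 1"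
  shows "cmod (kern \<xi> y) \<le> ((norm \<xi>)\<^sup>2 + norm \<xi>) * (norm y)\<^sup>2"
proof -
  have ip: "\<bar>y \<bullet> \<xi>\<bar> \<le> norm y * norm \<xi>" by (rule Cauchy_Schwarz_ineq2)
  have "kern \<xi> y = - (iexp (y \<bullet> \<xi>) - 1 - \<i> * complex_of_real (y \<bullet> \<xi>))
      + \<i> * complex_of_real ((y \<bullet> \<xi>) / (1 + (norm y)\<^sup>2) - (y \<bullet> \<xi>))"
    by (simp add: kern_def algebra_simps)
  also have "cmod \<dots> \<le> cmod (iexp (y \<bullet> \<xi>) - 1 - \<i> * complex_of_real (y \<bullet> \<xi>))
      + \<bar>(y \<bullet> \<xi>) / (1 + (norm y)\<^sup>2) - (y \<bullet> \<xi>)\<bar>"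
    by (rule norm_triangle_le) (simp only: norm_minus_cancel norm_mult norm_ii norm_of_real mult_1)
  also have "\<dots> \<le> (y \<bullet> \<xi>)\<^sup>2 / 2 + \<bar>y \<bullet> \<xi>\<bar> * (norm y)\<^sup>2"
    by (intro add_mono norm_iexp_minus_taylor abs_compensator_error)
  also have "\<dots> \<le> (norm y * norm \<xi>)\<^sup>2 + norm \<xi> * (norm y)\<^sup>2"
  proof (rule add_mono)
    have "(y \<bullet> \<xi>)\<^sup>2 \<le> (norm y * norm \<xi>)\<^sup>2"
      using ip by (simp add: abs_le_square_iff[symmetric])
    then show "(y \<bullet> \<xi>)\<^sup>2 / 2 \<le> (norm y * norm \<xi>)\<^sup>2" by (smt (verit) zero_le_power2 field_sum_of_halves)
    have "\<bar>y \<bullet> \<xi>\<bar> \<le> 1 * norm \<xi>"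
      using ip assms by (meson mult_right_mono norm_ge_zero order_trans)
    then show "\<bar>y \<bullet> \<xi>\<bar> * (norm y)\<^sup>2 \<le> norm \<xi> * (norm y)\<^sup>2"
      by (intro mult_right_mono) auto
  qed
  finally show ?thesis by (simp add: power_mult_distrib algebra_simps)
qed

text \<open>The share of the compensator carried by the large jumps, finite because |y| / (1 +
  |y|^2) \<le> 1 and the large jumps have finite mass. Moved into \<open>small_exponent\<close>, it
  leaves \<open>large_exponent\<close> as a pure compound Poisson exponent.\<close>

definition drift :: 'a where
  "drift = (LINT y|\<nu>. large y *\<^sub>R (y /\<^sub>R (1 + (norm y)\<^sup>2)))"

definition small_exponent :: "'a \<Rightarrow> 'a \<Rightarrow> complex" where
  "small_exponent l \<xi> = \<i> * of_real ((l + drift) \<bullet> \<xi>) + (LINT y|\<nu>. small y *\<^sub>R kern \<xi> y)"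

definition large_exponent :: "'a \<Rightarrow> complex" where
  "large_exponent \<xi> = (LINT y|\<nu>. large y *\<^sub>R (1 - iexp (y \<bullet> \<xi>)))"

lemma integrable_drift: "integrable \<nu> (\<lambda>y. large y *\<^sub>R (y /\<^sub>R (1 + (norm y)\<^sup>2)))"
proof (rule integrable_large_bound[where C=1])
  fix y :: 'a assume "1 < norm y"
  then have "norm y \<le> 1 + (norm y)\<^sup>2"
    using self_le_power[of "norm y" 2] by simp
  moreover have "0 < 1 + (norm y)\<^sup>2" by (simp add: add_pos_nonneg)
  ultimately show "norm (y /\<^sub>R (1 + (norm y)\<^sup>2)) \<le> 1"
    by (simp add: field_simps)
qed measurable

lemma integral_kern_split:
  "\<i> * of_real (l \<bullet> \<xi>) + (LINT y|\<nu>. kern \<xi> y) = small_exponent l \<xi> + large_exponent \<xi>"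
proof -
  have i1: "integrable \<nu> (\<lambda>y. small y *\<^sub>R kern \<xi> y)"
    by (rule integrable_small_bound(1)[OF _ norm_kern_small]) measurable
  have i2: "integrable \<nu> (\<lambda>y. large y *\<^sub>R (1 - iexp (y \<bullet> \<xi>)))"
  proof (rule integrable_large_bound[where C=2])
    show "cmod (1 - iexp (y \<bullet> \<xi>)) \<le> 2" for y
      using norm_triangle_ineq4[of 1 "iexp (y \<bullet> \<xi>)"] by simp
  qed measurable
  let ?d = "\<lambda>y. (large y *\<^sub>R (y /\<^sub>R (1 + (norm y)\<^sup>2))) \<bullet> \<xi>"
  have i3: "integrable \<nu> ?d" "(LINT y|\<nu>. ?d y) = drift \<bullet> \<xi>"
    unfolding drift_def
    by (rule integrable_inner_left[OF integrable_drift], rule integral_inner_left[OF integrable_drift])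
  have i4: "integrable \<nu> (\<lambda>y. \<i> * complex_of_real (?d y))"
    "(LINT y|\<nu>. \<i> * complex_of_real (?d y)) = \<i> * of_real (drift \<bullet> \<xi>)"
    by (intro integrable_mult_right integrable_of_real i3(1))
       (simp only: integral_mult_right_zero integral_complex_of_real i3(2))
  have "(LINT y|\<nu>. kern \<xi> y) = (LINT y|\<nu>. small y *\<^sub>R kern \<xi> y + (large y *\<^sub>R (1 - iexp (y \<bullet> \<xi>)) + \<i> * complex_of_real (?d y)))"
    by (intro Bochner_Integration.integral_cong) (auto simp: indicator_def kern_def divide_inverse mult.commute)
  also have "\<dots> = (LINT y|\<nu>. small y *\<^sub>R kern \<xi> y) + (large_exponent \<xi> + \<i> * of_real (drift \<bullet> \<xi>))"
    unfolding Bochner_Integration.integral_add[OF i1 Bochner_Integration.integrable_add[OF i2 i4(1)]]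
      Bochner_Integration.integral_add[OF i2 i4(1)] i4(2) large_exponent_def ..
  finally show ?thesis
    by (simp add: small_exponent_def inner_add_left algebra_simps)
qed

lemma measurable_small_exponent [measurable]: "small_exponent l \<in> borel_measurable borel"
  unfolding small_exponent_def[abs_def] by measurable

text \<open>Bounds the cost of dividing out the large jumps: the modulus of exp (t
  \<open>large_exponent\<close>) is bounded uniformly in \<xi>, so rapid decay of the full
  characteristic function passes to the small-jump factor.\<close>

lemma Re_large_exponent_le: "Re (large_exponent \<xi>) \<le> 2 * (LINT y|\<nu>. large y)"
proof -
  have "Re (large_exponent \<xi>) \<le> cmod (large_exponent \<xi>)" by (rule complex_Re_le_cmod)
  also have "\<dots> \<le> (LINT y|\<nu>. 2 * large y)"
    unfolding large_exponent_def
  proof (intro Bochner_Integration.integral_norm_bound_integral integrable_mult_right integrable_large)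
    have b: "cmod (1 - iexp (y \<bullet> \<xi>)) \<le> 2" for y
      using norm_triangle_ineq4[of 1 "iexp (y \<bullet> \<xi>)"] by simp
    then show "integrable \<nu> (\<lambda>y. large y *\<^sub>R (1 - iexp (y \<bullet> \<xi>)))"
      by (intro integrable_large_bound[where C=2]) auto
    show "cmod (large y *\<^sub>R (1 - iexp (y \<bullet> \<xi>))) \<le> 2 * large y" for y
      using b by (auto simp: indicator_def)
  qed
  finally show ?thesis by simp
qed

lemma large_part_law:
  assumes t: "0 < t"
  shows "\<exists>N. prob_space N \<and> sets N = sets borel \<and>
    (\<forall>\<xi>. (LINT y|N. iexp (y \<bullet> \<xi>)) = exp (- (complex_of_real t * large_exponent \<xi>)))"
proof -
  let ?\<rho> = "density \<nu> (\<lambda>y. ennreal (large y))"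
  have "finite_measure ?\<rho>"
  proof
    have "emeasure ?\<rho> (space ?\<rho>) = (\<integral>\<^sup>+ y. ennreal (large y) \<partial>\<nu>)"
      by (simp add: emeasure_density)
    also have "\<dots> \<noteq> \<infinity>"
      using nn_integral_eq_integral[OF integrable_large] by simp
    finally show "emeasure ?\<rho> (space ?\<rho>) \<noteq> \<infinity>" .
  qed
  moreover have "sets ?\<rho> = sets borel" by (simp add: sets_nu)
  moreover have "(LINT y|?\<rho>. 1 - iexp (y \<bullet> \<xi>)) = large_exponent \<xi>" for \<xi>
    unfolding large_exponent_def by (subst integral_density) auto
  ultimately show ?thesis
    using compound_poisson_exists_finite[of ?\<rho> t] t by simp
qed

text \<open>For |e| \<le> 1, the second derivative of \<open>small_exponent\<close> along
  \<open>e\<close> is \<open>moment e 2\<close>, and each further derivative raises \<open>k\<close>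
  by one and contributes a factor \<open>\<i>\<close>. From k = 2 on, |y|^2 dominates the integrand
  on the unit ball, uniformly in \<xi>.\<close>

definition moment :: "'a \<Rightarrow> nat \<Rightarrow> 'a \<Rightarrow> complex" where
  "moment e k \<xi> = (LINT y|\<nu>. small y *\<^sub>R (complex_of_real ((y \<bullet> e) ^ k) * iexp (y \<bullet> \<xi>)))"

lemma has_vector_derivative_iexp_line:
  "((\<lambda>s. iexp (y \<bullet> (\<xi> + s *\<^sub>R e))) has_vector_derivative \<i> * complex_of_real (y \<bullet> e) * iexp (y \<bullet> (\<xi> + s *\<^sub>R e))) (at s)"
proof -
  have "((\<lambda>s. iexp (y \<bullet> (\<xi> + s *\<^sub>R e))) has_vector_derivative (y \<bullet> e) *\<^sub>R (\<i> * iexp (y \<bullet> (\<xi> + s *\<^sub>R e)))) (at s)"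
    by (rule vector_diff_chain_at[where g=iexp, unfolded o_def])
       (auto intro!: derivative_eq_intros has_vector_derivative_iexp simp: inner_add_right has_real_derivative_iff_has_vector_derivative[symmetric])
  then show ?thesis by (simp add: scaleR_conv_of_real mult_ac)
qed

lemma abs_inner_power_le:
  assumes "norm (y :: 'a) \<le> 1" "norm e \<le> 1" "2 \<le> k"
  shows "\<bar>y \<bullet> e\<bar> ^ k \<le> (norm y)\<^sup>2"
proof -
  have 1: "\<bar>y \<bullet> e\<bar> \<le> norm y"
    using Cauchy_Schwarz_ineq2[of y e] mult_left_le[OF assms(2), of "norm y"] by simp
  then have "\<bar>y \<bullet> e\<bar> ^ k \<le> \<bar>y \<bullet> e\<bar>\<^sup>2"
    using assms by (intro power_decreasing) auto
  also have "\<dots> \<le> (norm y)\<^sup>2" using 1 by (intro power_mono) auto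
  finally show ?thesis .
qed

lemma integrable_moment:
  assumes "norm e \<le> 1" "2 \<le> k"
  shows "integrable \<nu> (\<lambda>y. small y *\<^sub>R (complex_of_real ((y \<bullet> e) ^ k) * iexp (y \<bullet> \<xi>)))"
    and "cmod (moment e k \<xi>) \<le> 1 * (LINT y|\<nu>. small y * (norm y)\<^sup>2)"
  unfolding moment_def
proof -
  have b: "cmod (complex_of_real ((y \<bullet> e) ^ k) * iexp (y \<bullet> \<xi>)) \<le> 1 * (norm y)\<^sup>2" if "norm y \<le> 1" for y
    using abs_inner_power_le[OF that assms] by (simp add: norm_mult norm_power)
  show "integrable \<nu> (\<lambda>y. small y *\<^sub>R (complex_of_real ((y \<bullet> e) ^ k) * iexp (y \<bullet> \<xi>)))"
    "cmod (LINT y|\<nu>. small y *\<^sub>R (complex_of_real ((y \<bullet> e) ^ k) * iexp (y \<bullet> \<xi>)))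
      \<le> 1 * (LINT y|\<nu>. small y * (norm y)\<^sup>2)"
    by (rule integrable_small_bound[OF _ b]; measurable)+
qed

lemma moment_has_vector_derivative:
  assumes e: "norm e \<le> 1" and k: "2 \<le> k"
  shows "((\<lambda>s. moment e k (\<xi> + s *\<^sub>R e)) has_vector_derivative \<i> * moment e (Suc k) \<xi>) (at 0)"
proof -
  let ?f = "\<lambda>s y. small y *\<^sub>R (complex_of_real ((y \<bullet> e) ^ k) * iexp (y \<bullet> (\<xi> + s *\<^sub>R e)))"
  let ?f' = "\<lambda>s y. small y *\<^sub>R (complex_of_real ((y \<bullet> e) ^ k) * (\<i> * complex_of_real (y \<bullet> e) * iexp (y \<bullet> (\<xi> + s *\<^sub>R e))))"
  have "((\<lambda>s. LINT y|\<nu>. ?f s y) has_vector_derivative (LINT y|\<nu>. ?f' 0 y)) (at 0)"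
  proof (rule has_vector_derivative_integral_dominated(2)[OF _ _ _ integrable_small])
    show "integrable \<nu> (?f s)" for s
      by (rule integrable_moment[OF e k])
    show "((\<lambda>s. ?f s y) has_vector_derivative ?f' s y) (at s)" for s y
      by (intro bounded_linear.has_vector_derivative[OF bounded_linear_scaleR_right] has_vector_derivative_mult_right has_vector_derivative_iexp_line)
    show "cmod (?f' s y) \<le> small y * (norm y)\<^sup>2" for s y
    proof (cases "norm y \<le> 1")
      case True
      have "\<bar>y \<bullet> e\<bar> ^ Suc k \<le> (norm y)\<^sup>2"
        using True e k by (intro abs_inner_power_le) auto
      then show ?thesis using True by (simp add: norm_mult power_abs mult.commute norm_power)
    qed auto
  qed
  moreover have "(LINT y|\<nu>. ?f' 0 y) = \<i> * moment e (Suc k) \<xi>"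
    unfolding moment_def integral_mult_right_zero[symmetric]
    by (intro Bochner_Integration.integral_cong) (auto simp: scaleR_conv_of_real mult_ac)
  ultimately show ?thesis by (simp add: moment_def)
qed

text \<open>The family is closed under differentiation up to the factor \<open>\<i>\<close>, and
  each member is bounded by the truncated second moment of \<nu>.\<close>

lemma slow_moment:
  assumes e: "norm e \<le> 1"
  shows "2 \<le> k \<Longrightarrow> slow e m (moment e k)"
proof (induction m arbitrary: k)
  have pb: "poly_bounded (moment e k)" if "2 \<le> k" for k
    unfolding poly_bounded_def
  proof (intro conjI exI[of _ "LINT y|\<nu>. small y * (norm y)\<^sup>2"] exI[of _ "0::nat"] allI)
    show "moment e k \<in> borel_measurable borel"
      unfolding moment_def[abs_def] by measurable
  qed (use integrable_moment(2)[OF e that] in simp)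
  {
    case 0
    then show ?case by (simp add: pb)
  next
    case (Suc m)
    have "slow e m (\<lambda>\<xi>. \<i> * moment e (Suc k) \<xi>)"
      by (intro slow_mult slow_const Suc.IH) (use Suc.prems in simp)
    then show ?case
      using pb[OF Suc.prems] moment_has_vector_derivative[OF e Suc.prems]
      by (auto intro!: exI[of _ "\<lambda>\<xi>. \<i> * moment e (Suc k) \<xi>"])
  }
qed

definition small_deriv :: "'a \<Rightarrow> 'a \<Rightarrow> 'a \<Rightarrow> complex" where
  "small_deriv l e \<xi> = \<i> * of_real ((l + drift) \<bullet> e) +
    (LINT y|\<nu>. small y *\<^sub>R (\<i> * complex_of_real (y \<bullet> e) * (complex_of_real (1 / (1 + (norm y)\<^sup>2)) - iexp (y \<bullet> \<xi>))))"

text \<open>The inner product of y and e supplies one power of |y|. The bracket vanishes at y = 0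
  and supplies the second, at the price of linear growth in |\<xi>|; this sets the first derivative
  apart from the bounded higher ones.\<close>

lemma norm_small_deriv_integrand:
  fixes y e \<xi> :: 'a
  assumes y: "norm y \<le> 1" and e: "norm e \<le> 1"
  shows "cmod (\<i> * complex_of_real (y \<bullet> e) * (complex_of_real (1 / (1 + (norm y)\<^sup>2)) - iexp (y \<bullet> \<xi>)))
    \<le> (1 + norm \<xi>) * (norm y)\<^sup>2"
proof -
  have ye: "\<bar>y \<bullet> e\<bar> \<le> norm y"
    using Cauchy_Schwarz_ineq2[of y e] mult_left_le[OF e, of "norm y"] by simp
  have "cmod (complex_of_real (1 / (1 + (norm y)\<^sup>2)) - iexp (y \<bullet> \<xi>))
      \<le> cmod (complex_of_real (1 / (1 + (norm y)\<^sup>2) - 1)) + cmod (iexp (y \<bullet> \<xi>) - 1)"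
    using norm_triangle_ineq4[of "complex_of_real (1 / (1 + (norm y)\<^sup>2) - 1)" "iexp (y \<bullet> \<xi>) - 1"] by simp
  also have "\<dots> \<le> (norm y)\<^sup>2 + \<bar>y \<bullet> \<xi>\<bar>"
    using abs_compensator_error[of 1 y] iexp_approx1[of "y \<bullet> \<xi>" 0]
    unfolding norm_of_real by simp
  also have "\<dots> \<le> norm y * 1 + norm y * norm \<xi>"
    using y Cauchy_Schwarz_ineq2[of y \<xi>] mult_left_le[OF y, of "norm y"] by (simp add: power2_eq_square)
  finally have "cmod (complex_of_real (1 / (1 + (norm y)\<^sup>2)) - iexp (y \<bullet> \<xi>)) \<le> norm y * (1 + norm \<xi>)"
    by (simp add: algebra_simps)
  then have "\<bar>y \<bullet> e\<bar> * cmod (complex_of_real (1 / (1 + (norm y)\<^sup>2)) - iexp (y \<bullet> \<xi>)) \<le> norm y * (norm y * (1 + norm \<xi>))"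
    using ye by (intro mult_mono) auto
  then show ?thesis
    by (simp only: norm_mult norm_ii norm_of_real mult_1 power2_eq_square mult_ac)
qed

lemma has_vector_derivative_kern_line:
  "((\<lambda>s. kern (\<xi> + s *\<^sub>R e) y) has_vector_derivative
    \<i> * complex_of_real (y \<bullet> e) * (complex_of_real (1 / (1 + (norm y)\<^sup>2)) - iexp (y \<bullet> (\<xi> + s *\<^sub>R e)))) (at s)"
proof -
  have "1 + (norm y)\<^sup>2 \<noteq> 0" by (metis add_pos_nonneg zero_less_one zero_le_power2 less_irrefl)
  then have "((\<lambda>s. complex_of_real ((y \<bullet> (\<xi> + s *\<^sub>R e)) / (1 + (norm y)\<^sup>2))) has_vector_derivative
      complex_of_real ((y \<bullet> e) / (1 + (norm y)\<^sup>2))) (at s)"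
    by (intro has_vector_derivative_of_real)
       (auto intro!: derivative_eq_intros simp: inner_add_right has_real_derivative_iff_has_vector_derivative[symmetric])
  then have "((\<lambda>s. kern (\<xi> + s *\<^sub>R e) y) has_vector_derivative
    0 - \<i> * complex_of_real (y \<bullet> e) * iexp (y \<bullet> (\<xi> + s *\<^sub>R e)) + \<i> * complex_of_real ((y \<bullet> e) / (1 + (norm y)\<^sup>2))) (at s)"
    unfolding kern_def
    by (intro has_vector_derivative_add has_vector_derivative_diff has_vector_derivative_const
        has_vector_derivative_mult_right has_vector_derivative_iexp_line)
  then show ?thesis by (simp add: algebra_simps)
qed

lemma small_exponent_has_vector_derivative:
  assumes e: "norm e \<le> 1"
  shows "((\<lambda>s. small_exponent l (\<xi> + s *\<^sub>R e)) has_vector_derivative small_deriv l e \<xi>) (at 0)"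
proof -
  let ?d = "\<lambda>s y. \<i> * complex_of_real (y \<bullet> e) * (complex_of_real (1 / (1 + (norm y)\<^sup>2)) - iexp (y \<bullet> (\<xi> + s *\<^sub>R e)))"
  have "((\<lambda>s. LINT y|\<nu>. small y *\<^sub>R kern (\<xi> + s *\<^sub>R e) y) has_vector_derivative (LINT y|\<nu>. small y *\<^sub>R ?d 0 y)) (at 0)"
  \<comment> \<open>The shift s e has norm at most 1, which turns the factor 1 + |\<xi>| into 2 +
    |\<xi>|.\<close>
  proof (rule has_vector_derivative_integral_dominated(2)[where g="\<lambda>y. (2 + norm \<xi>) * (small y * (norm y)\<^sup>2)"])
    show "integrable \<nu> (\<lambda>y. small y *\<^sub>R kern (\<xi> + s *\<^sub>R e) y)" for s
      by (rule integrable_small_bound(1)[OF _ norm_kern_small]) measurable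
    show "((\<lambda>s. small y *\<^sub>R kern (\<xi> + s *\<^sub>R e) y) has_vector_derivative small y *\<^sub>R ?d s y) (at s)" for s y
      by (intro bounded_linear.has_vector_derivative[OF bounded_linear_scaleR_right] has_vector_derivative_kern_line)
    show "integrable \<nu> (\<lambda>y. (2 + norm \<xi>) * (small y * (norm y)\<^sup>2))"
      by (intro integrable_mult_right integrable_small)
    show "cmod (small y *\<^sub>R ?d s y) \<le> (2 + norm \<xi>) * (small y * (norm y)\<^sup>2)" if s: "\<bar>s\<bar> < 1" for s y
    proof (cases "norm y \<le> 1")
      case True
      have "norm (s *\<^sub>R e) \<le> 1" using s e by (simp add: mult_le_one)
      then have "1 + norm (\<xi> + s *\<^sub>R e) \<le> 2 + norm \<xi>"
        using norm_triangle_ineq[of \<xi> "s *\<^sub>R e"] by linarith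
      then have "(1 + norm (\<xi> + s *\<^sub>R e)) * (norm y)\<^sup>2 \<le> (2 + norm \<xi>) * (norm y)\<^sup>2"
        by (intro mult_right_mono) auto
      with norm_small_deriv_integrand[OF True e, of "\<xi> + s *\<^sub>R e"] True show ?thesis
        by (simp add: indicator_def del: of_real_divide of_real_add)
    qed auto
  qed
  moreover have "((\<lambda>s. \<i> * complex_of_real ((l + drift) \<bullet> (\<xi> + s *\<^sub>R e))) has_vector_derivative \<i> * of_real ((l + drift) \<bullet> e)) (at 0)"
    by (intro has_vector_derivative_mult_right has_vector_derivative_of_real)
       (auto intro!: derivative_eq_intros simp: inner_add_right has_real_derivative_iff_has_vector_derivative[symmetric])
  ultimately show ?thesis
    unfolding small_exponent_def small_deriv_def
    using has_vector_derivative_add by fastforce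
qed

lemma small_deriv_has_vector_derivative:
  assumes e: "norm e \<le> 1"
  shows "((\<lambda>s. small_deriv l e (\<xi> + s *\<^sub>R e)) has_vector_derivative moment e 2 \<xi>) (at 0)"
proof -
  let ?f = "\<lambda>s y. \<i> * complex_of_real (y \<bullet> e) * (complex_of_real (1 / (1 + (norm y)\<^sup>2)) - iexp (y \<bullet> (\<xi> + s *\<^sub>R e)))"
  let ?f' = "\<lambda>s y. \<i> * complex_of_real (y \<bullet> e) * (0 - \<i> * complex_of_real (y \<bullet> e) * iexp (y \<bullet> (\<xi> + s *\<^sub>R e)))"
  have "((\<lambda>s. LINT y|\<nu>. small y *\<^sub>R ?f s y) has_vector_derivative (LINT y|\<nu>. small y *\<^sub>R ?f' 0 y)) (at 0)"
  proof (rule has_vector_derivative_integral_dominated(2)[OF _ _ _ integrable_small])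
    show "integrable \<nu> (\<lambda>y. small y *\<^sub>R ?f s y)" for s
      by (rule integrable_small_bound(1)[OF _ norm_small_deriv_integrand[OF _ e]]) measurable
    show "((\<lambda>s. small y *\<^sub>R ?f s y) has_vector_derivative small y *\<^sub>R ?f' s y) (at s)" for s y
      by (intro bounded_linear.has_vector_derivative[OF bounded_linear_scaleR_right] has_vector_derivative_mult_right has_vector_derivative_diff
          has_vector_derivative_const has_vector_derivative_iexp_line)
    show "cmod (small y *\<^sub>R ?f' s y) \<le> small y * (norm y)\<^sup>2" for s y
    proof (cases "norm y \<le> 1")
      case True
      have "\<bar>y \<bullet> e\<bar> ^ 2 \<le> (norm y)\<^sup>2"
        using True e by (intro abs_inner_power_le) auto
      then show ?thesis using True by (simp add: norm_mult power2_eq_square)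
    qed auto
  qed
  moreover have "(LINT y|\<nu>. small y *\<^sub>R ?f' 0 y) = moment e 2 \<xi>"
  proof -
    have "\<i> * a * (0 - \<i> * a * z) = a * a * z" for a z :: complex
    proof -
      have "\<i> * a * (0 - \<i> * a * z) = - (\<i> * \<i>) * (a * a * z)" by algebra
      then show ?thesis by simp
    qed
    then show ?thesis
      unfolding moment_def
      by (intro Bochner_Integration.integral_cong refl) (simp add: power2_eq_square)
  qed
  ultimately show ?thesis
    unfolding small_deriv_def
    using has_vector_derivative_add[OF has_vector_derivative_const] by fastforce
qed

lemma slow_small_deriv:
  assumes e: "norm e \<le> 1"
  shows "slow e m (small_deriv l e)"
proof -
  have "poly_bounded (\<lambda>\<xi>. LINT y|\<nu>. small y *\<^sub>R (\<i> * complex_of_real (y \<bullet> e) * (complex_of_real (1 / (1 + (norm y)\<^sup>2)) - iexp (y \<bullet> \<xi>))))"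
    unfolding poly_bounded_def
  proof (intro conjI exI[of _ "LINT y|\<nu>. small y * (norm y)\<^sup>2"] exI[of _ "1::nat"] allI)
    fix \<xi> :: 'a
    show "cmod (LINT y|\<nu>. small y *\<^sub>R (\<i> * complex_of_real (y \<bullet> e) * (complex_of_real (1 / (1 + (norm y)\<^sup>2)) - iexp (y \<bullet> \<xi>))))
      \<le> (LINT y|\<nu>. small y * (norm y)\<^sup>2) * (1 + norm \<xi>) ^ 1"
      unfolding power_one_right mult.commute[of "integral\<^sup>L \<nu> _"]
      by (rule integrable_small_bound(2)[OF _ norm_small_deriv_integrand[OF _ e]]) measurable
  qed measurable
  then have "poly_bounded (small_deriv l e)"
    unfolding small_deriv_def[abs_def] by (intro poly_bounded_add poly_bounded_const)
  then show ?thesis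
    using small_deriv_has_vector_derivative[OF e] slow_moment[OF e, of 2]
    by (cases m) auto
qed

lemma exp_small_exponent_has_vector_derivative:
  assumes e: "norm e \<le> 1"
  shows "((\<lambda>s. exp (- (complex_of_real t * small_exponent l (\<xi> + s *\<^sub>R e)))) has_vector_derivative
    (- complex_of_real t * small_deriv l e \<xi>) * exp (- (complex_of_real t * small_exponent l \<xi>))) (at 0)"
proof -
  have "((\<lambda>s. - complex_of_real t * small_exponent l (\<xi> + s *\<^sub>R e)) has_vector_derivative - complex_of_real t * small_deriv l e \<xi>) (at 0)"
    by (intro has_vector_derivative_mult_right small_exponent_has_vector_derivative e)
  from field_vector_diff_chain_at[OF this DERIV_exp] show ?thesis
    by (simp add: o_def)
qed

text \<open>The symbol \<open>P\<close> is carried along because each partial derivative of the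
  density multiplies its transform by a coordinate of \<xi>, up to a constant. Of the rapid decay in
  x of the small-jump factor, order 2n is what the convolution with the large-jump law
  consumes.\<close>

theorem fourier_exponent_integrable_vanishing:
  fixes \<psi> :: "'a \<Rightarrow> complex" and P :: "'a \<Rightarrow> complex"
  assumes \<psi>: "\<And>\<xi>. \<psi> \<xi> = \<i> * of_real (l \<bullet> \<xi>) + (LINT y|\<nu>. kern \<xi> y)"
    and t: "0 < t" and rapid: "rapid (\<lambda>\<xi>. exp (- (complex_of_real t * \<psi> \<xi>)))"
    and P: "\<And>e m. e \<in> Basis \<Longrightarrow> slow e m P"
  shows "integrable lborel (fourier (\<lambda>\<xi>. P \<xi> * exp (- (complex_of_real t * \<psi> \<xi>))))"
    and "(fourier (\<lambda>\<xi>. P \<xi> * exp (- (complex_of_real t * \<psi> \<xi>))) \<longlongrightarrow> 0) at_infinity"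
proof -
  let ?E = "\<lambda>\<xi>. exp (- (complex_of_real t * small_exponent l \<xi>))"
  have split: "\<psi> \<xi> = small_exponent l \<xi> + large_exponent \<xi>" for \<xi>
    unfolding \<psi> by (rule integral_kern_split)
  have E: "rapid ?E"
    unfolding rapid_def
  proof (intro conjI allI)
    fix N
    obtain C where C: "\<And>\<xi>. cmod (exp (- (complex_of_real t * \<psi> \<xi>))) * (1 + norm \<xi>) ^ N \<le> C"
      using rapid unfolding rapid_def by meson
    let ?K = "exp (2 * t * (LINT y|\<nu>. large y))"
    have "cmod (?E \<xi>) * (1 + norm \<xi>) ^ N \<le> ?K * C" for \<xi>
    proof -
      have "?E \<xi> = exp (complex_of_real t * large_exponent \<xi>) * exp (- (complex_of_real t * \<psi> \<xi>))"
        unfolding split by (simp add: exp_add[symmetric] algebra_simps)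
      then have "cmod (?E \<xi>) = exp (t * Re (large_exponent \<xi>)) * cmod (exp (- (complex_of_real t * \<psi> \<xi>)))"
        by (simp add: norm_mult)
      also have "\<dots> \<le> ?K * cmod (exp (- (complex_of_real t * \<psi> \<xi>)))"
        using mult_left_mono[OF Re_large_exponent_le[of \<xi>], of t] t by (intro mult_right_mono) (auto simp: mult_ac)
      finally have "cmod (?E \<xi>) * (1 + norm \<xi>) ^ N \<le> ?K * cmod (exp (- (complex_of_real t * \<psi> \<xi>))) * (1 + norm \<xi>) ^ N"
        by (intro mult_right_mono) auto
      also have "\<dots> \<le> ?K * C"
        unfolding mult.assoc using C by (intro mult_left_mono) auto
      finally show ?thesis .
    qed
    then show "\<exists>C. \<forall>\<xi>. cmod (?E \<xi>) * (1 + norm \<xi>) ^ N \<le> C" by blast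
  qed measurable
  obtain N where N: "prob_space N" "sets N = sets borel"
    "\<And>\<xi>. (LINT y|N. iexp (y \<bullet> \<xi>)) = exp (- (complex_of_real t * large_exponent \<xi>))"
    using large_part_law[OF t] by blast
  obtain e0 :: 'a where e0: "e0 \<in> Basis" using nonempty_Basis by blast
  have pb: "poly_bounded P" by (rule slow_poly_bounded[OF P[OF e0, of 0]])
  note r = rapid_mult[OF pb E]
  have "\<exists>C. \<forall>x. cmod (fourier (\<lambda>\<xi>. P \<xi> * ?E \<xi>) x) * (1 + norm x) ^ (2 * DIM('a)) \<le> C"
  proof (rule fourier_rapid_decay[OF E _ _ P])
    fix e :: 'a assume "e \<in> Basis"
    then have e: "norm e \<le> 1" by simp
    show "((\<lambda>s. ?E (\<xi> + s *\<^sub>R e)) has_vector_derivative (- complex_of_real t * small_deriv l e \<xi>) * ?E \<xi>) (at 0)" for \<xi>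
      by (rule exp_small_exponent_has_vector_derivative[OF e])
    show "slow e m (\<lambda>\<xi>. - complex_of_real t * small_deriv l e \<xi>)" for m
      by (intro slow_mult slow_const slow_small_deriv e)
  qed
  then obtain C where C: "\<And>x. cmod (fourier (\<lambda>\<xi>. P \<xi> * ?E \<xi>) x) * (1 + norm x) ^ (2 * DIM('a)) \<le> C"
    by blast
  have "fourier (\<lambda>\<xi>. P \<xi> * exp (- (complex_of_real t * \<psi> \<xi>)))
      = (\<lambda>x. LINT y|N. fourier (\<lambda>\<xi>. P \<xi> * ?E \<xi>) (x - y))"
  proof
    fix x
    have "fourier (\<lambda>\<xi>. P \<xi> * exp (- (complex_of_real t * \<psi> \<xi>))) x
      = fourier (\<lambda>\<xi>. (P \<xi> * ?E \<xi>) * (LINT y|N. iexp (y \<bullet> \<xi>))) x"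
      unfolding N(3) split by (simp add: exp_add[symmetric] algebra_simps)
    also have "\<dots> = (LINT y|N. fourier (\<lambda>\<xi>. P \<xi> * ?E \<xi>) (x - y))"
      by (rule fourier_mult_char[OF N(1,2) rapid_integrable[OF r]])
    finally show "fourier (\<lambda>\<xi>. P \<xi> * exp (- (complex_of_real t * \<psi> \<xi>))) x = \<dots>" .
  qed
  then show "integrable lborel (fourier (\<lambda>\<xi>. P \<xi> * exp (- (complex_of_real t * \<psi> \<xi>))))"
    and "(fourier (\<lambda>\<xi>. P \<xi> * exp (- (complex_of_real t * \<psi> \<xi>))) \<longlongrightarrow> 0) at_infinity"
    using integrable_convolution[OF N(1,2) measurable_fourier[OF r] C]
      tendsto_convolution[OF N(1,2) measurable_fourier[OF r] C] by simp_all
qed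

end

subsection \<open>Smooth functions and distributional gradients\<close>

lemma partial_deriv_eq:
  assumes "(f has_derivative D) (at x)"
  shows "partial_deriv i f x = D (axis i 1)"
proof -
  have "((\<lambda>h. x + h *\<^sub>R axis i (1::real)) has_derivative (\<lambda>h. h *\<^sub>R axis i 1)) (at 0)"
    by (auto intro!: derivative_eq_intros)
  then have "((\<lambda>h. f (x + h *\<^sub>R axis i 1)) has_derivative (\<lambda>h. D (h *\<^sub>R axis i 1))) (at 0)"
    using assms by (auto intro: has_derivative_compose[of _ _ 0 UNIV f D, simplified])
  moreover have "D (h *\<^sub>R axis i 1) = D (axis i 1) * h" for h
    using linear_scale[OF has_derivative_linear[OF assms]] by simp
  ultimately have "((\<lambda>h. f (x + h *\<^sub>R axis i 1)) has_field_derivative D (axis i 1)) (at 0)"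
    by (simp add: has_field_derivative_def)
  then show ?thesis
    unfolding partial_deriv_def by (rule DERIV_imp_deriv)
qed

lemma partial_deriv_has_vector_derivative:
  assumes "f differentiable (at x)"
  shows "((\<lambda>s. f (x + s *\<^sub>R axis i 1)) has_vector_derivative partial_deriv i f x) (at 0)"
proof -
  obtain D where D: "(f has_derivative D) (at x)"
    using assms by (auto simp: differentiable_def)
  have "((\<lambda>h. x + h *\<^sub>R axis i (1::real)) has_derivative (\<lambda>h. h *\<^sub>R axis i 1)) (at 0)"
    by (auto intro!: derivative_eq_intros)
  then have "((\<lambda>h. f (x + h *\<^sub>R axis i 1)) has_derivative (\<lambda>h. D (h *\<^sub>R axis i 1))) (at 0)"
    using D by (auto intro: has_derivative_compose[of _ _ 0 UNIV f D, simplified])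
  then show ?thesis
    using linear_scale[OF has_derivative_linear[OF D]]
    by (simp add: has_vector_derivative_def partial_deriv_eq[OF D])
qed

section \<open>Calculus of \<open>C_k\<close> functions\<close>

lemma C_k_continuous: "C_k k f \<Longrightarrow> continuous_on UNIV f"
  by (cases k) (auto simp: continuous_on_eq_continuous_at differentiable_imp_continuous_within)

lemma C_k_SucD: "C_k (Suc k) f \<Longrightarrow> C_k k f"
proof (induction k arbitrary: f)
  case 0
  then show ?case using C_k_continuous[OF 0] by simp
qed auto

lemma C_k_differentiable: "C_k (Suc k) f \<Longrightarrow> f differentiable (at x)"
  by simp

lemma C_k_partial_deriv: "C_k (Suc k) f \<Longrightarrow> C_k k (partial_deriv i f)"
  by simp

lemma partial_deriv_const [simp]: "partial_deriv i (\<lambda>_. c) = (\<lambda>_. 0)"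
  by (rule ext) (simp add: partial_deriv_def)

lemma C_k_const [simp]: "C_k k (\<lambda>_. c)"
  by (induction k arbitrary: c) auto

lemma C_k_add:
  "C_k k f \<Longrightarrow> C_k k g \<Longrightarrow> C_k k (\<lambda>x. f x + g x)"
proof (induction k arbitrary: f g)
  case (Suc k)
  have "partial_deriv i (\<lambda>x. f x + g x) = (\<lambda>x. partial_deriv i f x + partial_deriv i g x)" for i
  proof
    fix x
    obtain D E where "(f has_derivative D) (at x)" "(g has_derivative E) (at x)"
      using Suc.prems by (auto simp: differentiable_def) metis
    then show "partial_deriv i (\<lambda>x. f x + g x) x = partial_deriv i f x + partial_deriv i g x"
      using partial_deriv_eq[OF has_derivative_add] by (simp add: partial_deriv_eq)
  qed
  then show ?case using Suc by auto
qed (auto intro: continuous_on_add)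

lemma partial_deriv_mult:
  assumes "f differentiable (at x)" "g differentiable (at x)"
  shows "partial_deriv i (\<lambda>x. f x * g x) x = f x * partial_deriv i g x + partial_deriv i f x * g x"
proof -
  obtain D E where "(f has_derivative D) (at x)" "(g has_derivative E) (at x)"
    using assms by (auto simp: differentiable_def)
  then show ?thesis
    using partial_deriv_eq[OF has_derivative_mult] by (simp add: partial_deriv_eq)
qed

lemma C_k_mult:
  "C_k k f \<Longrightarrow> C_k k g \<Longrightarrow> C_k k (\<lambda>x. f x * g x)"
proof (induction k arbitrary: f g)
  case (Suc k)
  have "partial_deriv i (\<lambda>x. f x * g x) = (\<lambda>x. f x * partial_deriv i g x + partial_deriv i f x * g x)" for i
    using Suc.prems by (intro ext partial_deriv_mult C_k_differentiable)
  moreover have "C_k k (\<lambda>x. f x * partial_deriv i g x + partial_deriv i f x * g x)" for i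
    using Suc.prems
    by (intro C_k_add Suc.IH C_k_SucD[OF Suc.prems(1)] C_k_SucD[OF Suc.prems(2)] C_k_partial_deriv) auto
  ultimately show ?case using Suc.prems by auto
qed (auto intro: continuous_on_mult)

lemma C_k_inner: "C_k k (\<lambda>x :: real ^ 'n. x \<bullet> v)"
proof (cases k)
  case (Suc m)
  have D: "((\<lambda>x. x \<bullet> v) has_derivative (\<lambda>h. h \<bullet> v)) (at x)" for x :: "real ^ 'n"
    by (auto intro!: derivative_eq_intros)
  have "partial_deriv i (\<lambda>x. x \<bullet> v) = (\<lambda>_. axis i 1 \<bullet> v)" for i
    using partial_deriv_eq[OF D] by auto
  then show ?thesis using D Suc by (auto simp: differentiable_def)
qed (auto intro: continuous_intros)

lemma C_k_sum: "finite A \<Longrightarrow> (\<And>a. a \<in> A \<Longrightarrow> C_k k (f a)) \<Longrightarrow> C_k k (\<lambda>x. \<Sum>a\<in>A. f a x)"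
  by (induction A rule: finite_induct) (auto intro: C_k_add)

lemma C_k_norm_square: "C_k k (\<lambda>x :: real ^ 'n. (norm x)\<^sup>2)"
proof -
  have "(\<lambda>x::real^'n. (norm x)\<^sup>2) = (\<lambda>x. \<Sum>b\<in>Basis. (x \<bullet> b) * (x \<bullet> b))"
    unfolding power2_norm_eq_inner by (rule ext) (rule euclidean_inner)
  then show ?thesis by (simp add: C_k_sum C_k_mult C_k_inner)
qed

lemma partial_deriv_compose:
  assumes "u differentiable (at x)" "(g has_real_derivative d) (at (u x))"
  shows "(\<lambda>x. g (u x)) differentiable (at x)" "partial_deriv i (\<lambda>x. g (u x)) x = d * partial_deriv i u x"
proof -
  obtain D where D: "(u has_derivative D) (at x)"
    using assms(1) by (auto simp: differentiable_def)
  have "((\<lambda>x. g (u x)) has_derivative (\<lambda>h. d * D h)) (at x)"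
    using has_derivative_compose[OF D assms(2)[unfolded has_field_derivative_def]] .
  then show "(\<lambda>x. g (u x)) differentiable (at x)" "partial_deriv i (\<lambda>x. g (u x)) x = d * partial_deriv i u x"
    using partial_deriv_eq[OF D] by (auto simp: differentiable_def partial_deriv_eq)
qed

text \<open>\<open>G\<close> lists the successive derivatives of a function of one variable. The
  induction treats all members at once, because differentiating \<open>G j (u x)\<close> brings in
  \<open>G (Suc j)\<close>.\<close>

lemma C_k_compose:
  assumes G: "\<And>j r. (G j has_real_derivative G (Suc j) r) (at r)" and u: "\<And>m. C_k m u"
  shows "C_k k (\<lambda>x. G j (u x))"
proof (induction k arbitrary: j)
  case 0
  have "continuous_on UNIV (G j)"
    by (intro continuous_at_imp_continuous_on ballI DERIV_isCont[OF G])
  from continuous_on_compose2[OF this C_k_continuous[OF u]] show ?case by simp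
next
  case (Suc k)
  have "partial_deriv i (\<lambda>x. G j (u x)) = (\<lambda>x. G (Suc j) (u x) * partial_deriv i u x)" for i
    by (rule ext, rule partial_deriv_compose(2)[OF C_k_differentiable[OF u] G])
  then show ?case
    using C_k_mult[OF Suc.IH C_k_partial_deriv[OF u]] partial_deriv_compose(1)[OF C_k_differentiable[OF u] G]
    by simp
qed

text \<open>The flat function exp (-1/s), extended by 0, with a polynomial in 1/s as coefficient.
  Such functions are closed under differentiation, so one derivative lemma settles all
  orders.\<close>

definition flat_exp :: "real poly \<Rightarrow> real \<Rightarrow> real" where
  "flat_exp p s = (if 0 < s then poly p (inverse s) * exp (- inverse s) else 0)"

text \<open>Differentiating p(1/s) exp (-1/s) gives s^(-2) (p(1/s) - p'(1/s)) exp (-1/s), whose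
  coefficient is the polynomial X^2 (p - p') evaluated at 1/s.\<close>

definition flat_step :: "real poly \<Rightarrow> real poly" where
  "flat_step p = monom 1 2 * (p - pderiv p)"

lemma poly_exp_decay: "((\<lambda>u::real. poly p u * exp (- u)) \<longlongrightarrow> 0) at_top"
proof -
  have "((\<lambda>u::real. \<Sum>i\<le>degree p. coeff p i * (u ^ i / exp u)) \<longlongrightarrow> (\<Sum>i\<le>degree p. coeff p i * 0)) at_top"
    by (intro tendsto_sum tendsto_mult tendsto_const tendsto_power_div_exp_0)
  then show ?thesis
    by (simp add: poly_altdef exp_minus divide_inverse sum_distrib_right mult.assoc)
qed

lemma tendsto_flat_exp_0: "(flat_exp p \<longlongrightarrow> 0) (at 0)"
proof (rule filterlim_split_at)
  show "(flat_exp p \<longlongrightarrow> 0) (at_left 0)"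
    by (rule tendsto_eventually) (auto simp: flat_exp_def eventually_at_filter)
  have "((\<lambda>s. poly p (inverse s) * exp (- inverse s)) \<longlongrightarrow> 0) (at_right 0)"
    by (rule filterlim_compose[OF poly_exp_decay filterlim_inverse_at_top_right])
  then show "(flat_exp p \<longlongrightarrow> 0) (at_right 0)"
    by (rule Lim_transform_eventually) (auto simp: flat_exp_def eventually_at_filter)
qed

lemma flat_exp_has_derivative: "(flat_exp p has_real_derivative flat_exp (flat_step p) s) (at s)"
proof (cases s "0 :: real" rule: linorder_cases)
  case less
  have "((\<lambda>_. 0) has_real_derivative 0) (at s)" by simp
  then have "(flat_exp p has_real_derivative 0) (at s)"
    by (rule has_field_derivative_transform_within_open[where S="{..<0}"]) (use less in \<open>auto simp: flat_exp_def\<close>)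
  then show ?thesis using less by (simp add: flat_exp_def)
next
  case equal
  \<comment> \<open>Dividing by h multiplies the coefficient polynomial by X, so the difference
    quotient at 0 is again a member of the family.\<close>
  have "(flat_exp (pCons 0 p) \<longlongrightarrow> 0) (at 0)" by (rule tendsto_flat_exp_0)
  then have "((\<lambda>h. (flat_exp p (0 + h) - flat_exp p 0) / h) \<longlongrightarrow> 0) (at 0)"
    by (rule Lim_transform_eventually) (auto simp: flat_exp_def eventually_at_filter divide_inverse)
  then show ?thesis using equal by (simp add: DERIV_def flat_exp_def)
next
  case greater
  have "((\<lambda>s. poly p (inverse s) * exp (- inverse s)) has_real_derivative flat_exp (flat_step p) s) (at s)"
    using greater
    by (auto intro!: derivative_eq_intros DERIV_chain'[OF _ poly_DERIV]
        simp: flat_exp_def flat_step_def poly_monom field_simps power2_eq_square)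
  then show ?thesis
    by (rule has_field_derivative_transform_within_open[where S="{0<..}"]) (use greater in \<open>auto simp: flat_exp_def\<close>)
qed

text \<open>The cutoff has no plateau: its value at the centre, and its pointwise limit as R grows,
  is exp (-1) rather than 1. This constant appears on both sides of the limiting identities and
  cancels.\<close>

definition bump :: "real \<Rightarrow> real ^ 'n \<Rightarrow> real" where
  "bump R x = flat_exp 1 (1 - (norm x)\<^sup>2 / R\<^sup>2)"

lemma bump_smooth: "C_k k (bump R)"
proof -
  have u: "C_k m (\<lambda>x. 1 + (- 1 / R\<^sup>2) * (norm x)\<^sup>2)" for m
    by (intro C_k_add C_k_mult C_k_const C_k_norm_square)
  have "C_k k (\<lambda>x. flat_exp ((flat_step ^^ 0) 1) (1 + (- 1 / R\<^sup>2) * (norm x)\<^sup>2))"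
    by (rule C_k_compose[where G="\<lambda>j. flat_exp ((flat_step ^^ j) 1)", OF _ u]) (simp add: flat_exp_has_derivative)
  then show ?thesis by (simp add: bump_def[abs_def])
qed

lemma bump_bounds: "0 \<le> bump R x" "bump R x \<le> 1"
  by (auto simp: bump_def flat_exp_def)

lemma bump_support: "0 < R \<Longrightarrow> R \<le> norm x \<Longrightarrow> bump R x = 0"
  by (auto simp: bump_def flat_exp_def divide_simps not_less power_mono)

lemma tendsto_bump: "(\<lambda>k. bump (real (Suc k)) x) \<longlonglongrightarrow> exp (- 1)"
proof -
  have "isCont (flat_exp 1) 1"
    using flat_exp_has_derivative DERIV_isCont by blast
  moreover have "(\<lambda>k. 1 - (norm x)\<^sup>2 / (real (Suc k))\<^sup>2) \<longlonglongrightarrow> 1 - 0"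
  proof (intro tendsto_diff tendsto_const)
    have "(\<lambda>k. (norm x)\<^sup>2 * (1 / real (Suc k))\<^sup>2) \<longlonglongrightarrow> (norm x)\<^sup>2 * 0\<^sup>2"
      by (intro tendsto_intros LIMSEQ_Suc[OF lim_1_over_n])
    then show "(\<lambda>k. (norm x)\<^sup>2 / (real (Suc k))\<^sup>2) \<longlonglongrightarrow> 0"
      by (simp add: power_divide)
  qed
  ultimately have "(\<lambda>k. flat_exp 1 (1 - (norm x)\<^sup>2 / (real (Suc k))\<^sup>2)) \<longlonglongrightarrow> flat_exp 1 1"
    using isCont_tendsto_compose by fastforce
  then show ?thesis by (simp add: bump_def flat_exp_def)
qed

text \<open>By the chain rule and |x $ i| \<le> R on the supporting ball, the derivative is at most
  2 R / R^2 times a bound for the derivative of the flat function on [0, 1]. The decay in R makes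
  the cutoff error disappear.\<close>

lemma partial_deriv_bump_bound: "\<exists>K\<ge>0. \<forall>R>0. \<forall>i. \<forall>x::real^'n. \<bar>partial_deriv i (bump R) x\<bar> \<le> K / R"
proof -
  let ?g = "flat_exp (flat_step 1)"
  have "continuous_on {0..1} ?g"
    by (intro continuous_at_imp_continuous_on ballI DERIV_isCont[OF flat_exp_has_derivative])
  then have "bounded (?g ` {0..1})"
    by (intro compact_imp_bounded compact_continuous_image) auto
  then obtain K0 where K0: "\<forall>s\<in>{0..1}. \<bar>?g s\<bar> \<le> K0"
    unfolding bounded_iff by auto
  define K where "K = max K0 0"
  have K: "\<bar>?g s\<bar> \<le> K" if "s \<le> 1" for s
    using bspec[OF K0, of s] that by (cases "0 \<le> s") (auto simp: K_def flat_exp_def)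
  have "\<bar>partial_deriv i (bump R) x\<bar> \<le> (2 * K) / R" if R: "0 < R" for R i and x :: "real^'n"
  proof -
    let ?u = "\<lambda>x::real^'n. 1 - (norm x)\<^sup>2 / R\<^sup>2"
    have u: "(?u has_derivative (\<lambda>h. - (2 * (x \<bullet> h)) / R\<^sup>2)) (at x)"
    proof -
      have "((\<lambda>x. x \<bullet> x) has_derivative (\<lambda>h. x \<bullet> h + h \<bullet> x)) (at x)"
        by (intro has_derivative_inner has_derivative_ident)
      from has_derivative_diff[OF has_derivative_const bounded_linear.has_derivative[OF bounded_linear_divide this]]
      show ?thesis by (simp add: power2_norm_eq_inner inner_commute)
    qed
    have pd: "partial_deriv i (bump R) x = ?g (?u x) * (- (2 * (x $ i)) / R\<^sup>2)"
    proof -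
      have "partial_deriv i (\<lambda>x. flat_exp 1 (?u x)) x = ?g (?u x) * partial_deriv i ?u x"
        by (rule partial_deriv_compose(2)[OF differentiableI[OF u] flat_exp_has_derivative])
      then show ?thesis
        by (simp add: bump_def[abs_def] partial_deriv_eq[OF u] inner_axis)
    qed
    show ?thesis
    proof (cases "norm x \<le> R")
      case True
      have "\<bar>x $ i\<bar> \<le> R" using component_le_norm_cart[of x i] True by simp
      then have "2 * \<bar>x $ i\<bar> / R\<^sup>2 \<le> 2 * R / R\<^sup>2" by (intro divide_right_mono) auto
      also have "\<dots> = 2 / R" using R by (simp add: power2_eq_square)
      finally have "\<bar>?g (?u x)\<bar> * (2 * \<bar>x $ i\<bar> / R\<^sup>2) \<le> K * (2 / R)"
        by (intro mult_mono K) (auto simp: K_def)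
      then show ?thesis by (simp add: pd abs_mult mult_ac)
    next
      case False
      then have "R\<^sup>2 \<le> (norm x)\<^sup>2" using R by (intro power_mono) auto
      then have "?u x \<le> 0" using R by (simp add: divide_simps)
      then have "?g (?u x) = 0" by (simp add: flat_exp_def)
      then show ?thesis using R by (simp add: pd K_def)
    qed
  qed
  moreover have "0 \<le> 2 * K" by (simp add: K_def)
  ultimately show ?thesis by blast
qed

lemma test_function_mult_bump:
  assumes f: "C_infinity f" and R: "0 < R"
  shows "test_function (\<lambda>x. f x * bump R x)"
  unfolding test_function_def
proof
  show "C_infinity (\<lambda>x. f x * bump R x)"
    using f by (auto simp: C_infinity_def intro!: C_k_mult bump_smooth)
  have "{x. f x * bump R x \<noteq> 0} \<subseteq> cball 0 R"
  proof
    fix x assume "x \<in> {x. f x * bump R x \<noteq> 0}"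
    then have "\<not> R \<le> norm x" using bump_support[OF R, of x] by auto
    then show "x \<in> cball 0 R" by simp
  qed
  then have "closure {x. f x * bump R x \<noteq> 0} \<subseteq> cball 0 R"
    by (rule closure_minimal) simp
  then show "compact (closure {x. f x * bump R x \<noteq> 0})"
    using bounded_subset[OF bounded_cball] by (simp add: compact_eq_bounded_closed)
qed

lemma C_infinity_continuous: "C_infinity f \<Longrightarrow> continuous_on UNIV f"
  unfolding C_infinity_def using C_k_continuous by blast

lemma C_infinity_differentiable: "C_infinity f \<Longrightarrow> f differentiable (at x)"
  unfolding C_infinity_def using C_k_differentiable by blast

lemma C_infinity_partial_deriv: "C_infinity f \<Longrightarrow> C_infinity (partial_deriv i f)"
  unfolding C_infinity_def using C_k_partial_deriv by blast

lemma C_infinity_measurable: "C_infinity f \<Longrightarrow> f \<in> borel_measurable borel"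
  by (intro borel_measurable_continuous_onI C_infinity_continuous)

text \<open>Multiplied by a bump, \<open>f\<close> becomes a test function. As the radius grows, the
  term with the derivative of the bump dies out like K / R, and both sides converge to exp (-1)
  times the claimed ones.\<close>

lemma distributional_gradient_bounded:
  fixes p :: "real ^ 'n \<Rightarrow> real"
  assumes grad: "distributional_gradient p G" and p: "integrable lborel p" and G: "integrable lborel G"
    and f: "C_infinity f" and f_bound: "\<And>x. \<bar>f x\<bar> \<le> 1" and f'_bound: "\<And>x. \<bar>partial_deriv i f x\<bar> \<le> B"
  shows "(LINT x|lborel. p x * partial_deriv i f x) = - (LINT x|lborel. G x $ i * f x)"
proof -
  have Gi: "integrable lborel (\<lambda>x. G x $ i)"
    using integrable_inner_left[OF G, of "axis i 1"] by (simp add: inner_axis)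
  have [measurable]: "p \<in> borel_measurable borel" "(\<lambda>x. G x $ i) \<in> borel_measurable borel"
    "f \<in> borel_measurable borel" "partial_deriv i f \<in> borel_measurable borel"
    using borel_measurable_integrable[OF p] borel_measurable_integrable[OF Gi] f
    by (simp_all add: C_infinity_measurable C_infinity_partial_deriv)
  have bump_smooth': "C_infinity (bump R :: real ^ 'n \<Rightarrow> real)" for R :: real
    by (simp add: C_infinity_def bump_smooth)
  have [measurable]: "(bump R :: real ^ 'n \<Rightarrow> real) \<in> borel_measurable borel" "partial_deriv i (bump R) \<in> borel_measurable borel" for R
    using bump_smooth' by (simp_all add: C_infinity_measurable C_infinity_partial_deriv)
  obtain K where K: "0 \<le> K" "\<And>R x. 0 < R \<Longrightarrow> \<bar>partial_deriv i (bump R) (x::real^'n)\<bar> \<le> K / R"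
    using partial_deriv_bump_bound by blast
  let ?R = "\<lambda>k. real (Suc k)"
  have pd: "partial_deriv i (\<lambda>x. f x * bump (?R k) x) x = f x * partial_deriv i (bump (?R k)) x + partial_deriv i f x * bump (?R k) x" for k x
    by (intro partial_deriv_mult C_infinity_differentiable f bump_smooth')
  have eq: "(LINT x|lborel. p x * (f x * partial_deriv i (bump (?R k)) x + partial_deriv i f x * bump (?R k) x))
      = - (LINT x|lborel. G x $ i * (f x * bump (?R k) x))" for k
    using grad test_function_mult_bump[OF f, of "?R k"]
    unfolding distributional_gradient_def pd[symmetric] by auto
  have "(\<lambda>k. LINT x|lborel. p x * (f x * partial_deriv i (bump (?R k)) x + partial_deriv i f x * bump (?R k) x))
      \<longlonglongrightarrow> (LINT x|lborel. p x * (f x * 0 + partial_deriv i f x * exp (- 1)))"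
  proof (rule integral_dominated_convergence)
    show "integrable lborel (\<lambda>x. \<bar>p x\<bar> * (K + B))" using p by simp
    have "(\<lambda>k. partial_deriv i (bump (?R k)) x) \<longlonglongrightarrow> 0" for x
    proof (rule Lim_null_comparison)
      show "\<forall>\<^sub>F k in sequentially. norm (partial_deriv i (bump (?R k)) x) \<le> K * (1 / ?R k)"
        using K(2)[of "?R _" x] by (auto intro!: always_eventually)
      show "(\<lambda>k. K * (1 / ?R k)) \<longlonglongrightarrow> 0"
        using tendsto_mult_right_zero[OF LIMSEQ_Suc[OF lim_1_over_n]] .
    qed
    then show "AE x in lborel. (\<lambda>k. p x * (f x * partial_deriv i (bump (?R k)) x + partial_deriv i f x * bump (?R k) x))
        \<longlonglongrightarrow> p x * (f x * 0 + partial_deriv i f x * exp (- 1))"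
      by (intro AE_I2 tendsto_intros tendsto_bump)
    show "AE x in lborel. norm (p x * (f x * partial_deriv i (bump (?R k)) x + partial_deriv i f x * bump (?R k) x)) \<le> \<bar>p x\<bar> * (K + B)" for k
    proof (rule AE_I2)
      fix x
      have "\<bar>partial_deriv i (bump (?R k)) x\<bar> \<le> K"
      proof -
        have "\<bar>partial_deriv i (bump (?R k)) x\<bar> \<le> K / ?R k" by (rule K(2)) simp
        also have "\<dots> \<le> K / 1" using K(1) by (intro divide_left_mono) auto
        finally show ?thesis by simp
      qed
      then have "\<bar>f x\<bar> * \<bar>partial_deriv i (bump (?R k)) x\<bar> \<le> 1 * K"
        using f_bound by (intro mult_mono) auto
      moreover have "\<bar>partial_deriv i f x\<bar> * bump (?R k) x \<le> B * 1"
        using f'_bound[of x] bump_bounds by (intro mult_mono) auto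
      ultimately have "\<bar>f x * partial_deriv i (bump (?R k)) x + partial_deriv i f x * bump (?R k) x\<bar> \<le> K + B"
        using bump_bounds(1)[of "?R k" x]
        by (intro order_trans[OF abs_triangle_ineq]) (simp add: abs_mult)
      then show "norm (p x * (f x * partial_deriv i (bump (?R k)) x + partial_deriv i f x * bump (?R k) x)) \<le> \<bar>p x\<bar> * (K + B)"
        unfolding real_norm_def abs_mult[of "p x"] by (intro mult_left_mono) auto
    qed
  qed measurable
  moreover have "(\<lambda>k. - (LINT x|lborel. G x $ i * (f x * bump (?R k) x)))
      \<longlonglongrightarrow> - (LINT x|lborel. G x $ i * (f x * exp (- 1)))"
  proof (intro tendsto_minus integral_dominated_convergence)
    show "integrable lborel (\<lambda>x. \<bar>G x $ i\<bar>)" using Gi by simp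
    show "AE x in lborel. (\<lambda>k. G x $ i * (f x * bump (?R k) x)) \<longlonglongrightarrow> G x $ i * (f x * exp (- 1))"
      by (intro AE_I2 tendsto_intros tendsto_bump)
    show "AE x in lborel. norm (G x $ i * (f x * bump (?R k) x)) \<le> \<bar>G x $ i\<bar>" for k
    proof (rule AE_I2)
      fix x
      have "\<bar>f x\<bar> * bump (?R k) x \<le> 1 * 1"
        using f_bound bump_bounds by (intro mult_mono) auto
      then show "norm (G x $ i * (f x * bump (?R k) x)) \<le> \<bar>G x $ i\<bar>"
        using bump_bounds(1)[of "?R k" x] by (simp add: abs_mult mult_left_le)
    qed
  qed measurable
  ultimately have "(LINT x|lborel. p x * (f x * 0 + partial_deriv i f x * exp (- 1)))
      = - (LINT x|lborel. G x $ i * (f x * exp (- 1)))"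
    unfolding eq by (rule LIMSEQ_unique)
  then have "exp (- 1) * (LINT x|lborel. p x * partial_deriv i f x) = exp (- 1) * (- (LINT x|lborel. G x $ i * f x))"
    by (simp add: mult.assoc[symmetric] mult.commute[of "exp (- 1)"])
  then show ?thesis unfolding mult_cancel_left by simp
qed

text \<open>Consecutive derivatives of the cosine differ by a quarter period, which also covers the sine.\<close>

lemma C_infinity_cos_inner: "C_infinity (\<lambda>x. cos (x \<bullet> \<xi> + c))"
  and partial_deriv_cos_inner: "partial_deriv i (\<lambda>x. cos (x \<bullet> \<xi> + c)) x = - (\<xi> $ i) * sin (x \<bullet> \<xi> + c)"
proof -
  have u: "C_k m (\<lambda>x. x \<bullet> \<xi> + c)" for m
    by (intro C_k_add C_k_inner C_k_const)
  have G: "((\<lambda>r. cos (r + real j * (pi / 2))) has_real_derivative cos (r + real (Suc j) * (pi / 2))) (at r)" for j r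
    by (auto intro!: derivative_eq_intros simp: sin_cos_eq[of "r + real j * (pi / 2)"] algebra_simps cos_add sin_add add_divide_distrib)
  show "C_infinity (\<lambda>x. cos (x \<bullet> \<xi> + c))"
    unfolding C_infinity_def
    using C_k_compose[where G="\<lambda>j r. cos (r + real j * (pi / 2))" and j=0, OF G u] by simp
  have "((\<lambda>x. cos (x \<bullet> \<xi> + c)) has_derivative (\<lambda>h. - sin (x \<bullet> \<xi> + c) * (h \<bullet> \<xi>))) (at x)"
    by (auto intro!: derivative_eq_intros)
  then show "partial_deriv i (\<lambda>x. cos (x \<bullet> \<xi> + c)) x = - (\<xi> $ i) * sin (x \<bullet> \<xi> + c)"
    by (simp add: partial_deriv_eq inner_axis' )
qed

text \<open>Test functions are real, so the phases c = 0 and c = pi / 2 treat the sine and cosine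
  integrals separately. This accounts for the factor 2; \<open>CARD('n)\<close> comes from
  estimating |\<xi>| by the sum of its absolute coordinates.\<close>

lemma fourier_decay_of_gradient:
  fixes p :: "real ^ 'n \<Rightarrow> real"
  assumes grad: "distributional_gradient p G" and p: "integrable lborel p" and G: "integrable lborel G"
  shows "norm \<xi> * cmod (LINT x|lborel. p x *\<^sub>R iexp (x \<bullet> \<xi>)) \<le> 2 * real CARD('n) * (LINT x|lborel. norm (G x))"
proof -
  let ?I = "LINT x|lborel. norm (G x)"
  have [measurable]: "p \<in> borel_measurable borel"
    using borel_measurable_integrable[OF p] by simp
  have main: "\<bar>\<xi> $ i\<bar> * \<bar>LINT x|lborel. p x * sin (x \<bullet> \<xi> + c)\<bar> \<le> ?I" for i c
  proof -
    have Gi: "integrable lborel (\<lambda>x. G x $ i)"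
      using integrable_inner_left[OF G, of "axis i 1"] by (simp add: inner_axis)
    have [measurable]: "(\<lambda>x. G x $ i) \<in> borel_measurable borel"
      using borel_measurable_integrable[OF Gi] by simp
    have "(LINT x|lborel. p x * partial_deriv i (\<lambda>x. cos (x \<bullet> \<xi> + c)) x) = - (LINT x|lborel. G x $ i * cos (x \<bullet> \<xi> + c))"
      by (rule distributional_gradient_bounded[OF grad p G C_infinity_cos_inner, where B="\<bar>\<xi> $ i\<bar>"])
         (auto simp: partial_deriv_cos_inner abs_mult mult_left_le)
    then have "(LINT x|lborel. - (\<xi> $ i) * (p x * sin (x \<bullet> \<xi> + c))) = - (LINT x|lborel. G x $ i * cos (x \<bullet> \<xi> + c))"
      by (simp add: partial_deriv_cos_inner mult_ac)
    then have "\<bar>\<xi> $ i\<bar> * \<bar>LINT x|lborel. p x * sin (x \<bullet> \<xi> + c)\<bar> = \<bar>LINT x|lborel. G x $ i * cos (x \<bullet> \<xi> + c)\<bar>"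
    proof -
      assume "(LINT x|lborel. - (\<xi> $ i) * (p x * sin (x \<bullet> \<xi> + c))) = - (LINT x|lborel. G x $ i * cos (x \<bullet> \<xi> + c))"
      then have "(LINT x|lborel. G x $ i * cos (x \<bullet> \<xi> + c)) = \<xi> $ i * (LINT x|lborel. p x * sin (x \<bullet> \<xi> + c))"
        unfolding integral_mult_right_zero by linarith
      then show ?thesis by (simp only: abs_mult)
    qed
    also have "\<dots> \<le> ?I"
    proof (rule Bochner_Integration.integral_norm_bound_integral[where 'b=real, unfolded real_norm_def])
      show "integrable lborel (\<lambda>x. G x $ i * cos (x \<bullet> \<xi> + c))"
        by (rule Bochner_Integration.integrable_bound[OF Gi]) (auto simp: abs_mult mult_left_le)
      show "\<bar>G x $ i * cos (x \<bullet> \<xi> + c)\<bar> \<le> norm (G x)" for x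
        using component_le_norm_cart[of "G x" i] mult_left_le[of "\<bar>cos (x \<bullet> \<xi> + c)\<bar>" "\<bar>G x $ i\<bar>"]
        by (simp add: abs_mult)
    qed (use G in simp)
    finally show ?thesis .
  qed
  have i1: "integrable lborel (\<lambda>x. p x * sin (x \<bullet> \<xi>))" "integrable lborel (\<lambda>x. p x * cos (x \<bullet> \<xi>))"
    by (rule Bochner_Integration.integrable_bound[OF p]; auto simp: abs_mult mult_left_le)+
  let ?S = "LINT x|lborel. p x * sin (x \<bullet> \<xi>)" and ?C = "LINT x|lborel. p x * cos (x \<bullet> \<xi>)"
  have "(LINT x|lborel. p x *\<^sub>R iexp (x \<bullet> \<xi>)) = complex_of_real ?C + \<i> * complex_of_real ?S"
  proof -
    have "p x *\<^sub>R iexp (x \<bullet> \<xi>) = complex_of_real (p x * cos (x \<bullet> \<xi>)) + \<i> * complex_of_real (p x * sin (x \<bullet> \<xi>))" for x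
      by (simp add: exp_Euler scaleR_conv_of_real cos_of_real sin_of_real algebra_simps)
    then show ?thesis using i1 by (simp del: of_real_mult)
  qed
  then have "cmod (LINT x|lborel. p x *\<^sub>R iexp (x \<bullet> \<xi>)) \<le> \<bar>?C\<bar> + \<bar>?S\<bar>"
    using norm_triangle_ineq[of "complex_of_real ?C" "\<i> * complex_of_real ?S"] by (simp only: norm_mult norm_of_real norm_ii mult_1)
  then have "norm \<xi> * cmod (LINT x|lborel. p x *\<^sub>R iexp (x \<bullet> \<xi>)) \<le> (\<Sum>i\<in>UNIV. \<bar>\<xi> $ i\<bar>) * (\<bar>?C\<bar> + \<bar>?S\<bar>)"
    by (intro mult_mono norm_le_l1_cart sum_nonneg) auto
  also have "\<dots> = (\<Sum>i\<in>UNIV. \<bar>\<xi> $ i\<bar> * \<bar>?C\<bar> + \<bar>\<xi> $ i\<bar> * \<bar>?S\<bar>)"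
    by (simp add: sum_distrib_right distrib_left sum.distrib)
  also have "\<dots> \<le> (\<Sum>i\<in>(UNIV::'n set). 2 * ?I)"
  proof (rule sum_mono)
    fix i :: 'n
    show "\<bar>\<xi> $ i\<bar> * \<bar>?C\<bar> + \<bar>\<xi> $ i\<bar> * \<bar>?S\<bar> \<le> 2 * ?I"
      using main[of i 0] main[of i "pi / 2"] by (simp add: sin_add)
  qed
  finally show ?thesis by simp
qed

lemma test_function_outside:
  assumes "test_function \<phi>"
  shows "\<exists>r. \<forall>x. r < norm x \<longrightarrow> \<phi> x = 0 \<and> (\<forall>i. partial_deriv i \<phi> x = 0)"
proof -
  have "bounded {x. \<phi> x \<noteq> 0}"
    using assms bounded_subset[OF compact_imp_bounded closure_subset] by (auto simp: test_function_def)
  then obtain r where "\<forall>x\<in>{x. \<phi> x \<noteq> 0}. norm x \<le> r"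
    unfolding bounded_iff by blast
  then have r: "\<And>x. r < norm x \<Longrightarrow> \<phi> x = 0" by force
  moreover have "partial_deriv i \<phi> x = 0" if "r < norm x" for x i
  proof -
    have "(\<phi> has_derivative (\<lambda>_. 0)) (at x)"
      by (rule has_derivative_transform_within_open[of "\<lambda>_. 0" _ _ _ "- cball 0 r"]) (use that r in auto)
    from partial_deriv_eq[OF this] show ?thesis .
  qed
  ultimately show ?thesis by blast
qed

text \<open>\<open>p\<close> times a test function is smooth with compact support, so its partial
  derivatives integrate to 0; by the product rule this is the weak identity for the classical
  gradient.\<close>

lemma distributional_gradient_smooth:
  fixes p :: "real ^ 'n \<Rightarrow> real"
  assumes p: "C_infinity p" "integrable lborel p" and p': "\<And>i. integrable lborel (partial_deriv i p)"
  defines "G \<equiv> \<lambda>x. \<chi> i. partial_deriv i p x"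
  shows "integrable lborel G" "distributional_gradient p G"
proof -
  have loc: "locally_integrable f" if "integrable lborel f" for f :: "real ^ 'n \<Rightarrow> 'c::{banach, second_countable_topology}"
    unfolding locally_integrable_def set_integrable_def
    using that by (auto intro!: integrable_mult_indicator compact_imp_closed borel_closed)
  have "G = (\<lambda>x. \<Sum>i\<in>UNIV. partial_deriv i p x *\<^sub>R axis i 1)"
    unfolding G_def by (auto simp: vec_eq_iff axis_def if_distrib cong: if_cong)
  then show G: "integrable lborel G"
    using p' by simp
  have "(LINT x|lborel. p x * partial_deriv i \<phi> x) = - (LINT x|lborel. G x $ i * \<phi> x)" if \<phi>: "test_function \<phi>" for \<phi> i
  proof -
    have \<phi>_smooth: "C_infinity \<phi>" using \<phi> by (simp add: test_function_def)
    obtain r where r: "\<And>x. r < norm x \<Longrightarrow> \<phi> x = 0" "\<And>x i. r < norm x \<Longrightarrow> partial_deriv i \<phi> x = 0"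
      using test_function_outside[OF \<phi>] by blast
    note cont = C_infinity_continuous[OF p(1)] C_infinity_continuous[OF \<phi>_smooth]
      C_infinity_continuous[OF C_infinity_partial_deriv[OF p(1)]] C_infinity_continuous[OF C_infinity_partial_deriv[OF \<phi>_smooth]]
    have comp: "integrable lborel f" if "continuous_on UNIV f" "\<And>x. r < norm x \<Longrightarrow> f x = 0" for f :: "real ^ 'n \<Rightarrow> real"
    proof -
      have "integrable lborel (\<lambda>x. indicator (cball 0 r) x *\<^sub>R f x)"
        using borel_integrable_compact[of "cball 0 r" f] continuous_on_subset[OF that(1)] by simp
      moreover have "(\<lambda>x. indicator (cball 0 r) x *\<^sub>R f x) = f"
        using that(2) by (auto simp: indicator_def fun_eq_iff)
      ultimately show ?thesis by simp
    qed
    let ?f = "\<lambda>x. p x * \<phi> x" and ?f' = "\<lambda>x. p x * partial_deriv i \<phi> x + partial_deriv i p x * \<phi> x"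
    have int: "integrable lborel (\<lambda>x. p x * partial_deriv i \<phi> x)" "integrable lborel (\<lambda>x. partial_deriv i p x * \<phi> x)"
      by (intro comp continuous_on_mult cont; simp add: r)+
    have "continuous_on UNIV ?f'"
      by (intro continuous_on_add continuous_on_mult cont)
    from compact_imp_bounded[OF compact_continuous_image[OF continuous_on_subset[OF this subset_UNIV] compact_cball]]
    have "bounded (?f' ` cball 0 r)" .
    then obtain B where B: "\<forall>x\<in>cball 0 r. \<bar>?f' x\<bar> \<le> B"
      unfolding bounded_iff by auto
    have "(LINT x|lborel. ?f' x) = 0"
    \<comment> \<open>The ball is enlarged by 1 because shifts of length below 1 may move a point
      into the ball of radius \<open>r\<close>.\<close>
    proof (rule lborel_integral_directional_derivative(2)[of ?f "axis i 1" ?f' "\<lambda>x. \<bar>B\<bar> * indicator (cball 0 (r + 1)) x"])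
      show "integrable lborel ?f"
        by (intro comp continuous_on_mult cont) (simp add: r)
      show "((\<lambda>s. ?f (x + s *\<^sub>R axis i 1)) has_vector_derivative ?f' x) (at 0)" for x
        using has_vector_derivative_mult[OF
            partial_deriv_has_vector_derivative[OF C_infinity_differentiable[OF p(1)], of x i]
            partial_deriv_has_vector_derivative[OF C_infinity_differentiable[OF \<phi>_smooth], of x i]]
        by simp
      show "norm (?f' (x + s *\<^sub>R axis i 1)) \<le> \<bar>B\<bar> * indicator (cball 0 (r + 1)) x" if "\<bar>s\<bar> < 1" for s x
      proof (cases "norm (x + s *\<^sub>R axis i 1) \<le> r")
        case True
        have "norm x \<le> norm (x + s *\<^sub>R axis i 1) + norm (s *\<^sub>R (axis i 1 :: real ^ 'n))"
          using norm_triangle_ineq4[of "x + s *\<^sub>R axis i 1" "s *\<^sub>R axis i 1"] by simp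
        also have "norm (s *\<^sub>R (axis i 1 :: real ^ 'n)) \<le> 1" using that by simp
        finally have "norm x \<le> r + 1" using True by simp
        then show ?thesis using bspec[OF B, of "x + s *\<^sub>R axis i 1"] True by simp
      qed (simp add: r)
      show "integrable lborel (\<lambda>x::real^'n. \<bar>B\<bar> * indicator (cball 0 (r + 1)) x)"
        using emeasure_lborel_cball_finite[of "0 :: real ^ 'n" "r + 1"]
        by (intro integrable_mult_right integrable_real_indicator) (auto simp: less_top)
    qed
    then show ?thesis
      using int by (simp add: G_def)
  qed
  then show "distributional_gradient p G"
    unfolding distributional_gradient_def using loc[OF p(2)] loc[OF G] by blast
qed

section \<open>Multi-indices\<close>

lemma multi_deriv_zero: "multi_deriv (\<lambda>_. 0) f = f"
proof -
  have "foldr (\<lambda>i. partial_deriv i ^^ 0) xs f = f" for xs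
    by (induction xs) auto
  then show ?thesis by (simp add: multi_deriv_def)
qed

lemma multi_deriv_single:
  fixes f :: "real ^ 'n \<Rightarrow> real"
  shows "multi_deriv (\<lambda>j. if j = i then 1 else 0) f = partial_deriv i f"
proof -
  have "foldr (\<lambda>j. partial_deriv j ^^ (if j = i then 1 else 0)) xs f = (if i \<in> set xs then partial_deriv i f else f)"
    if "distinct xs" for xs
    using that by (induction xs) auto
  then show ?thesis
    unfolding multi_deriv_def using coordinates[where 'n='n] by auto
qed

text \<open>Spares the computation of iterated derivatives: their properties are read off from a set
  that contains \<open>f\<close> and is stable under each partial derivative.\<close>

lemma multi_deriv_closed:
  assumes "f \<in> S" "\<And>g i. g \<in> S \<Longrightarrow> partial_deriv i g \<in> S"
  shows "multi_deriv \<alpha> f \<in> S"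
proof -
  have "(partial_deriv i ^^ m) g \<in> S" if "g \<in> S" for i m g
    using that assms(2) by (induction m) auto
  then have "foldr (\<lambda>i. partial_deriv i ^^ \<alpha> i) xs f \<in> S" for xs
    using assms(1) by (induction xs) auto
  then show ?thesis by (simp add: multi_deriv_def)
qed

subsection \<open>Transition densities\<close>

lemma Re_fourier_has_derivative:
  assumes "rapid (h :: real ^ 'n \<Rightarrow> complex)"
  shows "((\<lambda>x. Re (fourier h x)) has_derivative
    (\<lambda>v. Re (fourier (\<lambda>\<xi>. (- \<i> * complex_of_real (v \<bullet> \<xi>)) * h \<xi>) x))) (at x)"
  using bounded_linear.has_derivative[OF bounded_linear_Re fourier_has_derivative[OF assms]] .

lemma partial_deriv_Re_fourier:
  assumes "rapid (h :: real ^ 'n \<Rightarrow> complex)"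
  shows "partial_deriv i (\<lambda>x. Re (fourier h x))
    = (\<lambda>x. Re (fourier (\<lambda>\<xi>. (- \<i> * complex_of_real (axis i 1 \<bullet> \<xi>)) * h \<xi>) x))"
  by (rule ext) (rule partial_deriv_eq[OF Re_fourier_has_derivative[OF assms]])

lemma C_infinity_Re_fourier:
  assumes "rapid (h :: real ^ 'n \<Rightarrow> complex)"
  shows "C_infinity (\<lambda>x. Re (fourier h x))"
proof -
  have "C_k k (\<lambda>x. Re (fourier h x))" if "rapid h" for k and h :: "real ^ 'n \<Rightarrow> complex"
    using that
  proof (induction k arbitrary: h)
    case 0
    then show ?case
      using continuous_on_Re[OF continuous_on_fourier] by simp
  next
    case (Suc k)
    have "rapid (\<lambda>\<xi>. (- \<i> * complex_of_real (axis i 1 \<bullet> \<xi>)) * h \<xi>)" for i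
      by (intro rapid_mult Suc.prems poly_bounded_mult poly_bounded_const poly_bounded_inner)
    then show ?case
      using Suc differentiableI[OF Re_fourier_has_derivative[OF Suc.prems]]
      by (simp only: C_k.simps partial_deriv_Re_fourier[OF Suc.prems] simp_thms)
  qed
  with assms show ?thesis by (simp add: C_infinity_def)
qed

lemma C_vanishing_bounded:
  assumes "C_vanishing f"
  shows "ess_bounded f"
proof -
  have cont: "continuous_on UNIV f" and lim: "(f \<longlongrightarrow> 0) at_infinity"
    using assms by (auto simp: C_vanishing_def)
  have "eventually (\<lambda>x. norm (f x) < 1) at_infinity"
    using tendstoD[OF lim, of 1] by simp
  then obtain R where R: "\<forall>x. R \<le> norm x \<longrightarrow> \<bar>f x\<bar> < 1"
    unfolding eventually_at_infinity by auto
  from compact_imp_bounded[OF compact_continuous_image[OF continuous_on_subset[OF cont subset_UNIV] compact_cball]]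
  obtain B where B: "\<forall>x\<in>cball 0 R. \<bar>f x\<bar> \<le> B"
    unfolding bounded_iff by (metis imageI real_norm_def)
  have "\<bar>f x\<bar> \<le> max B 1" for x
    using bspec[OF B, of x] spec[OF R, of x] by (cases "norm x \<le> R") auto
  then show ?thesis
    using borel_measurable_continuous_onI[OF cont] by (auto simp: ess_bounded_def)
qed

lemma transition_density_law:
  assumes "transition_density M X t p"
  shows "distr M borel (X t) = density lborel (\<lambda>x. ennreal (p x))" "p \<in> borel_measurable borel"
proof -
  have d: "distributed M lborel (X t) (\<lambda>x. ennreal (p x))" and nn: "\<And>x. 0 \<le> p x"
    using assms by (auto simp: transition_density_def)
  show "distr M borel (X t) = density lborel (\<lambda>x. ennreal (p x))"
    using distributed_distr_eq_density[OF d] by (simp cong: distr_cong)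
  have "(\<lambda>x. enn2real (ennreal (p x))) \<in> borel_measurable borel"
    using distributed_borel_measurable[OF d] by measurable
  then show "p \<in> borel_measurable borel" by (simp add: nn)
qed

locale levy_exponent = levy_process M X + levy_jumps \<nu>
  for M :: "'a measure" and X :: "real \<Rightarrow> 'a \<Rightarrow> real ^ 'n" and \<nu> :: "(real ^ 'n) measure" +
  fixes \<psi> :: "real ^ 'n \<Rightarrow> complex" and l :: "real ^ 'n"
  assumes exponent: "characteristic_exponent M X \<psi>"
    and psi_eq: "\<psi> \<xi> = \<i> * of_real (l \<bullet> \<xi>) + (LINT y|\<nu>. kern \<xi> y)"
begin

abbreviation law :: "real \<Rightarrow> (real ^ 'n) measure" where
  "law t \<equiv> distr M borel (X t)"

abbreviation char_fun :: "real \<Rightarrow> real ^ 'n \<Rightarrow> complex" where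
  "char_fun t \<xi> \<equiv> exp (- (complex_of_real t * \<psi> \<xi>))"

lemma law_char:
  assumes "0 \<le> t"
  shows "(LINT y|law t. iexp (y \<bullet> \<xi>)) = char_fun t \<xi>"
proof -
  have "(LINT y|law t. iexp (y \<bullet> \<xi>)) = (LINT \<omega>|M. iexp (X t \<omega> \<bullet> \<xi>))"
    by (rule integral_distr[OF rv[OF assms]]) measurable
  then show ?thesis
    using exponent assms unfolding characteristic_exponent_def by simp
qed

lemma prob_law: "0 \<le> t \<Longrightarrow> prob_space (law t)"
  by (rule prob_space_distr[OF rv])

lemma cmod_char_fun: "cmod (char_fun t \<xi>) = exp (- (t * Re (\<psi> \<xi>)))"
  by simp

text \<open>A characteristic function has modulus at most 1; time 1 already gives the sign.\<close>

lemma Re_psi_nonneg: "0 \<le> Re (\<psi> \<xi>)"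
proof -
  interpret N: prob_space "law 1" by (rule prob_law) simp
  have "cmod (LINT y|law 1. iexp (y \<bullet> \<xi>)) \<le> (LINT y|law 1. cmod (iexp (y \<bullet> \<xi>)))"
    by (rule integral_norm_bound)
  also have "\<dots> = 1" by (simp add: N.prob_space del: space_distr)
  finally have "exp (- (1 * Re (\<psi> \<xi>))) \<le> 1"
    using law_char[of 1 \<xi>] cmod_char_fun[of 1 \<xi>] by simp
  then show ?thesis by simp
qed

lemma measurable_char_fun: "0 \<le> t \<Longrightarrow> char_fun t \<in> borel_measurable borel"
proof -
  assume t: "0 \<le> t"
  interpret N: prob_space "law t" by (rule prob_law[OF t])
  have "(\<lambda>\<xi>. LINT y|law t. iexp (y \<bullet> \<xi>)) \<in> borel_measurable borel"
    by (rule measurable_char_function[OF N.sigma_finite_measure_axioms]) simp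
  then show ?thesis by (simp add: law_char[OF t])
qed

lemma rapid_char_fun:
  assumes a: "filterlim (\<lambda>\<xi>. Re (\<psi> \<xi>) / ln (1 + norm \<xi>)) at_top at_infinity" and t: "0 < t"
  shows "rapid (char_fun t)"
  unfolding rapid_def cmod_char_fun
  using rapid_decay_of_log_growth[OF a Re_psi_nonneg t] measurable_char_fun[of t] t by simp

lemma smooth_density:
  assumes a: "filterlim (\<lambda>\<xi>. Re (\<psi> \<xi>) / ln (1 + norm \<xi>)) at_top at_infinity" and t: "0 < t"
  shows "\<exists>p. transition_density M X t p \<and> C_infinity p \<and>
      (\<forall>\<alpha>. integrable lborel (multi_deriv \<alpha> p) \<and> C_vanishing (multi_deriv \<alpha> p))"
proof -
  \<comment> \<open>The stable set for iterated derivatives. A constant symbol gives the density,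
    and a partial derivative multiplies the symbol by a coordinate of \<xi> and
    \<open>- \<i>\<close>, which preserves slowness in every basis direction and to every
    order.\<close>
  define S where "S = {\<lambda>x. Re (fourier (\<lambda>\<xi>. P \<xi> * char_fun t \<xi>) x) | P. \<forall>e\<in>Basis. \<forall>m. slow e m P}"
  note rapid = rapid_char_fun[OF a t]
  interpret N: prob_space "law t" using t by (intro prob_law) simp
  have rapid_S: "rapid (\<lambda>\<xi>. P \<xi> * char_fun t \<xi>)" if P: "\<forall>e\<in>Basis. \<forall>m. slow e m P" for P
  proof -
    obtain e :: "real ^ 'n" where "e \<in> Basis" using nonempty_Basis by blast
    then show ?thesis using P slow_poly_bounded rapid_mult[OF _ rapid] by blast
  qed
  have S_smooth: "C_infinity f" if "f \<in> S" for f
    using that rapid_S C_infinity_Re_fourier by (auto simp: S_def)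
  have S_deriv: "partial_deriv i f \<in> S" if f: "f \<in> S" for f i
  proof -
    obtain P where P: "\<forall>e\<in>Basis. \<forall>m. slow e m P" "f = (\<lambda>x. Re (fourier (\<lambda>\<xi>. P \<xi> * char_fun t \<xi>) x))"
      using f by (auto simp: S_def)
    let ?Q = "\<lambda>\<xi>. (- \<i> * complex_of_real (axis i 1 \<bullet> \<xi>)) * P \<xi>"
    have "\<forall>e\<in>Basis. \<forall>m. slow e m ?Q"
      by (intro ballI allI slow_mult slow_const slow_inner) (use P(1) in blast)
    moreover have "partial_deriv i f = (\<lambda>x. Re (fourier (\<lambda>\<xi>. ?Q \<xi> * char_fun t \<xi>) x))"
      unfolding P(2) partial_deriv_Re_fourier[OF rapid_S[OF P(1)]] by (simp only: mult.assoc)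
    ultimately show ?thesis
      unfolding S_def by (intro CollectI exI[of _ ?Q] conjI)
  qed
  have S_int: "integrable lborel f \<and> C_vanishing f" if f: "f \<in> S" for f
  proof -
    obtain P where P: "\<forall>e\<in>Basis. \<forall>m. slow e m P" "f = (\<lambda>x. Re (fourier (\<lambda>\<xi>. P \<xi> * char_fun t \<xi>) x))"
      using f by (auto simp: S_def)
    note * = fourier_exponent_integrable_vanishing[OF psi_eq t rapid, of P]
    have "integrable lborel f"
      unfolding P(2) using P(1) by (intro integrable_Re *(1)) auto
    moreover have "(f \<longlongrightarrow> 0) at_infinity"
      unfolding P(2) using tendsto_Re[OF *(2)] P(1) by simp
    ultimately show ?thesis
      using C_infinity_continuous[OF S_smooth[OF f]] by (simp add: C_vanishing_def)
  qed
  define p where "p = (\<lambda>x. Re (fourier (\<lambda>\<xi>. LINT y|law t. iexp (y \<bullet> \<xi>)) x) / (2 * pi) ^ DIM(real ^ 'n))"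
  have char: "(\<lambda>\<xi>. LINT y|law t. iexp (y \<bullet> \<xi>)) = char_fun t"
    using t by (simp add: law_char)
  have p_S: "p \<in> S"
  proof -
    let ?c = "1 / (2 * pi) ^ DIM(real ^ 'n)"
    have "p = (\<lambda>x. Re (fourier (\<lambda>\<xi>. complex_of_real ?c * char_fun t \<xi>) x))"
      unfolding p_def char fourier_cmult by (simp del: of_real_divide of_real_power)
    then show ?thesis
      unfolding S_def by (intro CollectI exI[of _ "\<lambda>_. complex_of_real ?c"] conjI) simp_all
  qed
  have int: "integrable lborel (\<lambda>\<xi>. LINT y|law t. iexp (y \<bullet> \<xi>))"
    unfolding char by (rule rapid_integrable[OF rapid])
  note inv = fourier_inversion_density[OF N.finite_measure_axioms sets_distr int, folded p_def]
  have p_meas: "p \<in> borel_measurable borel"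
    using C_infinity_measurable[OF S_smooth[OF p_S]] .
  have nonneg: "0 \<le> p x" for x
    using inv(1)[of x] by (simp add: p_def)
  have dens: "law t = density lborel (\<lambda>x. ennreal (p x))"
    using inv(2) by (simp add: p_def)
  have "transition_density M X t p"
    unfolding transition_density_def distributed_def
    using nonneg dens p_meas rv[of t] t by (auto cong: distr_cong)
  moreover have "integrable lborel (multi_deriv \<alpha> p) \<and> C_vanishing (multi_deriv \<alpha> p)" for \<alpha>
    by (intro S_int multi_deriv_closed[of _ S] p_S S_deriv)
  ultimately show ?thesis using S_smooth[OF p_S] by blast
qed

lemma gradient_imp_growth:
  assumes "\<forall>t>0. \<exists>p G. transition_density M X t p \<and> integrable lborel p \<and>
      distributional_gradient p G \<and> integrable lborel G"
  shows "filterlim (\<lambda>\<xi>. Re (\<psi> \<xi>) / ln (1 + norm \<xi>)) at_top at_infinity"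
proof (rule log_growth_of_decay)
  fix t :: real assume t: "0 < t"
  then obtain p G where p: "transition_density M X t p" "integrable lborel p"
    "distributional_gradient p G" "integrable lborel G"
    using assms by blast
  note [measurable] = transition_density_law(2)[OF p(1)]
  have nonneg: "\<And>x. 0 \<le> p x" using p(1) by (simp add: transition_density_def)
  have "char_fun t \<xi> = (LINT x|lborel. p x *\<^sub>R iexp (x \<bullet> \<xi>))" for \<xi>
  proof -
    have "char_fun t \<xi> = (LINT y|law t. iexp (y \<bullet> \<xi>))" using t by (simp add: law_char)
    also have "\<dots> = (LINT x|lborel. p x *\<^sub>R iexp (x \<bullet> \<xi>))"
      unfolding transition_density_law(1)[OF p(1)] by (subst integral_density) (auto simp: nonneg)
    finally show ?thesis .
  qed
  then have "norm \<xi> * exp (- (t * Re (\<psi> \<xi>))) \<le> 2 * real CARD('n) * (LINT x|lborel. norm (G x))" for \<xi>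
    using fourier_decay_of_gradient[OF p(3,2,4), of \<xi>] cmod_char_fun[of t \<xi>] by simp
  then show "\<exists>C. \<forall>\<xi>. norm \<xi> * exp (- (t * Re (\<psi> \<xi>))) \<le> C" by blast
qed

lemma growth_of_integrable_char_fun:
  assumes g: "mono_on {0..} g" "\<And>\<xi>. \<psi> \<xi> = of_real (g ((norm \<xi>)\<^sup>2))"
    and f: "\<forall>t>0. integrable lborel (char_fun t)"
  shows "filterlim (\<lambda>\<xi>. Re (\<psi> \<xi>) / ln (1 + norm \<xi>)) at_top at_infinity"
proof (rule log_growth_of_decay)
  fix t :: real assume t: "0 < t"
  have Re: "Re (\<psi> \<xi>) = g ((norm \<xi>)\<^sup>2)" for \<xi> by (simp add: g(2))
  have "integrable lborel (\<lambda>\<xi>. exp (- (t * Re (\<psi> \<xi>))))"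
    using integrable_norm[of lborel "char_fun t"] f t by (simp only: cmod_char_fun)
  then show "\<exists>C. \<forall>\<xi>. norm \<xi> * exp (- (t * Re (\<psi> \<xi>))) \<le> C"
    unfolding Re using Re_psi_nonneg by (intro decay_of_radial_integrable g(1) t) (auto simp: Re)
qed

text \<open>A radial exponent with real values makes the characteristic function positive, which is
  what the Fatou argument asks for.\<close>

lemma integrable_char_fun_of_bounded_density:
  assumes g: "\<And>\<xi>. \<psi> \<xi> = of_real (g ((norm \<xi>)\<^sup>2))" and t: "0 < t"
    and p: "transition_density M X t p" "ess_bounded p"
  shows "integrable lborel (char_fun t)"
proof -
  have nonneg: "\<And>x. 0 \<le> p x" using p(1) by (simp add: transition_density_def)
  interpret N: prob_space "law t" using t by (intro prob_law) simp
  obtain C where "AE x in lborel. \<bar>p x\<bar> \<le> C"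
    using p(2) by (auto simp: ess_bounded_def)
  then have C: "AE x in lborel. p x \<le> C" by eventually_elim simp
  have eq: "char_fun t \<xi> = complex_of_real (exp (- (t * g ((norm \<xi>)\<^sup>2))))" for \<xi>
    by (simp add: g exp_of_real flip: of_real_mult of_real_minus)
  have "integrable lborel (\<lambda>\<xi>::real^'n. exp (- (t * g ((norm \<xi>)\<^sup>2))))"
    by (rule integrable_char_of_bounded_density[OF transition_density_law(2)[OF p(1)] nonneg C
          N.finite_measure_axioms transition_density_law(1)[OF p(1)]])
       (use t in \<open>simp_all only: law_char eq less_imp_le exp_ge_zero\<close>)
  then show ?thesis
    unfolding eq by (rule integrable_of_real)
qed

end

theorem theorem1:
  fixes M :: "'a measure" and X :: "real \<Rightarrow> 'a \<Rightarrow> real ^ 'n"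
    and \<psi> :: "real ^ 'n \<Rightarrow> complex"
    and l :: "real ^ 'n" and Q :: "real ^ 'n ^ 'n" and \<nu> :: "(real ^ 'n) measure"
  assumes levy: "levy_process M X"
    and exponent: "characteristic_exponent M X \<psi>"
    and repr: "levy_khintchine \<psi> l Q \<nu>"
    and no_gaussian: "Q = 0"
  defines "cond_a \<equiv> filterlim (\<lambda>\<xi>. Re (\<psi> \<xi>) / ln (1 + norm \<xi>)) at_top at_infinity"
    and "cond_b \<equiv> \<forall>t>0. \<exists>p. transition_density M X t p \<and> C_infinity p \<and>
      (\<forall>\<alpha>. integrable lborel (multi_deriv \<alpha> p) \<and> C_vanishing (multi_deriv \<alpha> p))"
    and "cond_c \<equiv> \<forall>t>0. \<exists>p G. transition_density M X t p \<and> integrable lborel p \<and>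
      distributional_gradient p G \<and> integrable lborel G"
    and "cond_d \<equiv> \<forall>t>0. \<exists>p. transition_density M X t p \<and> C_vanishing p"
    and "cond_e \<equiv> \<forall>t>0. \<exists>p. transition_density M X t p \<and> ess_bounded p"
    and "cond_f \<equiv> \<forall>t>0. integrable lborel (\<lambda>\<xi>. exp (- (complex_of_real t * \<psi> \<xi>)))"
  shows "(cond_a \<longleftrightarrow> cond_b) \<and> (cond_a \<longleftrightarrow> cond_c) \<and>
    (isotropic M X \<and> (\<exists>g. mono_on {0..} g \<and> (\<forall>\<xi>. \<psi> \<xi> = of_real (g ((norm \<xi>)\<^sup>2)))) \<longrightarrow>
      (cond_a \<longleftrightarrow> cond_d) \<and> (cond_a \<longleftrightarrow> cond_e) \<and> (cond_a \<longleftrightarrow> cond_f))"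
proof -
  interpret levy_process M X by (rule levy)
  interpret J: levy_jumps \<nu>
    by standard (use repr in \<open>auto simp: levy_khintchine_def levy_measure_def\<close>)
  interpret levy_exponent M X \<nu> \<psi> l
    by standard (use exponent repr no_gaussian in \<open>auto simp: levy_khintchine_def J.kern_def\<close>)
  \<comment> \<open>The implications close into two cycles: a, b, c, and for radial \<psi> also a,
    b, d, e, f.\<close>
  have a_b: "cond_b" if "cond_a"
    using that smooth_density unfolding cond_a_def cond_b_def by blast
  have b_c: "cond_c" if b: "cond_b"
    unfolding cond_c_def
  proof (intro allI impI)
    fix t :: real assume "0 < t"
    then obtain p where p: "transition_density M X t p" "C_infinity p"
      "\<And>\<alpha>. integrable lborel (multi_deriv \<alpha> p)"
      using b unfolding cond_b_def by blast
    \<comment> \<open>The zero multi-index recovers \<open>p\<close> itself, and the unit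
      multi-indices its first derivatives.\<close>
    have int: "integrable lborel p" "\<And>i. integrable lborel (partial_deriv i p)"
      using p(3)[of "\<lambda>_. 0"] p(3)[of "\<lambda>j. if j = _ then 1 else 0"]
      by (simp_all only: multi_deriv_zero multi_deriv_single)
    show "\<exists>p G. transition_density M X t p \<and> integrable lborel p \<and> distributional_gradient p G \<and> integrable lborel G"
      using p(1) int(1) distributional_gradient_smooth[OF p(2) int] by blast
  qed
  have c_a: "cond_a" if "cond_c"
    using that gradient_imp_growth unfolding cond_a_def cond_c_def by blast
  have b_d: "cond_d" if "cond_b"
    using that unfolding cond_b_def cond_d_def by (metis multi_deriv_zero)
  have d_e: "cond_e" if "cond_d"
    using that C_vanishing_bounded unfolding cond_d_def cond_e_def by blast
  have "cond_a \<longleftrightarrow> cond_b" "cond_a \<longleftrightarrow> cond_c"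
    using a_b b_c c_a by blast+
  moreover have "(cond_a \<longleftrightarrow> cond_d) \<and> (cond_a \<longleftrightarrow> cond_e) \<and> (cond_a \<longleftrightarrow> cond_f)"
    if g: "mono_on {0..} g" "\<forall>\<xi>. \<psi> \<xi> = of_real (g ((norm \<xi>)\<^sup>2))" for g
  proof -
    have e_f: "cond_f" if "cond_e"
      using that integrable_char_fun_of_bounded_density[of g] g(2) unfolding cond_e_def cond_f_def by blast
    have f_a: "cond_a" if "cond_f"
      using that growth_of_integrable_char_fun[of g] g unfolding cond_a_def cond_f_def by blast
    show ?thesis using a_b b_d d_e e_f f_a by blast
  qed
  ultimately show ?thesis by blast
qed

end
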